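(* Let $n\ge3$ and consider the presentation $A(B_n)=F_n\rtimes_{\rho_B}\mathcal{B}_n$ as a semidirect product. The group $\mathrm{Aut}(A(B_n),F_n)$ of automorphisms of $A(B_n)$ which leave invariant the subgroup $F_n$ is generated by the inner automorphisms of $A(B_n)$ and the automorphism $\epsilon_n$ which inverts each of the standard generators. Thus $$\mathrm{Aut}(A(B_n),F_n)=\mathrm{Inn}(A(B_n))\rtimes\langle\epsilon_n\rangle\cong\big(A(B_n)/Z(A(B_n))\big)\rtimes C_2,$$ where $Z(A(B_n))$ denotes the centre of $A(B_n)$. In particular, $\mathrm{Out}(A(B_n),F_n)\cong C_2$.
   Context: $\mathcal{B}_n$ is the $n$-string braid group with standard generators $\alpha_1,\dots,\alpha_{n-1}$. $A(B_n)$ is the Artin group of type $B_n$: standard generators $\beta_1,\dots,\beta_n$ with relations $\beta_1\beta_2\beta_1\beta_2=\beta_2\beta_1\beta_2\beta_1$, $\beta_i\beta_{i+1}\beta_i=\beta_{i+1}\beta_i\beta_{i+1}$ for $2\le i\le n-1$, and $\beta_i\beta_j=\beta_j\beta_i$ for $|i-j|\ge2$. Let $\pi_B:A(B_n)\to\mathcal{B}_n$ be the epimorphism $\beta_1\mapsto1$, $\beta_i\mapsto\alpha_{i-1}$ ($i\ge2$), with section $\alpha_i\mapsto\beta_{i+1}$. The subgroup $F_n$ is $\ker\pi_B$; it is free on $u_i=\beta_i\cdots\beta_2\beta_1\beta_2^{-1}\cdots\beta_i^{-1}$, $1\le i\le n$, and the section gives $A(B_n)=F_n\rtimes_{\rho_B}\mathcal{B}_n$,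 where $\rho_B(\alpha_i)$ sends $u_i\mapsto u_{i+1}$, $u_{i+1}\mapsto u_{i+1}^{-1}u_iu_{i+1}$ and fixes the other $u_j$. $\epsilon_n$ is the automorphism with $\epsilon_n(\beta_i)=\beta_i^{-1}$ for all $i$. For a normal subgroup $H$ of $G$, $\mathrm{Aut}(G,H)=\{\varphi\in\mathrm{Aut}(G):\varphi(H)=H\}$ and $\mathrm{Out}(G,H)=\mathrm{Aut}(G,H)/\mathrm{Inn}(G)$. $C_2$ is the group of order 2. *)

theory Defs
  imports "HOL-Algebra.Elementary_Groups" "HOL-Algebra.Bij"
begin

section \<open>Groups given by generators and relations\<close>

text \<open>A letter \<open>(x, True)\<close> stands for the generator \<open>x\<close> and \<open>(x, False)\<close> for its formal inverse.
  A relation \<open>l = r\<close> is the pair \<open>(l, r)\<close> of words.\<close>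

type_synonym 'a word = "('a \<times> bool) list"

definition words :: "'a set \<Rightarrow> 'a word set" where
  "words X = lists (X \<times> UNIV)"

inductive_set pres_cong :: "'a set \<Rightarrow> ('a word \<times> 'a word) set \<Rightarrow> ('a word \<times> 'a word) set"
  for X :: "'a set" and R :: "('a word \<times> 'a word) set"
where
  refl: "w \<in> words X \<Longrightarrow> (w, w) \<in> pres_cong X R"
| sym: "(v, w) \<in> pres_cong X R \<Longrightarrow> (w, v) \<in> pres_cong X R"
| trans: "(u, v) \<in> pres_cong X R \<Longrightarrow> (v, w) \<in> pres_cong X R \<Longrightarrow> (u, w) \<in> pres_cong X R"
| cancel: "u \<in> words X \<Longrightarrow> v \<in> words X \<Longrightarrow> x \<in> X \<Longrightarrow>
    (u @ [(x, b), (x, \<not> b)] @ v, u @ v) \<in> pres_cong X R"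
| rel: "u \<in> words X \<Longrightarrow> v \<in> words X \<Longrightarrow> (l, r) \<in> R \<Longrightarrow> l \<in> words X \<Longrightarrow> r \<in> words X \<Longrightarrow>
    (u @ l @ v, u @ r @ v) \<in> pres_cong X R"

definition pres_class :: "'a set \<Rightarrow> ('a word \<times> 'a word) set \<Rightarrow> 'a word \<Rightarrow> 'a word set" where
  "pres_class X R w = pres_cong X R `` {w}"

definition presented_group :: "'a set \<Rightarrow> ('a word \<times> 'a word) set \<Rightarrow> 'a word set monoid" where
  "presented_group X R =
     \<lparr>carrier = words X // pres_cong X R,
      monoid.mult = (\<lambda>A B. \<Union>u\<in>A. \<Union>v\<in>B. pres_class X R (u @ v)),
      one = pres_class X R []\<rparr>"

definition pres_gen :: "'a set \<Rightarrow> ('a word \<times> 'a word) set \<Rightarrow> 'a \<Rightarrow> 'a word set" where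
  "pres_gen X R x = pres_class X R [(x, True)]"

text \<open>The value of a word in \<open>H\<close> under an assignment of its generators, and the induced map on the
  presented group; the latter is meaningful when the assignment respects the relations
  (lemma \<open>pres_hom_hom\<close> below).\<close>

fun word_val :: "('b, 'c) monoid_scheme \<Rightarrow> ('a \<Rightarrow> 'b) \<Rightarrow> 'a word \<Rightarrow> 'b" where
  "word_val H f [] = \<one>\<^bsub>H\<^esub>"
| "word_val H f ((x, b) # w) = (if b then f x else inv\<^bsub>H\<^esub> (f x)) \<otimes>\<^bsub>H\<^esub> word_val H f w"

definition pres_hom ::
  "'a set \<Rightarrow> ('a word \<times> 'a word) set \<Rightarrow> ('b, 'c) monoid_scheme \<Rightarrow> ('a \<Rightarrow> 'b) \<Rightarrow> 'a word set \<Rightarrow> 'b"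
where
  "pres_hom X R H f = (\<lambda>A \<in> carrier (presented_group X R). the_elem (word_val H f ` A))"

lemma words_simps [simp]:
  "[] \<in> words X" "(l # w) \<in> words X \<longleftrightarrow> fst l \<in> X \<and> w \<in> words X"
  "u @ v \<in> words X \<longleftrightarrow> u \<in> words X \<and> v \<in> words X"
  by (auto simp: words_def mem_Times_iff)

lemma pres_cong_words: "(u, v) \<in> pres_cong X R \<Longrightarrow> u \<in> words X \<and> v \<in> words X"
  by (induction rule: pres_cong.induct) auto

lemma equiv_pres_cong: "equiv (words X) (pres_cong X R)"
proof (rule equivI)
  show "pres_cong X R \<subseteq> words X \<times> words X" by (auto dest: pres_cong_words)
  show "refl_on (words X) (pres_cong X R)" by (rule refl_onI) (rule pres_cong.refl)
  show "Relation.sym (pres_cong X R)" by (rule symI) (rule pres_cong.sym)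
  show "Relation.trans (pres_cong X R)" by (rule transI) (rule pres_cong.trans)
qed

lemma pres_cong_ctx:
  assumes "(u, v) \<in> pres_cong X R" "a \<in> words X" "b \<in> words X"
  shows "(a @ u @ b, a @ v @ b) \<in> pres_cong X R"
  using assms
proof (induction rule: pres_cong.induct)
  case (cancel u v x c)
  then show ?case using pres_cong.cancel[of "a @ u" X "v @ b" x c R] by simp
next
  case (rel u v l r)
  then show ?case using pres_cong.rel[of "a @ u" X "v @ b" l r R] by simp
next
  case (refl w)
  then show ?case by (simp add: pres_cong.refl)
next
  case (sym v w)
  then show ?case by (simp add: pres_cong.sym)
next
  case (trans u v w)
  from trans.IH(1)[OF trans.prems] trans.IH(2)[OF trans.prems] show ?case by (rule pres_cong.trans)
qed

lemma pres_class_eq: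
  "(u, v) \<in> pres_cong X R \<Longrightarrow> pres_class X R u = pres_class X R v"
  unfolding pres_class_def by (rule equiv_class_eq[OF equiv_pres_cong])

lemma in_pres_class: "v \<in> pres_class X R u \<longleftrightarrow> (u, v) \<in> pres_cong X R"
  by (simp add: pres_class_def)

lemma presented_carrier: "carrier (presented_group X R) = pres_class X R ` words X"
  by (auto simp: presented_group_def pres_class_def quotient_def)

lemma presented_one: "\<one>\<^bsub>presented_group X R\<^esub> = pres_class X R []"
  by (simp add: presented_group_def)

lemma presented_mult:
  assumes "u \<in> words X" "v \<in> words X"
  shows "pres_class X R u \<otimes>\<^bsub>presented_group X R\<^esub> pres_class X R v = pres_class X R (u @ v)"
proof -
  have "pres_class X R (u' @ v') = pres_class X R (u @ v)"
    if "u' \<in> pres_class X R u" "v' \<in> pres_class X R v" for u' v'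
  proof -
    have c: "(u, u') \<in> pres_cong X R" "(v, v') \<in> pres_cong X R"
      using that by (auto simp: in_pres_class)
    then have "(u @ v, u' @ v) \<in> pres_cong X R" "(u' @ v, u' @ v') \<in> pres_cong X R"
      using pres_cong_ctx[OF c(1), of "[]" v] pres_cong_ctx[OF c(2), of u' "[]"]
        assms pres_cong_words[OF c(1)] by auto
    then show ?thesis by (metis pres_class_eq)
  qed
  moreover have "u \<in> pres_class X R u" "v \<in> pres_class X R v"
    using assms by (auto simp: in_pres_class intro: pres_cong.refl)
  ultimately have "(\<Union>u'\<in>pres_class X R u. \<Union>v'\<in>pres_class X R v. pres_class X R (u' @ v')) =
      pres_class X R (u @ v)"
    by blast
  then show ?thesis by (simp add: presented_group_def)
qed

definition word_inv :: "'a word \<Rightarrow> 'a word" where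
  "word_inv w = rev (map (\<lambda>(x, b). (x, \<not> b)) w)"

lemma word_inv_words: "w \<in> words X \<Longrightarrow> word_inv w \<in> words X"
  by (induction w) (auto simp: word_inv_def)

lemma word_inv_cancel: "w \<in> words X \<Longrightarrow> (word_inv w @ w, []) \<in> pres_cong X R"
proof (induction w)
  case Nil
  then show ?case by (auto simp: word_inv_def intro: pres_cong.refl)
next
  case (Cons l w)
  obtain x b where l: "l = (x, b)" by force
  have "(word_inv w @ [(x, \<not> b), (x, \<not> \<not> b)] @ w, word_inv w @ w) \<in> pres_cong X R"
    using Cons.prems by (intro pres_cong.cancel word_inv_words) (auto simp: l)
  then have "(word_inv (l # w) @ l # w, word_inv w @ w) \<in> pres_cong X R"
    by (simp add: l word_inv_def)
  moreover have "(word_inv w @ w, []) \<in> pres_cong X R" using Cons by simp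
  ultimately show ?case by (rule pres_cong.trans)
qed

lemma group_presented [simp]: "group (presented_group X R)"
proof (rule groupI)
  fix A assume "A \<in> carrier (presented_group X R)"
  then obtain w where w: "A = pres_class X R w" "w \<in> words X"
    by (auto simp: presented_carrier)
  have "pres_class X R (word_inv w @ w) = pres_class X R []"
    using w(2) by (intro pres_class_eq word_inv_cancel)
  then have "pres_class X R (word_inv w) \<otimes>\<^bsub>presented_group X R\<^esub> A = \<one>\<^bsub>presented_group X R\<^esub>"
    using w by (simp add: presented_mult presented_one word_inv_words)
  then show "\<exists>B\<in>carrier (presented_group X R).
      B \<otimes>\<^bsub>presented_group X R\<^esub> A = \<one>\<^bsub>presented_group X R\<^esub>"
    using word_inv_words[OF w(2)] by (auto simp: presented_carrier)
qed (auto simp: presented_carrier presented_one presented_mult)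

lemma pres_gen_carrier [simp]: "x \<in> X \<Longrightarrow> pres_gen X R x \<in> carrier (presented_group X R)"
  by (auto simp: presented_carrier pres_gen_def)

lemma word_val_closed:
  assumes "group H" "f \<in> X \<rightarrow> carrier H" "w \<in> words X"
  shows "word_val H f w \<in> carrier H"
proof -
  interpret group H by fact
  show ?thesis using assms(2,3) by (induction w) (auto simp: Pi_iff)
qed

lemma word_val_append:
  assumes "group H" "f \<in> X \<rightarrow> carrier H" "u \<in> words X" "v \<in> words X"
  shows "word_val H f (u @ v) = word_val H f u \<otimes>\<^bsub>H\<^esub> word_val H f v"
proof -
  interpret group H by fact
  have "word_val H f w \<in> carrier H" if "w \<in> words X" for w
    using word_val_closed[OF assms(1,2) that] .
  then show ?thesis using assms(2-4) by (induction u) (auto simp: Pi_iff m_assoc)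
qed

lemma word_val_cong:
  assumes H: "group H" and f: "f \<in> X \<rightarrow> carrier H"
    and R: "\<And>l r. (l, r) \<in> R \<Longrightarrow> l \<in> words X \<Longrightarrow> r \<in> words X \<Longrightarrow> word_val H f l = word_val H f r"
    and "(u, v) \<in> pres_cong X R"
  shows "word_val H f u = word_val H f v"
  using assms(4)
proof (induction rule: pres_cong.induct)
  case (cancel u v x b)
  interpret group H by fact
  have "word_val H f ([(x, b), (x, \<not> b)] @ v) = word_val H f v"
    using word_val_closed[OF H f cancel(2)] f cancel(3)
    by (cases b) (auto simp: Pi_iff m_assoc[symmetric])
  then show ?case
    using cancel by (simp add: word_val_append[OF H f])
next
  case (rel u v l r)
  then show ?case using R[of l r] by (simp add: word_val_append[OF H f])
qed simp_all

lemma pres_hom_class: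
  assumes "group H" "f \<in> X \<rightarrow> carrier H"
    "\<And>l r. (l, r) \<in> R \<Longrightarrow> l \<in> words X \<Longrightarrow> r \<in> words X \<Longrightarrow> word_val H f l = word_val H f r"
    "w \<in> words X"
  shows "pres_hom X R H f (pres_class X R w) = word_val H f w"
proof -
  have "word_val H f v = word_val H f w" if "v \<in> pres_class X R w" for v
    using word_val_cong[OF assms(1-3), where u = w and v = v] that by (auto simp: in_pres_class)
  moreover have "w \<in> pres_class X R w"
    using assms(4) by (auto simp: in_pres_class intro: pres_cong.refl)
  ultimately have "word_val H f ` pres_class X R w = {word_val H f w}" by blast
  then show ?thesis using assms(4) by (simp add: pres_hom_def presented_carrier)
qed

lemma pres_hom_hom:
  assumes "group H" "f \<in> X \<rightarrow> carrier H"
    "\<And>l r. (l, r) \<in> R \<Longrightarrow> l \<in> words X \<Longrightarrow> r \<in> words X \<Longrightarrow> word_val H f l = word_val H f r"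
  shows "pres_hom X R H f \<in> hom (presented_group X R) H"
  by (rule homI)
    (auto simp: presented_carrier presented_mult pres_hom_class[OF assms]
      word_val_closed[OF assms(1,2)] word_val_append[OF assms(1,2)])

lemma pres_hom_gen:
  assumes "group H" "f \<in> X \<rightarrow> carrier H"
    "\<And>l r. (l, r) \<in> R \<Longrightarrow> l \<in> words X \<Longrightarrow> r \<in> words X \<Longrightarrow> word_val H f l = word_val H f r"
    "x \<in> X"
  shows "pres_hom X R H f (pres_gen X R x) = f x"
proof -
  interpret group H by fact
  have "f x \<in> carrier H" using assms(2,4) by auto
  then show ?thesis
    using pres_hom_class[OF assms(1-3), where w = "[(x, True)]"] assms(4) by (simp add: pres_gen_def)
qed

lemma hom_presented_eq:
  assumes H: "group H" and gh: "g \<in> hom (presented_group X R) H" "h \<in> hom (presented_group X R) H"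
    and eq: "\<And>x. x \<in> X \<Longrightarrow> g (pres_gen X R x) = h (pres_gen X R x)"
    and A: "A \<in> carrier (presented_group X R)"
  shows "g A = h A"
proof -
  let ?G = "presented_group X R"
  interpret G: group ?G by simp
  interpret g: group_hom ?G H g using H gh by (simp add: group_hom_def group_hom_axioms_def)
  interpret h: group_hom ?G H h using H gh by (simp add: group_hom_def group_hom_axioms_def)
  have gen: "pres_class X R [(x, b)] = (if b then pres_gen X R x else inv\<^bsub>?G\<^esub> pres_gen X R x)"
    if "x \<in> X" for x b
  proof (cases b)
    case False
    have "pres_class X R [(x, False)] \<otimes>\<^bsub>?G\<^esub> pres_gen X R x = \<one>\<^bsub>?G\<^esub>"
      using that pres_class_eq[OF pres_cong.cancel[of "[]" X "[]" x False R]]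
      by (simp add: pres_gen_def presented_mult presented_one)
    then show ?thesis
      using that False G.inv_equality[of "pres_class X R [(x, False)]" "pres_gen X R x"]
      by (simp add: presented_carrier pres_gen_def)
  qed (simp add: pres_gen_def)
  have "g (pres_class X R w) = h (pres_class X R w)" if "w \<in> words X" for w
    using that
  proof (induction w)
    case Nil
    then show ?case using g.hom_one h.hom_one by (simp add: presented_one)
  next
    case (Cons l w)
    obtain x b where l: "l = (x, b)" by force
    with Cons have x: "x \<in> X" and w: "w \<in> words X" by auto
    have c: "pres_class X R (l # w) = pres_class X R [(x, b)] \<otimes>\<^bsub>?G\<^esub> pres_class X R w"
      using presented_mult[of "[(x, b)]" X w R] x w by (simp add: l)
    have "g (pres_class X R [(x, b)]) = h (pres_class X R [(x, b)])"
      using eq[OF x] x by (simp add: gen)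
    moreover have "pres_class X R [(x, b)] \<in> carrier ?G" "pres_class X R w \<in> carrier ?G"
      using x w by (auto simp: presented_carrier)
    ultimately show ?case using Cons.IH w by (simp add: c)
  qed
  then show ?thesis using A by (auto simp: presented_carrier)
qed


section \<open>Braid groups and Artin groups of type B\<close>

abbreviation pos_word :: "'a list \<Rightarrow> 'a word" where
  "pos_word xs \<equiv> map (\<lambda>x. (x, True)) xs"

definition braid_rels :: "nat \<Rightarrow> (nat word \<times> nat word) set" where
  "braid_rels n =
     {(pos_word [i, i + 1, i], pos_word [i + 1, i, i + 1]) | i. 1 \<le> i \<and> i + 1 \<le> n - 1} \<union>
     {(pos_word [i, j], pos_word [j, i]) | i j. 1 \<le> i \<and> i + 2 \<le> j \<and> j \<le> n - 1}"

definition braid_group :: "nat \<Rightarrow> nat word set monoid" where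
  "braid_group n = presented_group {1..n - 1} (braid_rels n)"

definition alpha :: "nat \<Rightarrow> nat \<Rightarrow> nat word set" where
  "alpha n i = pres_gen {1..n - 1} (braid_rels n) i"

definition artin_B_rels :: "nat \<Rightarrow> (nat word \<times> nat word) set" where
  "artin_B_rels n =
     {(pos_word [1, 2, 1, 2], pos_word [2, 1, 2, 1])} \<union>
     {(pos_word [i, i + 1, i], pos_word [i + 1, i, i + 1]) | i. 2 \<le> i \<and> i \<le> n - 1} \<union>
     {(pos_word [i, j], pos_word [j, i]) | i j. 1 \<le> i \<and> i + 2 \<le> j \<and> j \<le> n}"

definition artin_B :: "nat \<Rightarrow> nat word set monoid" where
  "artin_B n = presented_group {1..n} (artin_B_rels n)"

definition beta :: "nat \<Rightarrow> nat \<Rightarrow> nat word set" where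
  "beta n i = pres_gen {1..n} (artin_B_rels n) i"

definition pi_B :: "nat \<Rightarrow> nat word set \<Rightarrow> nat word set" where
  "pi_B n = pres_hom {1..n} (artin_B_rels n) (braid_group n)
     (\<lambda>i. if i = 1 then \<one>\<^bsub>braid_group n\<^esub> else alpha n (i - 1))"

definition section_B :: "nat \<Rightarrow> nat word set \<Rightarrow> nat word set" where
  "section_B n = pres_hom {1..n - 1} (braid_rels n) (artin_B n) (\<lambda>i. beta n (i + 1))"

definition F_B :: "nat \<Rightarrow> nat word set set" where
  "F_B n = kernel (artin_B n) (braid_group n) (pi_B n)"

definition epsilon :: "nat \<Rightarrow> nat word set \<Rightarrow> nat word set" where
  "epsilon n = pres_hom {1..n} (artin_B_rels n) (artin_B n) (\<lambda>i. inv\<^bsub>artin_B n\<^esub> (beta n i))"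


section \<open>Automorphism groups\<close>

definition Inn :: "('a, 'b) monoid_scheme \<Rightarrow> ('a \<Rightarrow> 'a) set" where
  "Inn G = (\<lambda>g. \<lambda>x \<in> carrier G. g \<otimes>\<^bsub>G\<^esub> x \<otimes>\<^bsub>G\<^esub> inv\<^bsub>G\<^esub> g) ` carrier G"

definition Aut_pair :: "('a, 'b) monoid_scheme \<Rightarrow> 'a set \<Rightarrow> ('a \<Rightarrow> 'a) monoid" where
  "Aut_pair G H = (AutoGroup G) \<lparr>carrier := {\<phi> \<in> auto G. \<phi> ` H = H}\<rparr>"

definition Out_pair :: "('a, 'b) monoid_scheme \<Rightarrow> 'a set \<Rightarrow> ('a \<Rightarrow> 'a) set monoid" where
  "Out_pair G H = Aut_pair G H Mod Inn G"

definition center :: "('a, 'b) monoid_scheme \<Rightarrow> 'a set" where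
  "center G = {z \<in> carrier G. \<forall>x \<in> carrier G. z \<otimes>\<^bsub>G\<^esub> x = x \<otimes>\<^bsub>G\<^esub> z}"

abbreviation C2 :: "int monoid" where
  "C2 \<equiv> integer_mod_group 2"


section \<open>Semidirect products\<close>

definition internal_semidirect :: "('a, 'b) monoid_scheme \<Rightarrow> 'a set \<Rightarrow> 'a set \<Rightarrow> bool" where
  "internal_semidirect G N Q \<longleftrightarrow>
     N \<lhd> G \<and> subgroup Q G \<and> N \<inter> Q = {\<one>\<^bsub>G\<^esub>} \<and> N <#>\<^bsub>G\<^esub> Q = carrier G"

definition semidirect ::
  "('a, 'c) monoid_scheme \<Rightarrow> ('b, 'd) monoid_scheme \<Rightarrow> ('b \<Rightarrow> 'a \<Rightarrow> 'a) \<Rightarrow> ('a \<times> 'b) monoid"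
where
  "semidirect N Q \<theta> =
     \<lparr>carrier = carrier N \<times> carrier Q,
      monoid.mult = (\<lambda>(a, x) (b, y). (a \<otimes>\<^bsub>N\<^esub> \<theta> x b, x \<otimes>\<^bsub>Q\<^esub> y)),
      one = (\<one>\<^bsub>N\<^esub>, \<one>\<^bsub>Q\<^esub>)\<rparr>"

text \<open>The generator \<open>1\<close> of \<open>C2\<close> acts on \<open>G/Z(G)\<close>, with \<open>G = A(B_n)\<close>, by the automorphism induced by
  \<open>epsilon n\<close>: the coset \<open>Z g\<close> goes to its image \<open>Z (epsilon n g)\<close>.\<close>

definition epsilon_action :: "nat \<Rightarrow> int \<Rightarrow> nat word set set \<Rightarrow> nat word set set" where
  "epsilon_action n k C = (if k = 0 then C else epsilon n ` C)"


section \<open>Well-definedness of the maps above\<close>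

lemma group_artin_B [simp]: "group (artin_B n)" and group_braid [simp]: "group (braid_group n)"
  by (simp_all add: artin_B_def braid_group_def)

lemma alpha_carrier [simp]: "1 \<le> i \<Longrightarrow> i \<le> n - 1 \<Longrightarrow> alpha n i \<in> carrier (braid_group n)"
  and beta_carrier [simp]: "1 \<le> i \<Longrightarrow> i \<le> n \<Longrightarrow> beta n i \<in> carrier (artin_B n)"
  by (simp_all add: alpha_def beta_def braid_group_def artin_B_def)

lemma pos_word_words [simp]: "pos_word xs \<in> words X \<longleftrightarrow> set xs \<subseteq> X"
  by (induction xs) auto

lemma pos_word_class:
  "set xs \<subseteq> X \<Longrightarrow> pres_class X R (pos_word xs) =
     word_val (presented_group X R) (pres_gen X R) (pos_word xs)"
proof (induction xs)
  case (Cons x xs)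
  then show ?case
    using presented_mult[of "[(x, True)]" X "pos_word xs" R] by (simp add: pres_gen_def)
qed (simp add: presented_one)

lemma presented_rel:
  assumes "(pos_word xs, pos_word ys) \<in> R" "set xs \<subseteq> X" "set ys \<subseteq> X"
  shows "word_val (presented_group X R) (pres_gen X R) (pos_word xs) =
         word_val (presented_group X R) (pres_gen X R) (pos_word ys)"
  using pres_class_eq[OF pres_cong.rel[of "[]" X "[]" "pos_word xs" "pos_word ys" R]] assms
  by (simp add: pos_word_class)

lemma braid_relations:
  "1 \<le> i \<Longrightarrow> i + 1 \<le> n - 1 \<Longrightarrow>
     alpha n i \<otimes>\<^bsub>braid_group n\<^esub> alpha n (i + 1) \<otimes>\<^bsub>braid_group n\<^esub> alpha n i =
     alpha n (i + 1) \<otimes>\<^bsub>braid_group n\<^esub> alpha n i \<otimes>\<^bsub>braid_group n\<^esub> alpha n (i + 1)"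
  "1 \<le> i \<Longrightarrow> i + 2 \<le> j \<Longrightarrow> j \<le> n - 1 \<Longrightarrow>
     alpha n i \<otimes>\<^bsub>braid_group n\<^esub> alpha n j = alpha n j \<otimes>\<^bsub>braid_group n\<^esub> alpha n i"
proof -
  interpret B: group "braid_group n" by simp
  let ?v = "\<lambda>xs. word_val (braid_group n) (alpha n) (pos_word xs)"
  have r: "?v xs = ?v ys"
    if "(pos_word xs, pos_word ys) \<in> braid_rels n" "set xs \<subseteq> {1..n - 1}" "set ys \<subseteq> {1..n - 1}"
    for xs ys
  proof -
    have "alpha n = pres_gen {1..n - 1} (braid_rels n)" by (rule ext) (simp add: alpha_def)
    then show ?thesis using presented_rel[OF that] by (simp add: braid_group_def)
  qed
  show "alpha n i \<otimes>\<^bsub>braid_group n\<^esub> alpha n (i + 1) \<otimes>\<^bsub>braid_group n\<^esub> alpha n i =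
     alpha n (i + 1) \<otimes>\<^bsub>braid_group n\<^esub> alpha n i \<otimes>\<^bsub>braid_group n\<^esub> alpha n (i + 1)"
    if "1 \<le> i" "i + 1 \<le> n - 1"
  proof -
    have "?v [i, i + 1, i] = ?v [i + 1, i, i + 1]"
      using that by (intro r) (auto simp: braid_rels_def)
    then show ?thesis using that by (simp add: B.m_assoc)
  qed
  show "alpha n i \<otimes>\<^bsub>braid_group n\<^esub> alpha n j = alpha n j \<otimes>\<^bsub>braid_group n\<^esub> alpha n i"
    if "1 \<le> i" "i + 2 \<le> j" "j \<le> n - 1"
  proof -
    have "?v [i, j] = ?v [j, i]"
      using that by (intro r) (auto simp: braid_rels_def)
    then show ?thesis using that by simp
  qed
qed

lemma artin_B_relations:
  "n \<ge> 2 \<Longrightarrow>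
     beta n 1 \<otimes>\<^bsub>artin_B n\<^esub> beta n 2 \<otimes>\<^bsub>artin_B n\<^esub> beta n 1 \<otimes>\<^bsub>artin_B n\<^esub> beta n 2 =
     beta n 2 \<otimes>\<^bsub>artin_B n\<^esub> beta n 1 \<otimes>\<^bsub>artin_B n\<^esub> beta n 2 \<otimes>\<^bsub>artin_B n\<^esub> beta n 1"
  "2 \<le> i \<Longrightarrow> i \<le> n - 1 \<Longrightarrow>
     beta n i \<otimes>\<^bsub>artin_B n\<^esub> beta n (i + 1) \<otimes>\<^bsub>artin_B n\<^esub> beta n i =
     beta n (i + 1) \<otimes>\<^bsub>artin_B n\<^esub> beta n i \<otimes>\<^bsub>artin_B n\<^esub> beta n (i + 1)"
  "1 \<le> i \<Longrightarrow> i + 2 \<le> j \<Longrightarrow> j \<le> n \<Longrightarrow>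
     beta n i \<otimes>\<^bsub>artin_B n\<^esub> beta n j = beta n j \<otimes>\<^bsub>artin_B n\<^esub> beta n i"
proof -
  interpret A: group "artin_B n" by simp
  let ?v = "\<lambda>xs. word_val (artin_B n) (beta n) (pos_word xs)"
  have r: "?v xs = ?v ys"
    if "(pos_word xs, pos_word ys) \<in> artin_B_rels n" "set xs \<subseteq> {1..n}" "set ys \<subseteq> {1..n}"
    for xs ys
  proof -
    have "beta n = pres_gen {1..n} (artin_B_rels n)" by (rule ext) (simp add: beta_def)
    then show ?thesis using presented_rel[OF that] by (simp add: artin_B_def)
  qed
  show "beta n 1 \<otimes>\<^bsub>artin_B n\<^esub> beta n 2 \<otimes>\<^bsub>artin_B n\<^esub> beta n 1 \<otimes>\<^bsub>artin_B n\<^esub> beta n 2 =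
     beta n 2 \<otimes>\<^bsub>artin_B n\<^esub> beta n 1 \<otimes>\<^bsub>artin_B n\<^esub> beta n 2 \<otimes>\<^bsub>artin_B n\<^esub> beta n 1" if "n \<ge> 2"
  proof -
    have c: "beta n 1 \<in> carrier (artin_B n)" "beta n 2 \<in> carrier (artin_B n)"
      using that by auto
    have "?v [1, 2, 1, 2] = ?v [2, 1, 2, 1]"
      using that by (intro r) (auto simp: artin_B_rels_def)
    then show ?thesis using c by (simp add: A.m_assoc)
  qed
  show "beta n i \<otimes>\<^bsub>artin_B n\<^esub> beta n (i + 1) \<otimes>\<^bsub>artin_B n\<^esub> beta n i =
     beta n (i + 1) \<otimes>\<^bsub>artin_B n\<^esub> beta n i \<otimes>\<^bsub>artin_B n\<^esub> beta n (i + 1)"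
    if "2 \<le> i" "i \<le> n - 1"
  proof -
    have "?v [i, i + 1, i] = ?v [i + 1, i, i + 1]"
      using that by (intro r) (auto simp: artin_B_rels_def)
    then show ?thesis using that by (simp add: A.m_assoc)
  qed
  show "beta n i \<otimes>\<^bsub>artin_B n\<^esub> beta n j = beta n j \<otimes>\<^bsub>artin_B n\<^esub> beta n i"
    if "1 \<le> i" "i + 2 \<le> j" "j \<le> n"
  proof -
    have "?v [i, j] = ?v [j, i]"
      using that by (intro r) (auto simp: artin_B_rels_def)
    then show ?thesis using that by simp
  qed
qed

lemma artin_B_lift:
  assumes H: "group H" and f: "f \<in> {1..n} \<rightarrow> carrier H" and n: "n \<ge> 2"
    and "f 1 \<otimes>\<^bsub>H\<^esub> f 2 \<otimes>\<^bsub>H\<^esub> f 1 \<otimes>\<^bsub>H\<^esub> f 2 = f 2 \<otimes>\<^bsub>H\<^esub> f 1 \<otimes>\<^bsub>H\<^esub> f 2 \<otimes>\<^bsub>H\<^esub> f 1"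
    and "\<And>i. 2 \<le> i \<Longrightarrow> i \<le> n - 1 \<Longrightarrow>
      f i \<otimes>\<^bsub>H\<^esub> f (i + 1) \<otimes>\<^bsub>H\<^esub> f i = f (i + 1) \<otimes>\<^bsub>H\<^esub> f i \<otimes>\<^bsub>H\<^esub> f (i + 1)"
    and "\<And>i j. 1 \<le> i \<Longrightarrow> i + 2 \<le> j \<Longrightarrow> j \<le> n \<Longrightarrow> f i \<otimes>\<^bsub>H\<^esub> f j = f j \<otimes>\<^bsub>H\<^esub> f i"
  shows "pres_hom {1..n} (artin_B_rels n) H f \<in> hom (artin_B n) H"
    and "\<And>i. 1 \<le> i \<Longrightarrow> i \<le> n \<Longrightarrow> pres_hom {1..n} (artin_B_rels n) H f (beta n i) = f i"
proof -
  interpret group H by fact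
  have c: "f i \<in> carrier H" if "1 \<le> i" "i \<le> n" for i using f that by auto
  have c12: "f 1 \<in> carrier H" "f 2 \<in> carrier H" using c n by auto
  have R: "word_val H f l = word_val H f r" if "(l, r) \<in> artin_B_rels n" for l r
  proof -
    from that consider
        "l = pos_word [1, 2, 1, 2]" "r = pos_word [2, 1, 2, 1]"
      | i where "l = pos_word [i, i + 1, i]" "r = pos_word [i + 1, i, i + 1]" "2 \<le> i" "i \<le> n - 1"
      | i j where "l = pos_word [i, j]" "r = pos_word [j, i]" "1 \<le> i" "i + 2 \<le> j" "j \<le> n"
      unfolding artin_B_rels_def by blast
    then show ?thesis
    proof cases
      case 1
      then show ?thesis using c12 assms(4) by (simp add: m_assoc)
    next
      case (2 i)
      then show ?thesis using c[of i] c[of "i + 1"] assms(5)[of i] by (simp add: m_assoc)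
    next
      case (3 i j)
      then show ?thesis using c[of i] c[of j] assms(6)[of i j] by simp
    qed
  qed
  show "pres_hom {1..n} (artin_B_rels n) H f \<in> hom (artin_B n) H"
    unfolding artin_B_def by (rule pres_hom_hom[OF H f]) (rule R)
  show "pres_hom {1..n} (artin_B_rels n) H f (beta n i) = f i" if "1 \<le> i" "i \<le> n" for i
    unfolding beta_def using that by (intro pres_hom_gen[OF H f]) (auto intro: R)
qed

lemma pi_B:
  assumes n: "n \<ge> 2"
  shows pi_B_hom: "pi_B n \<in> hom (artin_B n) (braid_group n)"
    and pi_B_beta: "\<And>i. 1 \<le> i \<Longrightarrow> i \<le> n \<Longrightarrow>
      pi_B n (beta n i) = (if i = 1 then \<one>\<^bsub>braid_group n\<^esub> else alpha n (i - 1))"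
proof -
  interpret B: group "braid_group n" by simp
  let ?f = "\<lambda>i. if i = 1 then \<one>\<^bsub>braid_group n\<^esub> else alpha n (i - 1)"
  have c: "?f \<in> {1..n} \<rightarrow> carrier (braid_group n)" by auto
  have r2: "?f i \<otimes>\<^bsub>braid_group n\<^esub> ?f (i + 1) \<otimes>\<^bsub>braid_group n\<^esub> ?f i =
      ?f (i + 1) \<otimes>\<^bsub>braid_group n\<^esub> ?f i \<otimes>\<^bsub>braid_group n\<^esub> ?f (i + 1)" if "2 \<le> i" "i \<le> n - 1" for i
    using braid_relations(1)[of "i - 1" n] that by simp
  have r3: "?f i \<otimes>\<^bsub>braid_group n\<^esub> ?f j = ?f j \<otimes>\<^bsub>braid_group n\<^esub> ?f i"
    if "1 \<le> i" "i + 2 \<le> j" "j \<le> n" for i j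
    using braid_relations(2)[of "i - 1" "j - 1" n] that by auto
  have r1: "?f 1 \<otimes>\<^bsub>braid_group n\<^esub> ?f 2 \<otimes>\<^bsub>braid_group n\<^esub> ?f 1 \<otimes>\<^bsub>braid_group n\<^esub> ?f 2 =
      ?f 2 \<otimes>\<^bsub>braid_group n\<^esub> ?f 1 \<otimes>\<^bsub>braid_group n\<^esub> ?f 2 \<otimes>\<^bsub>braid_group n\<^esub> ?f 1"
    using alpha_carrier[of 1 n] n by simp
  note L = artin_B_lift[OF group_braid c n r1 r2 r3]
  show "pi_B n \<in> hom (artin_B n) (braid_group n)" unfolding pi_B_def by (rule L(1))
  show "pi_B n (beta n i) = ?f i" if "1 \<le> i" "i \<le> n" for i
    unfolding pi_B_def by (rule L(2)[OF _ _ _ _ _ that])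
qed

lemma section_B:
  shows section_B_hom: "section_B n \<in> hom (braid_group n) (artin_B n)"
    and section_B_alpha: "\<And>i. 1 \<le> i \<Longrightarrow> i \<le> n - 1 \<Longrightarrow> section_B n (alpha n i) = beta n (i + 1)"
proof -
  interpret A: group "artin_B n" by simp
  let ?f = "\<lambda>i. beta n (i + 1)"
  have f: "?f \<in> {1..n - 1} \<rightarrow> carrier (artin_B n)" by auto
  have R: "word_val (artin_B n) ?f l = word_val (artin_B n) ?f r" if "(l, r) \<in> braid_rels n" for l r
  proof -
    from that consider
        i where "l = pos_word [i, i + 1, i]" "r = pos_word [i + 1, i, i + 1]" "1 \<le> i" "i + 1 \<le> n - 1"
      | i j where "l = pos_word [i, j]" "r = pos_word [j, i]" "1 \<le> i" "i + 2 \<le> j" "j \<le> n - 1"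
      unfolding braid_rels_def by blast
    then show ?thesis
    proof cases
      case (1 i)
      then show ?thesis using artin_B_relations(2)[of "i + 1" n] by (simp add: A.m_assoc)
    next
      case (2 i j)
      then show ?thesis using artin_B_relations(3)[of "i + 1" "j + 1" n] by simp
    qed
  qed
  show "section_B n \<in> hom (braid_group n) (artin_B n)"
    unfolding section_B_def braid_group_def
    by (rule pres_hom_hom[OF group_artin_B f]) (rule R)
  show "section_B n (alpha n i) = beta n (i + 1)" if "1 \<le> i" "i \<le> n - 1" for i
    unfolding section_B_def alpha_def
    by (rule pres_hom_gen[OF group_artin_B f R]) (use that in auto)
qed

lemma pi_B_section_B:
  assumes "n \<ge> 2" "b \<in> carrier (braid_group n)"
  shows "pi_B n (section_B n b) = b"
proof -
  have "(pi_B n \<circ> section_B n) b = id b"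
  proof (rule hom_presented_eq[where H = "braid_group n" and g = "pi_B n \<circ> section_B n" and h = id
        and X = "{1..n - 1}" and R = "braid_rels n"])
    show "pi_B n \<circ> section_B n \<in> hom (presented_group {1..n - 1} (braid_rels n)) (braid_group n)"
      using Group.hom_compose[OF section_B_hom pi_B_hom[OF assms(1)]] by (simp add: braid_group_def)
    show "id \<in> hom (presented_group {1..n - 1} (braid_rels n)) (braid_group n)"
      by (simp add: braid_group_def hom_def)
    show "b \<in> carrier (presented_group {1..n - 1} (braid_rels n))"
      using assms(2) by (simp add: braid_group_def)
    show "(pi_B n \<circ> section_B n) (pres_gen {1..n - 1} (braid_rels n) i) =
        id (pres_gen {1..n - 1} (braid_rels n) i)" if "i \<in> {1..n - 1}" for i
      using section_B_alpha[of i n] pi_B_beta[OF assms(1), of "i + 1"] that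
      by (auto simp: alpha_def)
  qed simp
  then show ?thesis by simp
qed

lemma F_B_normal: "n \<ge> 2 \<Longrightarrow> F_B n \<lhd> artin_B n"
  unfolding F_B_def
  by (intro group_hom.normal_kernel) (simp add: group_hom_def group_hom_axioms_def pi_B_hom)

lemma epsilon:
  assumes n: "n \<ge> 2"
  shows epsilon_hom: "epsilon n \<in> hom (artin_B n) (artin_B n)"
    and epsilon_beta: "\<And>i. 1 \<le> i \<Longrightarrow> i \<le> n \<Longrightarrow> epsilon n (beta n i) = inv\<^bsub>artin_B n\<^esub> (beta n i)"
proof -
  interpret A: group "artin_B n" by simp
  let ?f = "\<lambda>i. inv\<^bsub>artin_B n\<^esub> (beta n i)"
  have f: "?f \<in> {1..n} \<rightarrow> carrier (artin_B n)" by auto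
  have r1: "?f 1 \<otimes>\<^bsub>artin_B n\<^esub> ?f 2 \<otimes>\<^bsub>artin_B n\<^esub> ?f 1 \<otimes>\<^bsub>artin_B n\<^esub> ?f 2 =
      ?f 2 \<otimes>\<^bsub>artin_B n\<^esub> ?f 1 \<otimes>\<^bsub>artin_B n\<^esub> ?f 2 \<otimes>\<^bsub>artin_B n\<^esub> ?f 1"
  proof -
    have "beta n 1 \<in> carrier (artin_B n)" "beta n 2 \<in> carrier (artin_B n)" using n by auto
    then show ?thesis
      using arg_cong[OF artin_B_relations(1)[OF n], of "m_inv (artin_B n)"]
      by (simp add: A.inv_mult_group A.m_assoc)
  qed
  have r2: "?f i \<otimes>\<^bsub>artin_B n\<^esub> ?f (i + 1) \<otimes>\<^bsub>artin_B n\<^esub> ?f i =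
      ?f (i + 1) \<otimes>\<^bsub>artin_B n\<^esub> ?f i \<otimes>\<^bsub>artin_B n\<^esub> ?f (i + 1)" if "2 \<le> i" "i \<le> n - 1" for i
    using arg_cong[OF artin_B_relations(2)[OF that], of "m_inv (artin_B n)"] that
    by (simp add: A.inv_mult_group A.m_assoc)
  have r3: "?f i \<otimes>\<^bsub>artin_B n\<^esub> ?f j = ?f j \<otimes>\<^bsub>artin_B n\<^esub> ?f i"
    if "1 \<le> i" "i + 2 \<le> j" "j \<le> n" for i j
    using arg_cong[OF artin_B_relations(3)[OF that], of "m_inv (artin_B n)"] that
    by (simp add: A.inv_mult_group)
  note L = artin_B_lift[OF group_artin_B f n r1 r2 r3]
  show "epsilon n \<in> hom (artin_B n) (artin_B n)" unfolding epsilon_def by (rule L(1))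
  show "epsilon n (beta n i) = ?f i" if "1 \<le> i" "i \<le> n" for i
    unfolding epsilon_def by (rule L(2)[OF _ _ _ _ _ that])
qed

lemma epsilon_epsilon:
  assumes "n \<ge> 2" "a \<in> carrier (artin_B n)"
  shows "epsilon n (epsilon n a) = a"
proof -
  interpret A: group "artin_B n" by simp
  interpret e: group_hom "artin_B n" "artin_B n" "epsilon n"
    using epsilon_hom[OF assms(1)] by (simp add: group_hom_def group_hom_axioms_def)
  have "(epsilon n \<circ> epsilon n) a = id a"
  proof (rule hom_presented_eq[where H = "artin_B n" and g = "epsilon n \<circ> epsilon n" and h = id
        and X = "{1..n}" and R = "artin_B_rels n"])
    show "epsilon n \<circ> epsilon n \<in> hom (presented_group {1..n} (artin_B_rels n)) (artin_B n)"
      using Group.hom_compose[OF epsilon_hom epsilon_hom] assms(1) by (simp add: artin_B_def)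
    show "id \<in> hom (presented_group {1..n} (artin_B_rels n)) (artin_B n)"
      by (simp add: artin_B_def hom_def)
    show "a \<in> carrier (presented_group {1..n} (artin_B_rels n))"
      using assms(2) by (simp add: artin_B_def)
    show "(epsilon n \<circ> epsilon n) (pres_gen {1..n} (artin_B_rels n) i) =
        id (pres_gen {1..n} (artin_B_rels n) i)" if "i \<in> {1..n}" for i
      using epsilon_beta[OF assms(1), of i] beta_carrier[of i n] that e.hom_inv[of "beta n i"]
      unfolding beta_def[symmetric] by simp
  qed simp
  then show ?thesis by simp
qed

lemma epsilon_auto:
  assumes "n \<ge> 2"
  shows "epsilon n \<in> auto (artin_B n)"
proof -
  have "epsilon n \<in> carrier (artin_B n) \<rightarrow> carrier (artin_B n)"
    using epsilon_hom[OF assms] by (simp add: hom_def)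
  then have "bij_betw (epsilon n) (carrier (artin_B n)) (carrier (artin_B n))"
    using epsilon_epsilon[OF assms] by (intro bij_betwI[where g = "epsilon n"]) auto
  moreover have "epsilon n \<in> extensional (carrier (artin_B n))"
    by (simp add: epsilon_def pres_hom_def artin_B_def)
  ultimately show ?thesis
    using epsilon_hom[OF assms] by (simp add: auto_def Bij_def)
qed

end

theory Submission
  imports Defs
begin

text \<open>An automorphism \<open>\<phi>\<close> preserving \<open>F\<^sub>n\<close> restricts to an automorphism \<open>f\<close> of \<open>F\<^sub>n\<close> that normalizes the
  action of \<open>A(B\<^sub>n)\<close>. Hence \<open>f\<close> maps conjugacy classes with a finite orbit to such classes. The squares
  of the braid generators act, up to sign, as twists: conjugation by \<open>u\<^sub>i u\<^sub>i\<^sub>+\<^sub>1\<close> on \<open>u\<^sub>i\<close> and \<open>u\<^sub>i\<^sub>+\<^sub>1\<close>, the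
  identity on the other generators. A cyclically reduced word whose images under all powers of a twist
  stay bounded, if it mixes \<open>u\<^sub>i\<close>, \<open>u\<^sub>i\<^sub>+\<^sub>1\<close> with other generators, is a product of powers of \<open>u\<^sub>i u\<^sub>i\<^sub>+\<^sub>1\<close> and of
  the others; so the only classes with a finite orbit are those of the powers of a generator and of
  \<open>\<delta> = u\<^sub>1 \<dots> u\<^sub>n\<close>. It follows that, up to composing \<open>\<phi>\<close> with \<open>\<epsilon>\<^sub>n\<close>, \<open>f\<close> sends each \<open>u\<^sub>i\<close> to a conjugate of
  some \<open>u\<^sub>j\<close> and \<open>\<delta>\<close> to a conjugate of \<open>\<delta>\<close>. By Artin's characterization, for which Hurwitz moves shorten
  the conjugating words, \<open>f\<close> is then a braid automorphism up to conjugation, and after composing with an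
  inner automorphism \<open>\<phi>\<close> is the identity on \<open>F\<^sub>n\<close>.

  The braid group acts faithfully (induction on the number of strings, forgetting one string), so the
  centralizer of \<open>F\<^sub>n\<close> is generated by one element \<open>\<zeta>\<close>, the \<open>n\<close>-th power of an element that permutes the
  \<open>u\<^sub>i\<close> cyclically. An automorphism that is the identity on \<open>F\<^sub>n\<close> multiplies each generator by a power of
  \<open>\<zeta>\<close>, and since \<open>\<zeta>\<close> has degree \<open>n (n - 1) > 2\<close> in the abelianization of the braid group, surjectivity
  forces these powers to be trivial.\<close>

section \<open>Free groups as groups of reduced words\<close>

text \<open>Only the presentations are given, so freeness of the \<open>u_i\<close> and faithfulness
  of the braid action have to be established as well. Both rest on one affine action:
  \<open>A(B_n)\<close> acts on the free group by \<open>x \<mapsto> ev a + rho (pi a) x\<close>,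
  which recovers the free component of an element and yields the normal form
  \<open>kap (ev a)\<close> times \<open>section_B (pi a)\<close>. Sending \<open>beta 1\<close> to
  the square of \<open>alpha 1\<close> maps \<open>A(B_n)\<close> to braids on one more string that
  fix the first one, and the normal form then reduces faithfulness for \<open>n + 1\<close> strings
  to faithfulness for \<open>n\<close>. The classification of classes with finite orbit is a
  pigeonhole argument: there are finitely many words of bounded length over a finite alphabet, so a
  nontrivial power of the twist fixes a rotated word, and centralizers of powers of positive words
  with distinct letters are found by comparing lengths. The hypothesis \<open>n \<ge> 3\<close>
  enters there, since three generators do not fit into one pair \<open>{i, Suc i}\<close>, and in
  the degree argument, since \<open>n (n - 1)\<close> is only 2 for \<open>n = 2\<close>.\<close>

definition neg :: "'a \<times> bool \<Rightarrow> 'a \<times> bool" where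
  "neg l = (fst l, \<not> snd l)"

lemma neg_neg [simp]: "neg (neg l) = l"
  and fst_neg [simp]: "fst (neg l) = fst l"
  and snd_neg [simp]: "snd (neg l) = (\<not> snd l)"
  and neg_neq [simp]: "neg l \<noteq> l" "l \<noteq> neg l"
  and neg_Pair [simp]: "neg (a, b) = (a, \<not> b)"
  by (auto simp: neg_def prod_eq_iff)

lemma neg_inject [simp]: "neg l = neg m \<longleftrightarrow> l = m"
  by (metis neg_neg)

lemma neg_swap: "neg l = m \<longleftrightarrow> l = neg m"
  by auto

abbreviation reduced :: "'a word \<Rightarrow> bool" where
  "reduced \<equiv> successively (\<lambda>l m. m \<noteq> neg l)"

definition push :: "'a \<times> bool \<Rightarrow> 'a word \<Rightarrow> 'a word" where
  "push l w = (case w of [] \<Rightarrow> [l] | m # v \<Rightarrow> if m = neg l then v else l # w)"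

lemma push_reduced: "reduced w \<Longrightarrow> reduced (push l w)"
  by (auto simp: push_def successively_Cons split: list.splits)

lemma push_neg: "reduced w \<Longrightarrow> push (neg l) (push l w) = w"
  by (auto simp: push_def successively_Cons split: list.splits)

lemma push_neg': "reduced w \<Longrightarrow> push l (push (neg l) w) = w"
  using push_neg[of w "neg l"] by simp

lemma push_Cons: "reduced (l # w) \<Longrightarrow> push l w = l # w"
  by (auto simp: push_def successively_Cons split: list.splits)

lemma foldr_push_reduced: "reduced w \<Longrightarrow> reduced (foldr push u w)"
  by (induction u) (auto intro: push_reduced)

lemma foldr_push_Nil: "reduced w \<Longrightarrow> foldr push w [] = w"
  by (induction w) (auto simp: push_Cons successively_Cons)

text \<open>Letters act on reduced words by mutually inverse maps, so a cancellation inside the left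
  factor does not change how it acts. Associativity follows without a confluence argument on
  words.\<close>

lemma foldr_push_push:
  "reduced w \<Longrightarrow> foldr push (push l u) w = push l (foldr push u w)"
  by (auto simp: push_def[of l u] push_neg' foldr_push_reduced split: list.splits)

lemma foldr_push_assoc:
  "reduced c \<Longrightarrow> foldr push (foldr push a b) c = foldr push a (foldr push b c)"
  by (induction a) (auto simp: foldr_push_push foldr_push_reduced)

lemma word_inv_simps [simp]:
  "word_inv [] = []" "word_inv (l # w) = word_inv w @ [neg l]"
  "word_inv (u @ v) = word_inv v @ word_inv u" "length (word_inv w) = length w"
  "word_inv w = [] \<longleftrightarrow> w = []"
  by (auto simp: word_inv_def neg_def split: prod.splits)

lemma word_inv_word_inv [simp]: "word_inv (word_inv w) = w"
  by (induction w) auto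

lemma hd_word_inv: "w \<noteq> [] \<Longrightarrow> hd (word_inv w) = neg (last w)"
  by (induction w rule: rev_induct) auto

lemma last_word_inv: "w \<noteq> [] \<Longrightarrow> last (word_inv w) = neg (hd w)"
  by (cases w) auto

lemma set_word_inv: "set (word_inv w) = neg ` set w"
  by (induction w) auto

lemma reduced_word_inv [simp]: "reduced (word_inv w) \<longleftrightarrow> reduced w"
proof -
  have "reduced (word_inv w)" if "reduced w" for w :: "'a word"
    using that
    by (induction w) (auto simp: successively_append_iff successively_Cons last_word_inv)
  then show ?thesis by (metis word_inv_word_inv)
qed

lemma foldr_push_word_inv: "reduced w \<Longrightarrow> foldr push (word_inv u) (foldr push u w) = w"
  by (induction u arbitrary: w) (auto simp: push_neg foldr_push_reduced)

text \<open>The group structure is written additively, so that the (noncommutative) type class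
  \<open>group_add\<close> is available.\<close>

typedef 'a fg = "{w :: 'a word. reduced w}" morphisms wd Abs_fg
  by (rule exI[of _ "[]"]) simp

lemma reduced_wd [simp]: "reduced (wd x)"
  using wd[of x] by simp

lemma wd_Abs_fg: "reduced w \<Longrightarrow> wd (Abs_fg w) = w"
  by (simp add: Abs_fg_inverse)

instantiation fg :: (type) group_add
begin

definition zero_fg_def: "0 = Abs_fg []"
definition plus_fg_def: "x + y = Abs_fg (foldr push (wd x) (wd y))"
definition uminus_fg_def: "- x = Abs_fg (word_inv (wd x))"
definition minus_fg_def: "(x :: 'a fg) - y = x + - y"

instance
proof
  fix a b c :: "'a fg"
  show "a + b + c = a + (b + c)"
    by (simp add: plus_fg_def wd_Abs_fg foldr_push_reduced foldr_push_assoc)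
  show "0 + a = a"
    by (simp add: plus_fg_def zero_fg_def wd_Abs_fg wd_inverse)
  show "a + 0 = a"
    by (simp add: plus_fg_def zero_fg_def wd_Abs_fg foldr_push_Nil wd_inverse)
  show "- a + a = 0"
    using foldr_push_word_inv[of "[]" "wd a"]
    by (simp add: plus_fg_def zero_fg_def uminus_fg_def wd_Abs_fg foldr_push_Nil)
  show "a + - b = a - b"
    by (simp add: minus_fg_def)
qed

end

definition fw :: "'a word \<Rightarrow> 'a fg" where
  "fw w = Abs_fg (foldr push w [])"

definition gen :: "'a \<Rightarrow> 'a fg" where
  "gen a = fw [(a, True)]"

lemma fw_wd [simp]: "fw (wd x) = x"
  by (simp add: fw_def foldr_push_Nil wd_inverse)

lemma wd_fw: "reduced w \<Longrightarrow> wd (fw w) = w"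
  by (simp add: fw_def foldr_push_Nil wd_Abs_fg)

lemma wd_fw': "wd (fw w) = foldr push w []"
  by (simp add: fw_def foldr_push_reduced wd_Abs_fg)

lemma fw_Nil [simp]: "fw [] = 0"
  by (simp add: fw_def zero_fg_def)

lemma fw_append [simp]: "fw (u @ v) = fw u + fw v"
proof -
  have "foldr push u (foldr push v []) = foldr push (foldr push u []) (foldr push v [])"
    by (simp add: foldr_push_assoc foldr_push_reduced)
  then show ?thesis
    by (simp add: fw_def plus_fg_def wd_Abs_fg foldr_push_reduced)
qed

lemma fw_word_inv: "fw (word_inv w) = - fw w"
proof -
  have "fw (word_inv w) + fw w = 0"
    using foldr_push_word_inv[of "[]" w] unfolding fw_append[symmetric] by (simp add: fw_def zero_fg_def)
  then show ?thesis by (simp add: eq_neg_iff_add_eq_0)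
qed

lemma fw_single: "fw [(a, b)] = (if b then gen a else - gen a)"
  using fw_word_inv[of "[(a, True)]"] by (simp add: gen_def)

lemma fw_Cons: "fw ((a, b) # w) = (if b then gen a else - gen a) + fw w"
  using fw_append[of "[(a, b)]" w] by (simp add: fw_single)

lemma wd_eq_iff: "wd x = wd y \<longleftrightarrow> x = y"
  by (metis fw_wd)

lemma wd_uminus: "wd (- x) = word_inv (wd x)"
  by (simp add: uminus_fg_def wd_Abs_fg)

lemma wd_plus: "reduced (wd x @ wd y) \<Longrightarrow> wd (x + y) = wd x @ wd y"
  by (metis fw_append fw_wd wd_fw)

lemma wd_zero [simp]: "wd 0 = []"
  by (simp add: zero_fg_def wd_Abs_fg)

lemma wd_Nil_iff [simp]: "wd x = [] \<longleftrightarrow> x = 0"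
  by (metis fw_Nil fw_wd wd_zero)

lemma wd_gen [simp]: "wd (gen a) = [(a, True)]"
  by (simp add: gen_def wd_fw)

lemma fg_induct [case_names zero gen neg]:
  assumes "P 0" "\<And>a x. P x \<Longrightarrow> P (gen a + x)" "\<And>a x. P x \<Longrightarrow> P (- gen a + x)"
  shows "P x"
proof -
  have "P (fw w)" for w
    by (induction w) (auto simp: fw_Cons assms)
  then show ?thesis by (metis fw_wd)
qed

definition len :: "'a fg \<Rightarrow> nat" where
  "len x = length (wd x)"

lemma length_push: "length (push l w) \<le> Suc (length w)"
  by (auto simp: push_def split: list.splits)

lemma length_foldr_push: "length (foldr push u w) \<le> length u + length w"
  by (induction u) (auto intro: order.trans[OF length_push])

lemma len_fw: "len (fw w) \<le> length w"
  using length_foldr_push[of w "[]"] by (simp add: len_def wd_fw')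

lemma len_fw_eq: "reduced w \<Longrightarrow> len (fw w) = length w"
  by (simp add: len_def wd_fw)

lemma len_plus: "len (x + y) \<le> len x + len y"
  using len_fw[of "wd x @ wd y"] by (simp add: len_def)

lemma len_uminus [simp]: "len (- x) = len x"
  by (simp add: len_def wd_uminus)

lemma len_zero [simp]: "len 0 = 0"
  and len_eq_0 [simp]: "len x = 0 \<longleftrightarrow> x = 0"
  by (auto simp: len_def)

lemma foldr_push_less:
  assumes "\<not> reduced (u @ v)" "reduced u" "reduced v"
  shows "length (foldr push u v) < length u + length v"
  using assms
proof (induction u)
  case (Cons l u)
  show ?case
  proof (cases "reduced (u @ v)")
    case True
    then have "foldr push u v = u @ v" using foldr_push_Nil[of "u @ v"] Cons.prems
      by (simp add: foldr_push_Nil)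
    moreover obtain v' where v': "u @ v = neg l # v'"
      using Cons.prems True by (cases "u @ v") (auto simp: successively_Cons)
    moreover have "length u + length v = Suc (length v')"
      using arg_cong[OF v', of length] by simp
    ultimately have "foldr push u v = neg l # v'" "length u + length v = Suc (length v')"
      by simp_all
    then show ?thesis by (simp add: push_def[of l "neg l # v'"])
  next
    case False
    then have "length (foldr push u v) < length u + length v"
      using Cons by (auto simp: successively_Cons)
    then show ?thesis using length_push[of l "foldr push u v"] by simp
  qed
qed simp

text \<open>Any cancellation strictly shortens the product. This is how commutation in the group is
  turned into an equality of concatenated words.\<close>

lemma len_plus_eq_imp_reduced:
  "len (x + y) = len x + len y \<Longrightarrow> reduced (wd x @ wd y)"
  using foldr_push_less[of "wd x" "wd y"]
  by (force simp: len_def plus_fg_def wd_Abs_fg foldr_push_reduced)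


subsection \<open>Homomorphisms\<close>

definition additive_map :: "('a::group_add \<Rightarrow> 'b::group_add) \<Rightarrow> bool" where
  "additive_map f \<longleftrightarrow> (\<forall>x y. f (x + y) = f x + f y)"

lemma additive_plus: "additive_map f \<Longrightarrow> f (x + y) = f x + f y"
  by (simp add: additive_map_def)

lemma additive_zero: "additive_map f \<Longrightarrow> f 0 = 0"
  using additive_plus[of f 0 0] add_left_cancel[of "f 0" "f 0" 0] by simp

lemma additive_uminus: "additive_map f \<Longrightarrow> f (- x) = - f x"
  using additive_plus[of f "- x" x] by (simp add: additive_zero eq_neg_iff_add_eq_0)

lemma additive_minus: "additive_map f \<Longrightarrow> f (x - y) = f x - f y"
  using additive_plus[of f x "- y"] by (simp add: additive_uminus)

lemmas additive_simps = additive_plus additive_zero additive_uminus additive_minus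

lemma additive_comp: "additive_map f \<Longrightarrow> additive_map g \<Longrightarrow> additive_map (f \<circ> g)"
  by (simp add: additive_map_def)

lemma additive_id [simp]: "additive_map id" "additive_map (\<lambda>x. x)"
  by (simp_all add: additive_map_def)

lemma additive_eq:
  assumes "additive_map f" "additive_map g" "\<And>a. f (gen a) = g (gen a)"
  shows "f = g"
proof
  fix x show "f x = g x"
    by (induction x rule: fg_induct)
      (simp_all add: additive_simps[OF assms(1)] additive_simps[OF assms(2)] assms(3))
qed

primrec wval :: "('a \<Rightarrow> 'b::group_add) \<Rightarrow> 'a word \<Rightarrow> 'b" where
  "wval f [] = 0"
| "wval f (l # w) = (if snd l then f (fst l) else - f (fst l)) + wval f w"

definition fext :: "('a \<Rightarrow> 'b::group_add) \<Rightarrow> 'a fg \<Rightarrow> 'b" where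
  "fext f x = wval f (wd x)"

lemma wval_push: "wval f (push l w) = (if snd l then f (fst l) else - f (fst l)) + wval f w"
proof (cases w)
  case (Cons m v)
  then show ?thesis
    by (cases "m = neg l") (auto simp: push_def simp del: add_uminus_conv_diff)
qed (simp add: push_def)

lemma wval_foldr_push: "wval f (foldr push u w) = wval f u + wval f w"
  by (induction u) (auto simp: wval_push add.assoc)

lemma additive_fext [simp]: "additive_map (fext f)"
  by (simp add: additive_map_def fext_def plus_fg_def wd_Abs_fg foldr_push_reduced wval_foldr_push)

lemmas fext_simps [simp] = additive_simps[OF additive_fext]

lemma fext_gen [simp]: "fext f (gen a) = f a"
  by (simp add: fext_def)

subsection \<open>Subgroups generated by sets of generators, exponent sums, powers\<close>

definition supp_in :: "'a set \<Rightarrow> 'a fg set" where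
  "supp_in S = {x. fst ` set (wd x) \<subseteq> S}"

lemma set_push: "set (push l w) \<subseteq> insert l (set w)"
  by (cases w) (auto simp: push_def)

lemma set_foldr_push: "set (foldr push u w) \<subseteq> set u \<union> set w"
  by (induction u) (auto dest!: subsetD[OF set_push])

lemma fw_supp_in: "fst ` set w \<subseteq> S \<Longrightarrow> fw w \<in> supp_in S"
  using set_foldr_push[of w "[]"] by (auto simp: supp_in_def wd_fw' image_subset_iff)

lemma supp_in_closed:
  "0 \<in> supp_in S" "x \<in> supp_in S \<Longrightarrow> y \<in> supp_in S \<Longrightarrow> x + y \<in> supp_in S"
  "x \<in> supp_in S \<Longrightarrow> - x \<in> supp_in S"
  "x \<in> supp_in S \<Longrightarrow> y \<in> supp_in S \<Longrightarrow> x - y \<in> supp_in S"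
  "a \<in> S \<Longrightarrow> gen a \<in> supp_in S"
proof -
  show p: "x + y \<in> supp_in S" if "x \<in> supp_in S" "y \<in> supp_in S" for x y
    using fw_supp_in[of "wd x @ wd y" S] that by (auto simp: supp_in_def)
  show m: "- x \<in> supp_in S" if "x \<in> supp_in S" for x
    using that by (force simp: supp_in_def wd_uminus set_word_inv)
  show "x - y \<in> supp_in S" if "x \<in> supp_in S" "y \<in> supp_in S" for x y
    using p[OF that(1) m[OF that(2)]] by simp
qed (auto simp: supp_in_def)

lemma supp_in_induct [consumes 1, case_names zero gen neg]:
  assumes "x \<in> supp_in S"
    and "P 0" "\<And>a x. a \<in> S \<Longrightarrow> x \<in> supp_in S \<Longrightarrow> P x \<Longrightarrow> P (gen a + x)"
    "\<And>a x. a \<in> S \<Longrightarrow> x \<in> supp_in S \<Longrightarrow> P x \<Longrightarrow> P (- gen a + x)"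
  shows "P x"
proof -
  have "P (fw w)" if "fst ` set w \<subseteq> S" for w
    using that
  proof (induction w)
    case (Cons l w)
    then show ?case by (cases l) (auto simp: fw_Cons intro!: assms(3,4) fw_supp_in)
  qed (simp add: assms)
  then show ?thesis using assms(1) unfolding supp_in_def by (metis fw_wd mem_Collect_eq)
qed

lemma additive_eq_on:
  assumes "additive_map f" "additive_map g" "\<And>a. a \<in> S \<Longrightarrow> f (gen a) = g (gen a)" "x \<in> supp_in S"
  shows "f x = g x"
  using assms(4)
  by (induction rule: supp_in_induct)
    (simp_all add: additive_simps[OF assms(1)] additive_simps[OF assms(2)] assms(3))

definition expo :: "'a \<Rightarrow> 'a fg \<Rightarrow> int" where
  "expo a = fext (\<lambda>b. if b = a then 1 else 0)"

lemma expo_simps [simp]: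
  "expo a (x + y) = expo a x + expo a y" "expo a 0 = 0" "expo a (- x) = - expo a x"
  "expo a (x - y) = expo a x - expo a y" "expo a (gen b) = (if b = a then 1 else 0)"
  by (simp_all add: expo_def)

definition npow :: "nat \<Rightarrow> 'a::group_add \<Rightarrow> 'a" where
  "npow k x = sum_list (replicate k x)"

lemma npow_simps [simp]: "npow 0 x = 0" "npow (Suc k) x = x + npow k x" "npow k 0 = 0"
  by (auto simp: npow_def sum_list_replicate) (induction k; simp)

lemma npow_add: "npow (j + k) x = npow j x + npow k x"
  by (simp add: npow_def replicate_add)

lemma npow_Suc': "npow (Suc k) x = npow k x + x"
  using npow_add[of k 1 x] by simp

lemma additive_npow: "additive_map f \<Longrightarrow> f (npow k x) = npow k (f x)"
  by (induction k) (auto simp: additive_simps)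

lemma npow_conj: "npow k (y + x - y) = y + npow k x - (y::'a::group_add)"
  by (induction k) (simp_all add: diff_conv_add_uminus add.assoc del: add_uminus_conv_diff)

lemma npow_uminus: "npow k (- x) = - npow k (x::'a::group_add)"
proof (induction k)
  case (Suc k)
  have "npow (Suc k) (- x) = - (npow k x + x)" by (simp add: Suc minus_add)
  then show ?case by (simp only: npow_Suc')
qed simp

lemma expo_npow [simp]: "expo a (npow k x) = int k * expo a x"
  by (induction k) (auto simp: algebra_simps)

lemma fw_replicate: "fw (concat (replicate k w)) = npow k (fw w)"
  by (induction k) auto

lemma npow_supp_in: "x \<in> supp_in S \<Longrightarrow> npow k x \<in> supp_in S"
  by (induction k) (auto intro: supp_in_closed)

section \<open>Conjugacy\<close>

definition conjg :: "'a::group_add \<Rightarrow> 'a \<Rightarrow> bool" where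
  "conjg x y \<longleftrightarrow> (\<exists>g. x = g + y - g)"

lemma conjg_refl [simp]: "conjg x x"
  unfolding conjg_def by (rule exI[of _ 0]) simp

lemma conjgI: "conjg (g + y - g) y"
  by (auto simp: conjg_def)

lemma conjg_sym: "conjg x y \<Longrightarrow> conjg y x"
proof -
  assume "conjg x y"
  then obtain g where "x = g + y - g" by (auto simp: conjg_def)
  then have "y = - g + x - - g" by (simp add: add.assoc diff_conv_add_uminus del: add_uminus_conv_diff)
  then show ?thesis unfolding conjg_def by blast
qed

lemma conjg_trans: "conjg x y \<Longrightarrow> conjg y z \<Longrightarrow> conjg x z"
proof -
  assume "conjg x y" "conjg y z"
  then obtain g h where "x = g + (h + z - h) - g" by (auto simp: conjg_def)
  then have "x = (g + h) + z - (g + h)"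
    by (simp add: add.assoc minus_add diff_conv_add_uminus del: add_uminus_conv_diff)
  then show ?thesis unfolding conjg_def by blast
qed

lemma conjg_conj_iff: "conjg (g + x - g) y \<longleftrightarrow> conjg x y"
  by (meson conjgI conjg_sym conjg_trans)

lemma conjg_additive: "additive_map f \<Longrightarrow> conjg x y \<Longrightarrow> conjg (f x) (f y)"
  by (auto simp: conjg_def additive_simps)

lemma conjg_uminus: "conjg x y \<Longrightarrow> conjg (- x) (- y)"
proof -
  assume "conjg x y"
  then obtain g where "x = g + y - g" by (auto simp: conjg_def)
  then have "- x = g + - y - g"
    by (simp add: add.assoc minus_add diff_conv_add_uminus del: add_uminus_conv_diff)
  then show ?thesis unfolding conjg_def by blast
qed

lemma conjg_npow: "conjg x y \<Longrightarrow> conjg (npow k x) (npow k y)"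
  unfolding conjg_def by (metis npow_conj)

lemma conjg_zero [simp]: "conjg x 0 \<longleftrightarrow> x = 0" "conjg 0 x \<longleftrightarrow> x = 0"
proof -
  show "conjg x 0 \<longleftrightarrow> x = 0" for x :: 'a by (auto simp: conjg_def)
  then show "conjg 0 x \<longleftrightarrow> x = 0" by (metis conjg_sym)
qed

lemma conjg_expo: "conjg x y \<Longrightarrow> expo a x = expo a y"
  by (auto simp: conjg_def)

section \<open>Centralizers in free groups\<close>

text \<open>Copies of \<open>q\<close> are stripped from the front of \<open>w\<close> until a
  proper prefix of \<open>q\<close> is left. A nonempty such prefix would make a letter of
  \<open>q\<close> occur twice, so distinctness takes the place of the usual argument on common
  roots of commuting words.\<close>

lemma replicate_commute_list:
  assumes "q \<noteq> []" "distinct q" "w @ concat (replicate (Suc N) q) = concat (replicate (Suc N) q) @ w"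
  shows "\<exists>k. w = concat (replicate k q)"
  using assms(3)
proof (induction w rule: measure_induct_rule[of length])
  case (less w)
  let ?r = "concat (replicate N q)"
  have comm: "?r @ q = q @ ?r" by (induction N) auto
  have eq: "w @ q @ ?r = q @ ?r @ w" using less.prems by simp
  show ?case
  proof (cases "length q \<le> length w")
    case True
    obtain w' where w': "w = q @ w'"
      using eq True by (metis append_eq_append_conv_if append_take_drop_id)
    then have "w' @ concat (replicate (Suc N) q) = concat (replicate (Suc N) q) @ w'"
      using eq comm by (simp add: w')
    then obtain k where "w' = concat (replicate k q)"
      using less.IH[of w'] w' assms(1) by auto
    then have "w = concat (replicate (Suc k) q)" by (simp add: w')
    then show ?thesis by blast
  next
    case False
    then obtain s where s: "q = w @ s" "s \<noteq> []"
      using eq by (metis append_eq_append_conv_if append_take_drop_id linorder_not_le nle_le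
          append.right_neutral)
    then have e: "w @ s @ ?r = s @ ?r @ w" using eq by simp
    have "w = []"
    proof (rule ccontr)
      assume "w \<noteq> []"
      then have "hd w = hd s" using s(2) e by (metis hd_append2)
      then show False using \<open>w \<noteq> []\<close> s assms(2) by (metis disjoint_iff distinct_append hd_in_set)
    qed
    then show ?thesis by (intro exI[of _ 0]) simp
  qed
qed

lemma reduced_positive: "\<forall>l \<in> set w. snd l \<Longrightarrow> reduced w"
proof (induction w)
  case (Cons l w)
  then show ?case by (cases w) (auto simp: successively_Cons)
qed simp

text \<open>If nothing cancels in \<open>x + fw p\<close>, lengths add, so nothing cancels in
  \<open>fw p + x\<close> either, and the reduced words commute. If \<open>x\<close> ends in the
  inverse of the first letter of \<open>q\<close>, then either \<open>x\<close> starts with that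
  letter, which the same length count excludes, or the first case applies to
  \<open>- x\<close>.\<close>

lemma centralizer_npow:
  fixes x :: "'a fg"
  assumes q: "q \<noteq> []" "distinct q" "\<forall>l \<in> set q. snd l"
    and comm: "x + npow (Suc N) (fw q) = npow (Suc N) (fw q) + x"
  shows "\<exists>k. x = npow k (fw q) \<or> x = - npow k (fw q)"
proof -
  define p where "p = concat (replicate (Suc N) q)"
  have fp: "npow (Suc N) (fw q) = fw p" by (simp only: p_def fw_replicate)
  have p: "p \<noteq> []" "hd p = hd q" "\<forall>l \<in> set p. snd l"
    using q by (auto simp: p_def)
  have rp: "reduced p" using p by (intro reduced_positive)
  then have wp: "wd (fw p) = p" by (rule wd_fw)
  have A: "\<exists>k. y = npow k (fw q)"
    if y: "y + fw p = fw p + y" "y = 0 \<or> last (wd y) \<noteq> neg (hd q)" for y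
  proof -
    have "hd q \<noteq> neg (last (wd y))" if "y \<noteq> 0" using y(2) that by (metis neg_neg)
    then have r: "reduced (wd y @ wd (fw p))"
      using rp p wp by (auto simp: successively_append_iff)
    then have "len (y + fw p) = len y + len (fw p)" by (simp add: len_def wd_plus)
    then have "len (fw p + y) = len (fw p) + len y" using y(1) by simp
    then have r': "reduced (wd (fw p) @ wd y)" by (rule len_plus_eq_imp_reduced)
    have "wd y @ p = p @ wd y"
      using y(1) wd_plus[OF r] wd_plus[OF r'] wp by simp
    then obtain k where "wd y = concat (replicate k q)"
      using replicate_commute_list[OF q(1,2)] by (auto simp: p_def)
    then show ?thesis by (metis fw_replicate fw_wd)
  qed
  have comm': "x + fw p = fw p + x" using comm by (simp add: fp del: npow_simps)
  have comm'': "- x + fw p = fw p + - x"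
  proof -
    have "- x + (x + fw p) + - x = - x + (fw p + x) + - x" by (simp only: comm')
    then show ?thesis by (simp add: add.assoc del: add_uminus_conv_diff)
  qed
  show ?thesis
  proof (cases "x = 0 \<or> last (wd x) \<noteq> neg (hd q)")
    case True
    then show ?thesis using A[OF comm'] by blast
  next
    case x: False
    show ?thesis
    proof (cases "hd (wd x) = hd q")
      case True
      have "snd (last p)" "snd (hd q)" using p q(1) by (auto intro: q(3)[rule_format])
      then have "reduced (wd (fw p) @ wd x)"
        using True rp wp x by (auto simp: successively_append_iff)
      then have "len (fw p + x) = len (fw p) + len x" by (simp add: len_def wd_plus)
      then have "reduced (wd x @ wd (fw p))"
        using comm' by (intro len_plus_eq_imp_reduced) simp
      then show ?thesis using x p wp by (auto simp: successively_append_iff)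
    next
      case False
      then have "last (wd (- x)) \<noteq> neg (hd q)"
        using x by (simp add: wd_uminus last_word_inv)
      then obtain k where "- x = npow k (fw q)" using A[OF comm''] by blast
      then show ?thesis by (metis minus_minus)
    qed
  qed
qed

lemma centralizer_gen:
  assumes "x + gen a = gen a + x"
  shows "\<exists>k. x = npow k (gen a) \<or> x = - npow k (gen a)"
  using centralizer_npow[of "[(a, True)]" x 0] assms by (simp add: fw_Cons)

section \<open>Cyclically reduced words\<close>

text \<open>Pairs of cyclically consecutive letters, the last with the first included. As a set it
  is unchanged by rotation, so properties stated through it belong to the cyclic word.\<close>

definition adj :: "'b list \<Rightarrow> ('b \<times> 'b) set" where
  "adj w = set (zip w (tl w @ [hd w]))"

lemma zip_tl_successively:
  "(\<forall>(l, m) \<in> set (zip w (tl w @ [z])). P l m) \<longleftrightarrow> w = [] \<or> successively P w \<and> P (last w) z"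
proof (induction w)
  case (Cons a w)
  then show ?case by (cases w) auto
qed simp

lemma adj_successively:
  "(\<forall>(l, m) \<in> adj w. P l m) \<longleftrightarrow> w = [] \<or> successively P w \<and> P (last w) (hd w)"
  unfolding adj_def by (rule zip_tl_successively)

lemma adj_swap: "adj (u @ v) = adj (v @ u)"
proof (cases "u = [] \<or> v = []")
  case False
  then obtain a u' b v' where uv: "u = a # u'" "v = b # v'" by (meson neq_Nil_conv)
  have z: "zip (a # u' @ b # v') (u' @ b # v' @ [a]) = zip (a # u') (u' @ [b]) @ zip (b # v') (v' @ [a])"
    for a b :: 'a and u' v'
    using zip_append[of "a # u'" "u' @ [b]" "b # v'" "v' @ [a]"] by simp
  show ?thesis using z[of a u' b v'] z[of b v' a u'] by (auto simp: adj_def uv)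
qed auto

lemma adj_succ: "l \<in> set w \<Longrightarrow> \<exists>m. (l, m) \<in> adj w"
proof -
  assume "l \<in> set w"
  moreover have "map fst (zip w (tl w @ [hd w])) = w" by (cases w) simp_all
  ultimately show ?thesis unfolding adj_def
    by (metis (no_types, lifting) imageE list.set_map prod.collapse)
qed

lemma adj_pred:
  assumes "l \<in> set w"
  shows "\<exists>m. (m, l) \<in> adj w"
proof -
  have ne: "w \<noteq> []" using assms by auto
  have "map snd (zip w (tl w @ [hd w])) = tl w @ [hd w]" using ne by (cases w) simp_all
  moreover have "set (tl w @ [hd w]) = set w" using ne by (cases w) auto
  ultimately have "l \<in> snd ` set (zip w (tl w @ [hd w]))" using assms by (metis list.set_map)
  then show ?thesis unfolding adj_def by force
qed

lemma adj_in_set: "(l, m) \<in> adj w \<Longrightarrow> l \<in> set w \<and> m \<in> set w"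
  unfolding adj_def by (cases w) (auto dest: set_zip_leftD set_zip_rightD)

lemma adj_nth: "Suc k < length w \<Longrightarrow> (w ! k, w ! Suc k) \<in> adj w"
  unfolding adj_def by (cases w) (auto simp: in_set_zip nth_append intro!: exI[of _ k])

lemma adj_last_hd: "w \<noteq> [] \<Longrightarrow> (last w, hd w) \<in> adj w"
  using adj_successively[of w "\<lambda>l m. (l, m) \<in> adj w"] by blast

definition cyc_reduced :: "'a word \<Rightarrow> bool" where
  "cyc_reduced w \<longleftrightarrow> (\<forall>(l, m) \<in> adj w. m \<noteq> neg l)"

lemma cyc_reduced_iff: "cyc_reduced w \<longleftrightarrow> reduced w \<and> (w \<noteq> [] \<longrightarrow> hd w \<noteq> neg (last w))"
  unfolding cyc_reduced_def adj_successively by auto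

lemma cyc_reduced_swap: "cyc_reduced (u @ v) \<longleftrightarrow> cyc_reduced (v @ u)"
  by (simp add: cyc_reduced_def adj_swap)

lemma cyc_reduced_word_inv: "cyc_reduced w \<Longrightarrow> cyc_reduced (word_inv w)"
  by (auto simp: cyc_reduced_iff hd_word_inv last_word_inv neg_swap)

lemma conjg_swap: "conjg (fw (u @ v)) (fw (v @ u))"
proof -
  have "fw (u @ v) = fw u + fw (v @ u) - fw u" by (simp add: add.assoc diff_conv_add_uminus del: add_uminus_conv_diff)
  then show ?thesis unfolding conjg_def by blast
qed

lemma cyc_reduced_replicate: "cyc_reduced w \<Longrightarrow> reduced (concat (replicate k w))"
proof (induction k)
  case (Suc k)
  then show ?case
    by (cases k) (auto simp: cyc_reduced_iff successively_append_iff)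
qed simp

text \<open>Mutually inverse letters are stripped from the two ends. No new letters appear, which
  keeps the generators within \<open>1..n\<close> later.\<close>

lemma exists_cyc_reduced: "\<exists>w. cyc_reduced w \<and> conjg x (fw w) \<and> set w \<subseteq> set (wd x)"
proof (induction "len x" arbitrary: x rule: less_induct)
  case less
  show ?case
  proof (cases "cyc_reduced (wd x)")
    case True
    then show ?thesis by (intro exI[of _ "wd x"]) simp
  next
    case False
    then have ne: "wd x \<noteq> []" and h: "hd (wd x) = neg (last (wd x))"
      by (auto simp: cyc_reduced_iff)
    then obtain l w where w: "wd x = l # w" by (meson neq_Nil_conv)
    with h have "w \<noteq> []" by auto
    then obtain v m where v: "w = v @ [m]" by (metis rev_exhaust)
    with w h have wx: "wd x = [l] @ v @ [neg l]" by (auto simp: neg_swap)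
    have "x = fw (wd x)" by simp
    also have "conjg \<dots> (fw ((v @ [neg l]) @ [l]))" unfolding wx by (rule conjg_swap)
    also have "fw ((v @ [neg l]) @ [l]) = fw v"
      by (cases l) (auto simp: fw_Cons)
    finally have c: "conjg x (fw v)" .
    have "len (fw v) < len x" using len_fw[of v] wx by (simp add: len_def)
    then obtain w' where "cyc_reduced w'" "conjg (fw v) (fw w')" "set w' \<subseteq> set (wd (fw v))"
      using less by blast
    moreover have "set (wd (fw v)) \<subseteq> set (wd x)"
      using set_foldr_push[of v "[]"] by (auto simp: wd_fw' wx)
    ultimately show ?thesis using c conjg_trans by blast
  qed
qed

text \<open>Compare the growth of the lengths of the powers of two conjugate elements.\<close>

lemma cyc_reduced_minimal_length:
  assumes "cyc_reduced w" "conjg (fw w) z"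
  shows "length w \<le> len z"
proof (rule ccontr)
  assume "\<not> length w \<le> len z"
  then have lz: "Suc (len z) \<le> length w" by simp
  obtain g where g: "fw w = g + z - g" using assms(2) by (auto simp: conjg_def)
  \<comment> \<open>With more than \<open>2 * len g\<close> factors, a deficit of one letter per
    factor outweighs the two conjugating ends.\<close>
  define n where "n = Suc (2 * len g)"
  have np: "len (npow k z) \<le> k * len z" for k
    by (induction k) (auto intro: order.trans[OF len_plus])
  have "n * length w = length (concat (replicate n w))"
    by (simp add: length_concat sum_list_replicate)
  also have "\<dots> = len (npow n (fw w))"
    using cyc_reduced_replicate[OF assms(1), of n] by (simp only: fw_replicate[symmetric] len_fw_eq)
  also have "\<dots> = len (g + npow n z + - g)" by (simp only: g npow_conj add_uminus_conv_diff)
  also have "\<dots> \<le> len g + len (npow n z) + len g"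
    using len_plus[of "g + npow n z" "- g"] len_plus[of g "npow n z"] by simp
  also have "\<dots> \<le> 2 * len g + n * len z" using np[of n] by simp
  also have "\<dots> < n + n * len z" by (simp add: n_def)
  also have "\<dots> = n * Suc (len z)" by simp
  also have "\<dots> \<le> n * length w" using lz by (rule mult_le_mono2)
  finally show False by simp
qed


section \<open>Partial conjugations\<close>

text \<open>For \<open>g\<close> in the subgroup on \<open>S\<close>, this conjugates one free
  factor and is the identity on the complementary one. The powers of the square of
  \<open>sigma i\<close> have this form (\<open>sigma_twist\<close>).\<close>

definition pconj :: "'a set \<Rightarrow> 'a fg \<Rightarrow> 'a fg \<Rightarrow> 'a fg" where
  "pconj S g = fext (\<lambda>a. if a \<in> S then g + gen a - g else gen a)"

lemma additive_pconj [simp]: "additive_map (pconj S g)"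
  by (simp add: pconj_def)

lemma pconj_gen: "pconj S g (gen a) = (if a \<in> S then g + gen a - g else gen a)"
  by (simp add: pconj_def)

lemma additive_conj: "additive_map (\<lambda>x. g + x - (g :: 'a::group_add))"
  by (simp add: additive_map_def add.assoc diff_conv_add_uminus del: add_uminus_conv_diff)

lemma pconj_in: "x \<in> supp_in S \<Longrightarrow> pconj S g x = g + x - g"
  by (rule additive_eq_on[OF additive_pconj additive_conj, of S]) (simp_all add: pconj_gen)

lemma pconj_out: "x \<in> supp_in (- S) \<Longrightarrow> pconj S g x = x"
  by (rule additive_eq_on[OF additive_pconj additive_id(2), of "- S"]) (simp_all add: pconj_gen)

lemma pconj_pconj:
  assumes "h \<in> supp_in S"
  shows "pconj S g (pconj S h x) = pconj S (g + h) x"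
proof -
  have "pconj S g \<circ> pconj S h = pconj S (g + h)"
  proof (rule additive_eq)
    fix a
    have "pconj S g h = g + h - g" by (rule pconj_in[OF assms])
    then show "(pconj S g \<circ> pconj S h) (gen a) = pconj S (g + h) (gen a)"
      by (auto simp: pconj_gen additive_simps[OF additive_pconj] add.assoc minus_add
          diff_conv_add_uminus simp del: add_uminus_conv_diff)
  qed (auto intro: additive_comp)
  then show ?thesis by (metis comp_apply)
qed

lemma pconj_0 [simp]: "pconj S 0 x = x"
proof -
  have "pconj S 0 = id" by (rule additive_eq) (auto simp: pconj_gen)
  then show ?thesis by simp
qed

lemma pconj_supp_in:
  assumes "g \<in> supp_in T" "x \<in> supp_in T"
  shows "pconj S g x \<in> supp_in T"
  using assms(2)
proof (induction rule: supp_in_induct)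
  case (gen a x)
  then show ?case using assms(1)
    by (auto simp: additive_simps[OF additive_pconj] pconj_gen intro!: supp_in_closed)
next
  case (neg a x)
  then have "- pconj S g (gen a) + pconj S g x \<in> supp_in T" using assms(1)
    by (intro supp_in_closed) (auto simp: pconj_gen intro!: supp_in_closed)
  then show ?case by (simp add: additive_simps[OF additive_pconj])
qed (simp add: additive_simps[OF additive_pconj] supp_in_closed)

section \<open>Normal forms of words under a partial conjugation\<close>

context
  fixes S :: "'a set" and g :: "'a fg"
  assumes g: "g \<in> supp_in S"
begin

lemma conj_supp:
  assumes "reduced h" "fst ` set h \<subseteq> S"
  shows "fst ` set (wd (g + fw h - g)) \<subseteq> S" "h \<noteq> [] \<Longrightarrow> wd (g + fw h - g) \<noteq> []"
proof -
  have "g + fw h - g \<in> supp_in S" using g fw_supp_in[OF assms(2)] by (intro supp_in_closed)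
  then show "fst ` set (wd (g + fw h - g)) \<subseteq> S" by (simp add: supp_in_def)
  assume "h \<noteq> []"
  then have "fw h \<noteq> 0" using assms(1) wd_fw by fastforce
  then have "g + fw h - g \<noteq> 0" by (metis conjg_conj_iff conjg_zero(1))
  then show "wd (g + fw h - g) \<noteq> []" by simp
qed

lemma pconj_split:
  assumes w: "reduced (h @ y)" "fst ` set h \<subseteq> S"
    and y: "y = [] \<or> wd (pconj S g (fw y)) \<noteq> [] \<and> fst (hd (wd (pconj S g (fw y)))) \<notin> S"
  shows "wd (pconj S g (fw (h @ y))) = wd (g + fw h - g) @ wd (pconj S g (fw y))"
proof -
  have rh: "reduced h" using w(1) by (simp add: successively_append_iff)
  have "pconj S g (fw (h @ y)) = (g + fw h - g) + pconj S g (fw y)"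
    using pconj_in[OF fw_supp_in[OF w(2)], of g] by (simp add: additive_simps[OF additive_pconj])
  moreover have "reduced (wd (g + fw h - g) @ wd (pconj S g (fw y)))"
  proof (cases "y = []")
    case False
    with y have y': "fst (hd (wd (pconj S g (fw y)))) \<notin> S" by auto
    have "fst (last (wd (g + fw h - g))) \<in> S" if "wd (g + fw h - g) \<noteq> []"
      using conj_supp(1)[OF rh w(2)] last_in_set[OF that] by blast
    with y' show ?thesis by (auto simp: successively_append_iff)
  qed (simp add: additive_simps[OF additive_pconj])
  ultimately show ?thesis by (simp add: wd_plus)
qed

text \<open>A maximal stretch of letters from \<open>S\<close> is conjugated inside the subgroup on
  \<open>S\<close> and stays nontrivial, so it still separates the letters outside \<open>S\<close>.
  Hence these letters survive and the image can be read off piece by piece.\<close>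

lemma pconj_Cons_out:
  assumes "reduced (l # y)" "fst l \<notin> S"
  shows "wd (pconj S g (fw (l # y))) = l # wd (pconj S g (fw y))"
  using assms
proof (induction y arbitrary: l rule: measure_induct_rule[of length])
  case (less y)
  define h z where "h = takeWhile (\<lambda>l. fst l \<in> S) y" and "z = dropWhile (\<lambda>l. fst l \<in> S) y"
  have y: "y = h @ z" by (simp add: h_def z_def)
  have ry: "reduced (h @ z)" using less.prems(1) by (auto simp: y successively_Cons)
  have h: "fst ` set h \<subseteq> S" "reduced h"
    using ry by (auto simp: h_def dest: set_takeWhileD simp: successively_append_iff)
  have z: "z = [] \<or> (\<exists>m z'. z = m # z' \<and> fst m \<notin> S \<and> wd (pconj S g (fw z)) = m # wd (pconj S g (fw z')))"
  proof (cases z)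
    case (Cons m z')
    have "fst m \<notin> S" using hd_dropWhile[of "\<lambda>l. fst l \<in> S" y] Cons unfolding z_def by fastforce
    moreover have "length z' < length y" "reduced (m # z')"
      using ry by (auto simp: y Cons successively_append_iff)
    ultimately show ?thesis using less.IH[of z' m] Cons by auto
  qed simp
  have e: "wd (pconj S g (fw y)) = wd (g + fw h - g) @ wd (pconj S g (fw z))"
    unfolding y using z by (intro pconj_split ry h) auto
  have "reduced ([l] @ wd (pconj S g (fw y)))"
  proof (cases "h = []")
    case True
    with e have "wd (pconj S g (fw y)) = wd (pconj S g (fw z))" by simp
    moreover have "z \<noteq> [] \<Longrightarrow> hd z \<noteq> neg l" using less.prems(1) True by (simp add: y successively_Cons)
    ultimately show ?thesis using z by (auto simp: successively_Cons additive_simps[OF additive_pconj])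
  next
    case False
    have "fst (hd (wd (g + fw h - g))) \<in> S"
      using conj_supp[OF h(2,1)] False hd_in_set by blast
    then have "hd (wd (pconj S g (fw y))) \<noteq> neg l"
      using less.prems(2) conj_supp(2)[OF h(2,1) False] by (auto simp: e)
    then show ?thesis by (simp add: successively_Cons)
  qed
  moreover have "pconj S g (fw (l # y)) = fw [l] + pconj S g (fw y)"
    using pconj_out[OF fw_supp_in[of "[l]" "- S"], of g] less.prems(2)
      additive_plus[OF additive_pconj[of S g], of "fw [l]" "fw y"] fw_append[of "[l]" y]
    by simp
  ultimately show ?case using wd_plus[of "fw [l]" "pconj S g (fw y)"] by (simp add: wd_fw)
qed

lemma pconj_takeWhile:
  assumes "reduced w"
  defines "h \<equiv> takeWhile (\<lambda>l. fst l \<in> S) w" and "y \<equiv> dropWhile (\<lambda>l. fst l \<in> S) w"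
  shows "wd (pconj S g (fw w)) = wd (g + fw h - g) @ wd (pconj S g (fw y))"
    and "fst ` set h \<subseteq> S" "reduced h"
    and "y = [] \<or> (\<exists>m z. y = m # z \<and> fst m \<notin> S \<and> reduced z \<and> length z < length w \<and>
      wd (pconj S g (fw y)) = m # wd (pconj S g (fw z)))"
proof -
  have w: "w = h @ y" by (simp add: h_def y_def)
  have ry: "reduced (h @ y)" using assms(1) by (simp add: w)
  show h: "fst ` set h \<subseteq> S" "reduced h"
    using ry by (auto simp: h_def dest: set_takeWhileD simp: successively_append_iff)
  show y: "y = [] \<or> (\<exists>m z. y = m # z \<and> fst m \<notin> S \<and> reduced z \<and> length z < length w \<and>
      wd (pconj S g (fw y)) = m # wd (pconj S g (fw z)))"
  proof (cases y)
    case (Cons m z)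
    have "fst m \<notin> S" using hd_dropWhile[of "\<lambda>l. fst l \<in> S" w] Cons unfolding y_def by fastforce
    moreover have "reduced (m # z)" using ry by (auto simp: Cons successively_append_iff)
    ultimately show ?thesis using pconj_Cons_out[of m z]
      by (auto simp: Cons successively_Cons w)
  qed simp
  show "wd (pconj S g (fw w)) = wd (g + fw h - g) @ wd (pconj S g (fw y))"
    unfolding w using y by (intro pconj_split ry h) auto
qed

lemma pconj_last:
  assumes "reduced w" "w \<noteq> []" "fst (last w) \<notin> S"
  shows "wd (pconj S g (fw w)) \<noteq> [] \<and> last (wd (pconj S g (fw w))) = last w"
  using assms
proof (induction w rule: measure_induct_rule[of length])
  case (less w)
  define h y where "h = takeWhile (\<lambda>l. fst l \<in> S) w" and "y = dropWhile (\<lambda>l. fst l \<in> S) w"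
  note T = pconj_takeWhile[OF less.prems(1), folded h_def y_def]
  have w: "w = h @ y" by (simp add: h_def y_def)
  have "y \<noteq> []" using less.prems(2,3) T(2) w by (metis append_Nil2 image_subset_iff last_in_set)
  then obtain m z where z: "y = m # z" "reduced z" "length z < length w"
      "wd (pconj S g (fw y)) = m # wd (pconj S g (fw z))" using T(4) by blast
  show ?case
  proof (cases "z = []")
    case True
    then show ?thesis using T(1) z w by (simp add: additive_simps[OF additive_pconj])
  next
    case False
    then have "last z = last w" using w z by simp
    then show ?thesis using less.IH[of z] less.prems(3) z False T(1) by simp
  qed
qed

text \<open>A word that starts in \<open>S\<close> and ends outside keeps both properties, so
  nothing cancels across its ends. By \<open>cyc_reduced_minimal_length\<close> the images then have
  minimal length in their conjugacy classes.\<close>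

lemma pconj_cyc_reduced:
  assumes "reduced w" "w \<noteq> []" "fst (hd w) \<in> S" "fst (last w) \<notin> S"
  shows "cyc_reduced (wd (pconj S g (fw w)))"
proof -
  define h y where "h = takeWhile (\<lambda>l. fst l \<in> S) w" and "y = dropWhile (\<lambda>l. fst l \<in> S) w"
  note T = pconj_takeWhile[OF assms(1), folded h_def y_def]
  have "h \<noteq> []" using assms(2,3) unfolding h_def by (cases w) auto
  then have "fst (hd (wd (pconj S g (fw w)))) \<in> S"
    using conj_supp[OF T(3,2)] T(1) by (metis hd_append2 hd_in_set image_subset_iff)
  then have "hd (wd (pconj S g (fw w))) \<noteq> neg (last (wd (pconj S g (fw w))))"
    using pconj_last[OF assms(1,2,4)] assms(4) by auto
  then show ?thesis by (simp add: cyc_reduced_iff)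
qed

end

inductive blocks :: "'a \<Rightarrow> 'a \<Rightarrow> 'a word \<Rightarrow> bool" for p q where
  Nil: "blocks p q []"
| out: "fst l \<notin> {p, q} \<Longrightarrow> blocks p q w \<Longrightarrow> blocks p q (l # w)"
| pos: "blocks p q w \<Longrightarrow> blocks p q ((p, True) # (q, True) # w)"
| neg: "blocks p q w \<Longrightarrow> blocks p q ((q, False) # (p, False) # w)"

lemma takeWhile_append_eq:
  assumes "a @ b = h @ y" "\<forall>x \<in> set a. P x" "\<forall>x \<in> set h. P x"
    "b = [] \<or> \<not> P (hd b)" "y = [] \<or> \<not> P (hd y)"
  shows "a = h \<and> b = y"
proof -
  have "takeWhile P (a @ b) = a" using assms(2,4) by (cases b) (auto simp: takeWhile_append2)
  moreover have "takeWhile P (h @ y) = h" using assms(3,5) by (cases y) (auto simp: takeWhile_append2)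
  ultimately show ?thesis using assms(1) by simp
qed

text \<open>The normal forms are compared stretch by stretch. A stretch of letters on
  \<open>p\<close>, \<open>q\<close> that is fixed commutes with a positive power of
  \<open>gen p + gen q\<close>, and by \<open>centralizer_npow\<close> it is itself a power of
  \<open>gen p + gen q\<close> up to sign.\<close>

lemma pconj_fixed_blocks:
  assumes "p \<noteq> q" and w: "reduced w"
    and fixed: "pconj {p, q} (- npow (Suc N) (gen p + gen q)) (fw w) = fw w"
  shows "blocks p q w"
  using w fixed
proof (induction w rule: measure_induct_rule[of length])
  case (less w)
  let ?S = "{p, q}" and ?g = "- npow (Suc N) (gen p + gen q)"
  define h y where "h = takeWhile (\<lambda>l. fst l \<in> ?S) w" and "y = dropWhile (\<lambda>l. fst l \<in> ?S) w"
  have g: "?g \<in> supp_in ?S" by (intro supp_in_closed npow_supp_in) auto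
  note T = pconj_takeWhile[OF g less.prems(1), folded h_def y_def]
  have w: "w = h @ y" by (simp add: h_def y_def)
  have "wd (?g + fw h - ?g) @ wd (pconj ?S ?g (fw y)) = h @ y"
    using T(1) w less.prems wd_fw by metis
  then have e: "wd (?g + fw h - ?g) = h \<and> wd (pconj ?S ?g (fw y)) = y"
  proof (rule takeWhile_append_eq[where P = "\<lambda>l. fst l \<in> ?S"])
    show "\<forall>x \<in> set (wd (?g + fw h - ?g)). fst x \<in> ?S" "\<forall>x \<in> set h. fst x \<in> ?S"
      using conj_supp(1)[OF g T(3,2)] T(2) by blast+
    show "wd (pconj ?S ?g (fw y)) = [] \<or> fst (hd (wd (pconj ?S ?g (fw y)))) \<notin> ?S"
      "y = [] \<or> fst (hd y) \<notin> ?S"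
      using T(4) by (auto simp: additive_simps[OF additive_pconj])
  qed
  have "blocks p q y"
  proof (cases "y = []")
    case False
    then obtain m z where z: "y = m # z" "fst m \<notin> ?S" "reduced z" "length z < length w"
      "wd (pconj ?S ?g (fw y)) = m # wd (pconj ?S ?g (fw z))" using T(4) by blast
    then have "wd (pconj ?S ?g (fw z)) = z" using e by simp
    then have "pconj ?S ?g (fw z) = fw z" by (metis fw_wd)
    then show ?thesis using less.IH[of z] z by (auto intro: blocks.out)
  qed (simp add: blocks.Nil)
  let ?q = "[(p, True), (q, True)]"
  have c: "fw ?q = gen p + gen q" by (simp add: fw_Cons)
  have "?g + fw h - ?g = fw h" using e by (metis fw_wd)
  then have "?g + fw h = fw h + ?g" by (metis diff_add_cancel)
  then have "npow (Suc N) (fw ?q) + (?g + fw h) + npow (Suc N) (fw ?q)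
      = npow (Suc N) (fw ?q) + (fw h + ?g) + npow (Suc N) (fw ?q)"
    by (simp only:)
  then have "fw h + npow (Suc N) (fw ?q) = npow (Suc N) (fw ?q) + fw h"
    unfolding c by (simp add: add.assoc del: npow_simps add_uminus_conv_diff)
  then obtain k where "fw h = npow k (fw ?q) \<or> fw h = - npow k (fw ?q)"
    using centralizer_npow[of ?q "fw h" N] assms(1) by auto
  then consider "fw h = fw (concat (replicate k ?q))" | "fw h = fw (word_inv (concat (replicate k ?q)))"
    by (metis fw_replicate fw_word_inv)
  then consider "h = concat (replicate k ?q)" | "h = word_inv (concat (replicate k ?q))"
  proof cases
    case 1
    have "reduced (concat (replicate k ?q))" by (rule reduced_positive) auto
    then show ?thesis using 1 that(1) wd_fw[OF T(3)] wd_fw by metis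
  next
    case 2
    have "reduced (word_inv (concat (replicate k ?q)))"
      unfolding reduced_word_inv by (rule reduced_positive) auto
    then show ?thesis using 2 that(2) wd_fw[OF T(3)] wd_fw by metis
  qed
  then show ?case
  proof cases
    case 1
    have "blocks p q (concat (replicate k ?q) @ y)"
      by (induction k) (auto intro: blocks.pos \<open>blocks p q y\<close>)
    then show ?thesis by (simp add: w 1)
  next
    case 2
    have "concat (replicate (Suc k) ?q) = concat (replicate k ?q) @ ?q" for k
      by (induction k) auto
    then have s: "word_inv (concat (replicate (Suc k) ?q))
        = [(q, False), (p, False)] @ word_inv (concat (replicate k ?q))" for k
      by (simp only: word_inv_simps) simp
    have "blocks p q (word_inv (concat (replicate k ?q)) @ y)"
    proof (induction k)
      case (Suc k)
      then show ?case unfolding s by (auto intro: blocks.neg)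
    qed (simp add: \<open>blocks p q y\<close>)
    then show ?thesis by (simp add: w 2)
  qed
qed

text \<open>The cyclic counterpart of \<open>blocks\<close>. Being phrased through
  \<open>adj\<close>, it can be transferred from a rotated word back to \<open>w\<close>.\<close>

definition coupled :: "'a \<Rightarrow> 'a \<Rightarrow> 'a word \<Rightarrow> bool" where
  "coupled p q w \<longleftrightarrow>
     (\<forall>(l, m) \<in> adj w. (l = (p, True) \<longleftrightarrow> m = (q, True)) \<and> (l = (q, False) \<longleftrightarrow> m = (p, False)))"

lemma blocks_coupled:
  assumes "blocks p q w" "p \<noteq> q"
  shows "coupled p q w"
proof -
  let ?P = "\<lambda>l m. (l = (p, True) \<longleftrightarrow> m = (q, True)) \<and> (l = (q, False) \<longleftrightarrow> m = (p, False))"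
  have "successively ?P w \<and> (w \<noteq> [] \<longrightarrow>
      hd w \<notin> {(q, True), (p, False)} \<and> last w \<notin> {(p, True), (q, False)})"
    using assms(1) by induction (use assms(2) in \<open>auto simp: successively_Cons\<close>)
  then show ?thesis unfolding coupled_def adj_successively by auto
qed

text \<open>The images of a suitably rotated word under the powers of the twist are cyclically
  reduced, use finitely many letters and have bounded length, so two of them coincide. Then a
  nontrivial power of the twist fixes the rotated word.\<close>

lemma coupled_of_bounded:
  assumes pq: "p \<noteq> q" and w: "cyc_reduced w" "\<exists>l \<in> set w. fst l \<in> {p, q}" "\<exists>l \<in> set w. fst l \<notin> {p, q}"
    and C: "finite C" "\<And>m. \<exists>z \<in> C. conjg (pconj {p, q} (- npow m (gen p + gen q)) (fw w)) z"
  shows "coupled p q w"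
proof -
  let ?S = "{p, q}" and ?c = "gen p + gen q"
  let ?in = "\<lambda>l :: 'a \<times> bool. fst l \<in> {p, q}"
  \<comment> \<open>For a word starting outside \<open>{p, q}\<close>, cutting at its first letter
    from \<open>{p, q}\<close> gives a rotation with the required ends. A preliminary rotation below
    reduces the general case to this one.\<close>
  have rot: "\<exists>u v. w = u @ v \<and> ?in (hd (v @ u)) \<and> \<not> ?in (last (v @ u)) \<and> w \<noteq> []"
    if "w \<noteq> []" "\<not> ?in (hd w)" "\<exists>l \<in> set w. ?in l" for w
  proof -
    define u v where "u = takeWhile (\<lambda>l. \<not> ?in l) w" and "v = dropWhile (\<lambda>l. \<not> ?in l) w"
    have "v \<noteq> []" using that(3) by (auto simp: v_def dropWhile_eq_Nil_conv)
    moreover have "u \<noteq> []" using that(1,2) by (cases w) (auto simp: u_def)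
    moreover have "?in (hd v)" using \<open>v \<noteq> []\<close> hd_dropWhile unfolding v_def by blast
    moreover have "\<not> ?in (last u)" using last_in_set[OF \<open>u \<noteq> []\<close>] unfolding u_def
      by (blast dest: set_takeWhileD)
    ultimately show ?thesis using that(1)
      by (intro exI[of _ u] exI[of _ v]) (simp add: u_def v_def)
  qed
  have "\<exists>w0. cyc_reduced w0 \<and> conjg (fw w0) (fw w) \<and> adj w0 = adj w \<and> set w0 = set w \<and>
      ?in (hd w0) \<and> \<not> ?in (last w0)"
  proof -
    have ne: "w \<noteq> []" using w(2) by auto
    define u v where "u = takeWhile ?in w" and "v = dropWhile ?in w"
    have "v \<noteq> []" using w(3) by (auto simp: v_def dropWhile_eq_Nil_conv)
    then have h: "\<not> ?in (hd v)" using hd_dropWhile unfolding v_def by blast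
    have uv: "w = u @ v" by (simp add: u_def v_def)
    obtain u' v' where uv': "v @ u = u' @ v'" "?in (hd (v' @ u'))" "\<not> ?in (last (v' @ u'))"
      using rot[of "v @ u"] \<open>v \<noteq> []\<close> h w(2) uv by auto
    have "cyc_reduced (v' @ u')" using w(1) uv uv'(1) cyc_reduced_swap by metis
    moreover have "conjg (fw (v' @ u')) (fw w)"
      using conjg_swap[of v' u'] conjg_swap[of v u] uv uv'(1) conjg_trans by metis
    moreover have "adj (v' @ u') = adj w" using adj_swap uv uv'(1) by metis
    moreover have "set (v' @ u') = set w" using arg_cong[OF uv'(1), of set] uv by auto
    ultimately show ?thesis using uv' by blast
  qed
  then obtain w0 where w0: "cyc_reduced w0" "conjg (fw w0) (fw w)" "adj w0 = adj w" "set w0 = set w"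
    "?in (hd w0)" "\<not> ?in (last w0)" by blast
  have r0: "reduced w0" "w0 \<noteq> []" using w0(1,4) w(2) by (auto simp: cyc_reduced_iff)
  have gS: "npow m ?c \<in> supp_in ?S" for m by (intro supp_in_closed npow_supp_in) auto
  have gS': "- npow m ?c \<in> supp_in ?S" for m using gS by (intro supp_in_closed)
  define W where "W m = wd (pconj ?S (- npow m ?c) (fw w0))" for m
  have credW: "cyc_reduced (W m)" for m
    unfolding W_def using pconj_cyc_reduced[OF gS' r0 w0(5,6)] .
  define A where "A = (fst ` set w \<union> ?S) \<times> (UNIV :: bool set)"
  define L where "L = Max (len ` C)"
  have "W m \<in> {v. set v \<subseteq> A \<and> length v \<le> L}" for m
  proof -
    have "- npow m ?c \<in> supp_in (fst ` set w \<union> ?S)" using gS'[of m] by (auto simp: supp_in_def)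
    then have "pconj ?S (- npow m ?c) (fw w0) \<in> supp_in (fst ` set w \<union> ?S)"
      using w0(4) by (intro pconj_supp_in fw_supp_in) auto
    then have fs: "fst ` set (W m) \<subseteq> fst ` set w \<union> ?S" by (simp only: supp_in_def W_def mem_Collect_eq)
    have "set (W m) \<subseteq> A"
    proof
      fix l assume "l \<in> set (W m)"
      then have "fst l \<in> fst ` set w \<union> ?S" using fs by blast
      then show "l \<in> A" by (simp only: A_def mem_Times_iff UNIV_I)
    qed
    moreover obtain z where z: "z \<in> C" "conjg (pconj ?S (- npow m ?c) (fw w)) z"
      using C(2) by blast
    then have "conjg (fw (W m)) z" unfolding W_def fw_wd
      using conjg_additive[OF additive_pconj w0(2)] conjg_trans by blast
    then have "length (W m) \<le> len z" using credW by (rule cyc_reduced_minimal_length[rotated])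
    then have "length (W m) \<le> L" using C(1) z(1) unfolding L_def
      by (meson Max_ge finite_imageI imageI order.trans)
    ultimately show ?thesis by simp
  qed
  moreover have "finite {v. set v \<subseteq> A \<and> length v \<le> L}"
    by (rule finite_lists_length_le) (simp add: A_def)
  ultimately have "finite (range W)" by (meson finite_subset image_subsetI)
  then have "\<not> inj W" using finite_imageD infinite_UNIV_nat by blast
  then obtain i j where ij: "W i = W j" "i < j"
    unfolding inj_def by (metis linorder_neqE_nat)
  then obtain N where N: "j = Suc N + i" using less_imp_Suc_add by (metis add.commute add_Suc)
  \<comment> \<open>Undoing power \<open>i\<close> in the coincidence of the powers \<open>i\<close>
    and \<open>j\<close> leaves the power \<open>j - i\<close>, which is positive.\<close>
  have "pconj ?S (npow i ?c) (pconj ?S (- npow j ?c) (fw w0))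
      = pconj ?S (npow i ?c) (pconj ?S (- npow i ?c) (fw w0))"
    using ij(1) unfolding W_def by (simp add: wd_eq_iff)
  then have "pconj ?S (npow i ?c + - npow j ?c) (fw w0) = fw w0"
    by (simp add: pconj_pconj gS' del: add_uminus_conv_diff)
  moreover have "npow i ?c + - npow j ?c = - npow (Suc N) ?c"
    unfolding N npow_add[of "Suc N" i] by (simp only: minus_add add_minus_cancel)
  ultimately have "blocks p q w0" using pconj_fixed_blocks[OF pq r0(1)] by simp
  then have "coupled p q w0" using pq by (rule blocks_coupled)
  then show ?thesis unfolding coupled_def w0(3) .
qed

section \<open>Words coupled at all adjacent pairs of generators\<close>

definition delta :: "nat \<Rightarrow> nat fg" where
  "delta n = fw (pos_word [1..<Suc n])"

lemma fw_pos_word: "fw (pos_word xs) = sum_list (map gen xs)"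
  by (induction xs) (auto simp: fw_Cons)

lemma delta_sum_list: "delta n = sum_list (map gen [1..<Suc n])"
  unfolding delta_def by (rule fw_pos_word)

lemma delta_Suc: "delta (Suc n) = delta n + gen (Suc n)"
  by (simp add: delta_sum_list)

lemma delta_0 [simp]: "delta 0 = 0"
  by (simp add: delta_sum_list)

lemma expo_delta: "expo j (delta n) = (if 1 \<le> j \<and> j \<le> n then 1 else 0)"
proof (induction n)
  case (Suc n)
  then show ?case unfolding delta_Suc by auto
qed auto

lemma delta_supp_in: "delta n \<in> supp_in {1..n}"
  unfolding delta_def by (rule fw_supp_in) auto

lemma wd_delta: "wd (delta n) = pos_word [1..<Suc n]"
  unfolding delta_def by (rule wd_fw, rule reduced_positive) auto

lemma centralizer_delta:
  assumes "n \<ge> 1" "x + delta n = delta n + x"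
  shows "\<exists>k. x = npow k (delta n) \<or> x = - npow k (delta n)"
proof -
  have "\<exists>k. x = npow k (fw (pos_word [1..<Suc n])) \<or> x = - npow k (fw (pos_word [1..<Suc n]))"
    using assms by (intro centralizer_npow[where N = 0])
      (auto simp: delta_def distinct_map inj_on_def)
  then show ?thesis by (simp only: delta_def)
qed

lemma cyclic_word_delta:
  assumes n: "n \<ge> 1" and hd: "w \<noteq> []" "hd w = (1, True)"
    and succ: "\<And>j m. ((j, True), m) \<in> adj w \<Longrightarrow> m = (if j < n then Suc j else 1, True)"
  shows "\<exists>k. fw w = npow k (delta n)"
proof -
  have nth: "w ! k = (Suc (k mod n), True)" if "k < length w" for k
    using that
  proof (induction k)
    case 0
    then show ?case using hd by (simp add: hd_conv_nth[symmetric])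
  next
    case (Suc k)
    then have "((Suc (k mod n), True), w ! Suc k) \<in> adj w" using adj_nth[of k w] by simp
    then have "w ! Suc k = (if Suc (k mod n) < n then Suc (Suc (k mod n)) else 1, True)"
      by (rule succ)
    moreover have "k mod n < n" using n by simp
    ultimately show ?case by (auto simp: mod_Suc)
  qed
  define L where "L = length w"
  have "last w = (Suc ((L - 1) mod n), True)"
    using hd(1) nth[of "L - 1"] by (simp add: last_conv_nth L_def)
  \<comment> \<open>The cyclic successor of the last letter is the first letter \<open>1\<close>. So
    the last letter is \<open>n\<close>, and \<open>n\<close> divides the length.\<close>
  then have "((Suc ((L - 1) mod n), True), (1, True)) \<in> adj w"
    using adj_last_hd[OF hd(1)] hd(2) by simp
  from succ[OF this] have "\<not> Suc ((L - 1) mod n) < n" by auto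
  moreover have "(L - 1) mod n < n" using n by simp
  ultimately have "Suc ((L - 1) mod n) = n" by simp
  then have "Suc (L - 1) mod n = 0" by (simp add: mod_Suc)
  then have "L mod n = 0" using hd(1) by (simp add: L_def)
  then obtain k where k: "L = k * n" by (metis mod_0_imp_dvd dvdE mult.commute)
  have "v = concat (replicate k (pos_word [1..<Suc n]))"
    if "length v = k * n" "\<And>i. i < length v \<Longrightarrow> v ! i = (Suc (i mod n), True)" for v k
    using that
  proof (induction k arbitrary: v)
    case (Suc k)
    have "take n v = pos_word [1..<Suc n]"
      using Suc.prems by (intro nth_equalityI) (auto simp: nth_map simp del: upt_Suc)
    moreover have "drop n v = concat (replicate k (pos_word [1..<Suc n]))"
      using Suc.prems by (intro Suc.IH) auto
    ultimately show ?case by (metis append_take_drop_id concat.simps(2) replicate_Suc)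
  qed simp
  from this[of w k] have "w = concat (replicate k (pos_word [1..<Suc n]))"
    using k nth by (simp add: L_def)
  then have "fw w = npow k (delta n)" unfolding delta_def by (metis fw_replicate)
  then show ?thesis by blast
qed

lemma reduced_singleton_support:
  assumes "reduced w" "fst ` set w \<subseteq> {j}"
  shows "\<exists>k. fw w = npow k (gen j) \<or> fw w = - npow k (gen j)"
proof -
  have "w = replicate (length w) (j, True) \<or> w = replicate (length w) (j, False)"
    using assms
  proof (induction w)
    case (Cons l w)
    then show ?case by (cases l; cases w) (auto simp: successively_Cons)
  qed simp
  moreover have "fw (replicate k (j, True)) = npow k (gen j)" for k
    by (induction k) (auto simp: fw_Cons)
  moreover have "fw (replicate k (j, False)) = npow k (- gen j)" for k
    by (induction k) (auto simp: fw_Cons simp del: add_uminus_conv_diff)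
  ultimately show ?thesis by (metis npow_uminus)
qed

lemma coupledD:
  assumes "coupled p q w" "(l, m) \<in> adj w"
  shows "(l = (p, True) \<longleftrightarrow> m = (q, True)) \<and> (l = (q, False) \<longleftrightarrow> m = (p, False))"
  using bspec[OF assms(1)[unfolded coupled_def] assms(2)] by simp

text \<open>If more than one generator occurs, each of the three alternatives makes \<open>i\<close>
  occur exactly when \<open>Suc i\<close> does, so all generators occur. Then every consecutive pair
  is coupled, and a positive letter can only be continued by repeating \<open>1, 2, ..., n\<close>
  cyclically.\<close>

lemma coupled_word_classification:
  assumes n: "n \<ge> 3" and w: "cyc_reduced w" "fst ` set w \<subseteq> {1..n}" "\<exists>l \<in> set w. snd l"
    and tri: "\<And>i. 1 \<le> i \<Longrightarrow> i < n \<Longrightarrow> fst ` set w \<subseteq> {i, Suc i} \<or> fst ` set w \<inter> {i, Suc i} = {} \<or>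
      coupled i (Suc i) w"
  shows "(\<exists>k. \<exists>j \<in> {1..n}. fw w = npow k (gen j) \<or> fw w = - npow k (gen j)) \<or>
    (\<exists>k. conjg (fw w) (npow k (delta n)))"
proof (cases "\<exists>j. fst ` set w \<subseteq> {j}")
  case True
  then obtain j where j: "fst ` set w \<subseteq> {j}" by blast
  from w(3) obtain l where "l \<in> set w" by blast
  then have "fst l \<in> {j}" "fst l \<in> {1..n}" using j w(2) by blast+
  then have "j \<in> {1..n}" by simp
  moreover have "reduced w" using w(1) by (simp add: cyc_reduced_iff)
  ultimately show ?thesis using reduced_singleton_support[OF _ j] by blast
next
  case False
  define I where "I = fst ` set w"
  have notsub: "\<not> I \<subseteq> {j}" for j using False by (simp add: I_def)
  have In: "I \<subseteq> {1..n}" using w(2) by (simp add: I_def)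
  note tri' = tri[folded I_def]
  have up: "Suc i \<in> I \<longleftrightarrow> i \<in> I" if i: "1 \<le> i" "i < n" for i
  proof -
    from tri'[OF i] consider "I \<subseteq> {i, Suc i}" | "I \<inter> {i, Suc i} = {}" | "coupled i (Suc i) w"
      by argo
    then show ?thesis
    proof cases
      case 1
      obtain a b where "a \<in> I" "a \<noteq> i" "b \<in> I" "b \<noteq> Suc i"
        using notsub[of i] notsub[of "Suc i"] unfolding subset_iff singleton_iff by metis
      moreover have "a = i \<or> a = Suc i" "b = i \<or> b = Suc i"
        using subsetD[OF 1 \<open>a \<in> I\<close>] subsetD[OF 1 \<open>b \<in> I\<close>] by simp_all
      ultimately show ?thesis by auto
    next
      case 2
      then have "i \<notin> I" "Suc i \<notin> I" by auto
      then show ?thesis by simp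
    next
      case 3
      have c: "(l = (i, True) \<longleftrightarrow> m = (Suc i, True)) \<and> (l = (Suc i, False) \<longleftrightarrow> m = (i, False))"
        if "(l, m) \<in> adj w" for l m using coupledD[OF 3 that] .
      have s: "(Suc i, b) \<in> set w" if h: "(i, b) \<in> set w" for b
      proof (cases b)
        case True
        with h have "(i, True) \<in> set w" by simp
        then obtain m where m: "((i, True), m) \<in> adj w" using adj_succ by metis
        show ?thesis using c[OF m] adj_in_set[OF m] True by simp
      next
        case False
        with h have "(i, False) \<in> set w" by simp
        then obtain m where m: "(m, (i, False)) \<in> adj w" using adj_pred by metis
        show ?thesis using c[OF m] adj_in_set[OF m] False by simp
      qed
      have p: "(i, b) \<in> set w" if h: "(Suc i, b) \<in> set w" for b
      proof (cases b)
        case True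
        with h have "(Suc i, True) \<in> set w" by simp
        then obtain m where m: "(m, (Suc i, True)) \<in> adj w" using adj_pred by metis
        show ?thesis using c[OF m] adj_in_set[OF m] True by simp
      next
        case False
        with h have "(Suc i, False) \<in> set w" by simp
        then obtain m where m: "((Suc i, False), m) \<in> adj w" using adj_succ by metis
        show ?thesis using c[OF m] adj_in_set[OF m] False by simp
      qed
      have I: "a \<in> I \<longleftrightarrow> (\<exists>b. (a, b) \<in> set w)" for a unfolding I_def by force
      show ?thesis unfolding I using s p by blast
    qed
  qed
  have "w \<noteq> []" using w(3) by auto
  then obtain i0 where i0: "i0 \<in> I" by (cases w) (auto simp: I_def)
  have i0n: "1 \<le> i0" "i0 \<le> n" using i0 In by auto
  have "1 \<in> I"
  proof -
    have "i0 - d \<in> I" if "d < i0" for d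
      using that
    proof (induction d)
      case (Suc d)
      have "Suc (i0 - Suc d) = i0 - d" using Suc.prems by simp
      then show ?case using Suc up[of "i0 - Suc d"] i0n by simp
    qed (use i0 in simp)
    from this[of "i0 - 1"] i0n show ?thesis by simp
  qed
  have all: "i \<in> I" if "1 \<le> i" "i \<le> n" for i
    using that
  proof (induction i rule: dec_induct)
    case base
    show ?case by fact
  next
    case (step i)
    then show ?case using up[of i] by simp
  qed
  have coup: "coupled i (Suc i) w" if i: "1 \<le> i" "i < n" for i
  proof -
    \<comment> \<open>Here \<open>n \<ge> 3\<close> matters: the generators \<open>1\<close>,
      \<open>2\<close>, \<open>3\<close> all occur and do not fit into one pair.\<close>
    have "card {1, 2, 3 :: nat} \<le> card {i, Suc i}" if "I \<subseteq> {i, Suc i}"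
    proof (rule card_mono)
      have "1 \<in> I" "2 \<in> I" "3 \<in> I" using all n by auto
      then show "{1, 2, 3} \<subseteq> {i, Suc i}" using that by blast
    qed simp
    then have "\<not> I \<subseteq> {i, Suc i}" by auto
    moreover have "I \<inter> {i, Suc i} \<noteq> {}" using all[of i] i by auto
    ultimately show ?thesis using tri'[OF i] by metis
  qed
  have c: "(l = (i, True) \<longleftrightarrow> m = (Suc i, True)) \<and> (l = (Suc i, False) \<longleftrightarrow> m = (i, False))"
    if "(l, m) \<in> adj w" "1 \<le> i" "i < n" for l m i
    using coupledD[OF coup[OF that(2,3)] that(1)] .
  have succ: "m = (if j < n then Suc j else 1, True)" if a: "((j, True), m) \<in> adj w" for j m
  proof -
    have j: "1 \<le> j" "j \<le> n" using adj_in_set[OF a] w(2) by force+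
    have m: "fst m \<in> {1..n}" using adj_in_set[OF a] w(2) by force
    obtain i b where ib: "m = (i, b)" by force
    show ?thesis
    proof (cases "j < n")
      case True
      then show ?thesis using c[OF a j(1)] by simp
    next
      case False
      then have jn: "j = n" using j by simp
      \<comment> \<open>After \<open>(n, True)\<close>, a letter \<open>(i, False)\<close> with
        \<open>i < n\<close> would need \<open>(Suc i, False)\<close> in front of it, and
        \<open>(n, False)\<close> would cancel. A positive letter other than \<open>1\<close> would
        need the preceding generator in front of it.\<close>
      have b
      proof (rule ccontr)
        assume "\<not> b"
        then have i: "m = (i, False)" using ib by simp
        show False
        proof (cases "i < n")
          case True
          then show False using c[OF a, of i] m i by auto
        next
          case False
          then have "m = neg (j, True)" using m i jn by auto
          then show False using w(1) a unfolding cyc_reduced_def by blast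
        qed
      qed
      moreover have "i = 1"
      proof (rule ccontr)
        assume "i \<noteq> 1"
        then have "1 \<le> i - 1" "i - 1 < n" "Suc (i - 1) = i" using m ib by auto
        then show False using c[OF a, of "i - 1"] \<open>b\<close> ib jn by auto
      qed
      ultimately show ?thesis using ib jn by simp
    qed
  qed
  obtain j where j: "(j, True) \<in> set w" using w(3) by force
  have "1 \<le> j" "j \<le> n" using j w(2) by force+
  have "(j + d, True) \<in> set w" if "j + d \<le> n" for d
    using that
  proof (induction d)
    case (Suc d)
    then obtain m where "((j + d, True), m) \<in> adj w" using adj_succ by force
    then show ?case using succ[of "j + d" m] Suc.prems adj_in_set by force
  qed (use j in simp)
  from this[of "n - j"] have "(n, True) \<in> set w" using \<open>j \<le> n\<close> by simp
  then obtain m where "((n, True), m) \<in> adj w" using adj_succ by force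
  then have "(1, True) \<in> set w" using succ[of n m] adj_in_set by force
  then obtain u v where uv: "w = u @ (1, True) # v" by (meson split_list)
  have "\<exists>k. fw (((1, True) # v) @ u) = npow k (delta n)"
  proof (rule cyclic_word_delta)
    show "((j, True), m) \<in> adj (((1, True) # v) @ u) \<Longrightarrow> m = (if j < n then Suc j else 1, True)" for j m
      unfolding adj_swap[of "(1, True) # v" u] using succ uv by simp
  qed (use n in simp_all)
  then obtain k where k: "fw (((1, True) # v) @ u) = npow k (delta n)" by blast
  have "conjg (fw w) (npow k (delta n))"
    using conjg_swap[of u "(1, True) # v"] unfolding uv k .
  then show ?thesis by blast
qed

lemma bounded_twists_positive:
  assumes n: "n \<ge> 3" and w: "cyc_reduced w" "fst ` set w \<subseteq> {1..n}" "\<exists>l \<in> set w. snd l" "conjg x (fw w)"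
    and C: "finite C"
    and tw: "\<And>i m. 1 \<le> i \<Longrightarrow> i < n \<Longrightarrow>
      \<exists>z \<in> C. conjg (pconj {i, Suc i} (- npow m (gen i + gen (Suc i))) x) z"
  shows "(\<exists>k. \<exists>j \<in> {1..n}. conjg x (npow k (gen j)) \<or> conjg x (- npow k (gen j))) \<or>
    (\<exists>k. conjg x (npow k (delta n)))"
proof -
  have "fst ` set w \<subseteq> {i, Suc i} \<or> fst ` set w \<inter> {i, Suc i} = {} \<or> coupled i (Suc i) w"
    if i: "1 \<le> i" "i < n" for i
  proof (rule ccontr)
    assume a: "\<not> ?thesis"
    have "coupled i (Suc i) w"
    proof (rule coupled_of_bounded[OF _ w(1) _ _ C])
      show "\<exists>l \<in> set w. fst l \<in> {i, Suc i}" "\<exists>l \<in> set w. fst l \<notin> {i, Suc i}"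
        using a by blast+
      show "\<exists>z \<in> C. conjg (pconj {i, Suc i} (- npow m (gen i + gen (Suc i))) (fw w)) z" for m
        using tw[OF i, of m] conjg_additive[OF additive_pconj conjg_sym[OF w(4)]] conjg_trans by meson
    qed simp
    with a show False by blast
  qed
  from coupled_word_classification[OF n w(1-3) this] show ?thesis
    using w(4) conjg_trans by metis
qed

text \<open>If the cyclically reduced form has only negative letters, its inverse is treated
  instead; the negative powers of \<open>delta n\<close> come from there.\<close>

lemma bounded_twists_classification:
  fixes x :: "nat fg"
  assumes n: "n \<ge> 3" and x: "x \<in> supp_in {1..n}" "x \<noteq> 0" and C: "finite C"
    and tw: "\<And>i m. 1 \<le> i \<Longrightarrow> i < n \<Longrightarrow>
      \<exists>z \<in> C. conjg (pconj {i, Suc i} (- npow m (gen i + gen (Suc i))) x) z"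
  shows "(\<exists>k. \<exists>j \<in> {1..n}. conjg x (npow k (gen j)) \<or> conjg x (- npow k (gen j))) \<or>
    (\<exists>k. conjg x (npow k (delta n)) \<or> conjg x (- npow k (delta n)))"
proof -
  obtain w where w: "cyc_reduced w" "conjg x (fw w)" "set w \<subseteq> set (wd x)" using exists_cyc_reduced by blast
  then have sub: "fst ` set w \<subseteq> {1..n}" using x(1) by (auto simp: supp_in_def)
  show ?thesis
  proof (cases "\<exists>l \<in> set w. snd l")
    case True
    then show ?thesis using bounded_twists_positive[OF n w(1) sub True w(2) C tw] by blast
  next
    case False
    have "w \<noteq> []" using w(2) x(2) by auto
    then have p: "\<exists>l \<in> set (word_inv w). snd l" using False by (cases w) (auto simp: set_word_inv)
    have s: "fst ` set (word_inv w) \<subseteq> {1..n}" using sub by (simp add: set_word_inv image_image)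
    have c: "conjg (- x) (fw (word_inv w))" using w(2) by (simp add: fw_word_inv conjg_uminus)
    have t: "\<exists>z \<in> uminus ` C. conjg (pconj {i, Suc i} (- npow m (gen i + gen (Suc i))) (- x)) z"
      if "1 \<le> i" "i < n" for i m
      using tw[OF that, of m] by (auto simp: additive_simps[OF additive_pconj] intro: conjg_uminus)
    note B = bounded_twists_positive[OF n cyc_reduced_word_inv[OF w(1)] s p c _ t]
    have m: "conjg x y" if "conjg (- x) (- y)" for y using conjg_uminus[OF that] by simp
    show ?thesis using B C m by (metis finite_imageI minus_minus)
  qed
qed

section \<open>The Artin action on the free group\<close>

text \<open>All braid groups act on one free group of infinite rank: \<open>sigma i\<close> moves the generators \<open>i\<close> and
  \<open>Suc i\<close> only, and the free group of rank \<open>n\<close> is \<open>supp_in {1..n}\<close>.\<close>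

lemmas grp_norm = add.assoc minus_add diff_conv_add_uminus

definition sigma :: "nat \<Rightarrow> nat fg \<Rightarrow> nat fg" where
  "sigma i = fext (\<lambda>a. if a = i then gen (Suc i)
     else if a = Suc i then - gen (Suc i) + gen i + gen (Suc i) else gen a)"

definition sigma_inv :: "nat \<Rightarrow> nat fg \<Rightarrow> nat fg" where
  "sigma_inv i = fext (\<lambda>a. if a = i then gen i + gen (Suc i) - gen i
     else if a = Suc i then gen i else gen a)"

lemma additive_sigma [simp]: "additive_map (sigma i)"
  and additive_sigma_inv [simp]: "additive_map (sigma_inv i)"
  by (simp_all add: sigma_def sigma_inv_def)

lemmas sigma_additive [simp] = additive_simps[OF additive_sigma] additive_simps[OF additive_sigma_inv]

lemma sigma_gen: "sigma i (gen a) = (if a = i then gen (Suc i)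
     else if a = Suc i then - gen (Suc i) + gen i + gen (Suc i) else gen a)"
  and sigma_inv_gen: "sigma_inv i (gen a) = (if a = i then gen i + gen (Suc i) - gen i
     else if a = Suc i then gen i else gen a)"
  by (simp_all add: sigma_def sigma_inv_def)

lemma sigma_sigma_inv [simp]: "sigma i (sigma_inv i x) = x"
  and sigma_inv_sigma [simp]: "sigma_inv i (sigma i x) = x"
proof -
  have "sigma i \<circ> sigma_inv i = id"
    by (rule additive_eq)
      (auto intro: additive_comp simp: sigma_gen sigma_inv_gen grp_norm simp del: add_uminus_conv_diff)
  then show "sigma i (sigma_inv i x) = x" by (metis comp_apply id_apply)
  have "sigma_inv i \<circ> sigma i = id"
    by (rule additive_eq)
      (auto intro: additive_comp simp: sigma_gen sigma_inv_gen grp_norm simp del: add_uminus_conv_diff)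
  then show "sigma_inv i (sigma i x) = x" by (metis comp_apply id_apply)
qed

lemma bij_sigma: "bij (sigma i)"
  by (rule bij_betw_byWitness[where f' = "sigma_inv i"]) auto

lemma sigma_braid:
  "sigma i \<circ> (sigma (Suc i) \<circ> sigma i) = sigma (Suc i) \<circ> (sigma i \<circ> sigma (Suc i))"
  by (rule additive_eq)
    (auto intro!: additive_comp simp: sigma_gen grp_norm simp del: add_uminus_conv_diff)

lemma sigma_commute:
  "i + 2 \<le> j \<Longrightarrow> sigma i \<circ> sigma j = sigma j \<circ> sigma i"
  by (rule additive_eq)
    (auto intro!: additive_comp simp: sigma_gen grp_norm simp del: add_uminus_conv_diff)

lemma sigma_supp_in:
  assumes "1 \<le> i" "i < n" "x \<in> supp_in {1..n}"
  shows "sigma i x \<in> supp_in {1..n}" "sigma_inv i x \<in> supp_in {1..n}"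
proof -
  have *: "f x \<in> supp_in {1..n}"
    if f: "additive_map f" "\<And>a. a \<in> {1..n} \<Longrightarrow> f (gen a) \<in> supp_in {1..n}" for f :: "nat fg \<Rightarrow> nat fg"
    using assms(3)
  proof (induction rule: supp_in_induct)
    case (gen a x)
    then show ?case using f(2)[of a] by (simp add: additive_simps[OF f(1)] supp_in_closed)
  next
    case (neg a x)
    then have "- f (gen a) + f x \<in> supp_in {1..n}" using f(2)[of a] by (intro supp_in_closed)
    then show ?case by (simp add: additive_simps[OF f(1)])
  qed (simp add: additive_simps[OF f(1)] supp_in_closed)
  show "sigma i x \<in> supp_in {1..n}" "sigma_inv i x \<in> supp_in {1..n}"
    by (rule *; use assms(1,2) in \<open>auto simp: sigma_gen sigma_inv_gen intro!: supp_in_closed\<close>)+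
qed

lemma sigma_delta:
  assumes "1 \<le> i" "i < n"
  shows "sigma i (delta n) = delta n" "sigma_inv i (delta n) = delta n"
proof -
  have low: "sigma i (delta k) = delta k" if "k < i" for k
  proof -
    have "sigma i (delta k) = id (delta k)"
      by (rule additive_eq_on[OF additive_sigma additive_id(1) _ delta_supp_in])
        (use that in \<open>auto simp: sigma_gen\<close>)
    then show ?thesis by simp
  qed
  obtain k where k: "i = Suc k" using assms(1) by (cases i) auto
  show s: "sigma i (delta n) = delta n"
    using assms(2)
  proof (induction n)
    case (Suc n)
    show ?case
    proof (cases "i < n")
      case True
      then show ?thesis using Suc.IH by (simp add: delta_Suc sigma_gen)
    next
      case False
      then have "n = Suc k" using Suc.prems k by simp
      then show ?thesis using low[of k] k
        by (simp add: delta_Suc sigma_gen grp_norm del: add_uminus_conv_diff)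
    qed
  qed simp
  show "sigma_inv i (delta n) = delta n" by (metis s sigma_inv_sigma)
qed

lemma sigma_square: "sigma i (sigma i x) = pconj {i, Suc i} (- (gen i + gen (Suc i))) x"
proof -
  have "sigma i \<circ> sigma i = pconj {i, Suc i} (- (gen i + gen (Suc i)))"
    by (rule additive_eq)
      (auto intro!: additive_comp simp: sigma_gen pconj_gen grp_norm simp del: add_uminus_conv_diff)
  then show ?thesis by (metis comp_apply)
qed

lemma sigma_twist: "((\<lambda>x. sigma i (sigma i x)) ^^ m) x = pconj {i, Suc i} (- npow m (gen i + gen (Suc i))) x"
proof (induction m)
  case (Suc m)
  have "- npow m (gen i + gen (Suc i)) \<in> supp_in {i, Suc i}"
    by (intro supp_in_closed npow_supp_in) auto
  moreover have "((\<lambda>x. sigma i (sigma i x)) ^^ Suc m) x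
      = sigma i (sigma i (pconj {i, Suc i} (- npow m (gen i + gen (Suc i))) x))"
    by (simp add: Suc)
  ultimately have "((\<lambda>x. sigma i (sigma i x)) ^^ Suc m) x
      = pconj {i, Suc i} (- (gen i + gen (Suc i)) + - npow m (gen i + gen (Suc i))) x"
    by (simp only: sigma_square pconj_pconj)
  then show ?case unfolding npow_Suc' by (simp only: minus_add)
qed simp


section \<open>Artin's characterization of braid automorphisms\<close>

text \<open>Factors are added on the right because a Hurwitz move precomposes an automorphism with
  \<open>sigma i\<close> or its inverse.\<close>

inductive braid_map :: "nat \<Rightarrow> (nat fg \<Rightarrow> nat fg) \<Rightarrow> bool" for n where
  id: "braid_map n id"
| sigma: "braid_map n f \<Longrightarrow> 1 \<le> i \<Longrightarrow> i < n \<Longrightarrow> braid_map n (f \<circ> sigma i)"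
| sigma_inv: "braid_map n f \<Longrightarrow> 1 \<le> i \<Longrightarrow> i < n \<Longrightarrow> braid_map n (f \<circ> sigma_inv i)"

section \<open>Hurwitz moves on conjugates of generators\<close>

lemma neg_eq_Pair: "neg l = (a, b) \<longleftrightarrow> l = (a, \<not> b)" "(a, b) = neg l \<longleftrightarrow> l = (a, \<not> b)"
  by (cases l; auto)+

lemma len_gen [simp]: "len (gen a) = 1"
  by (simp add: len_def)

text \<open>Under this condition the expression \<open>w + gen j - w\<close> is reduced as it
  stands, so its length is known exactly.\<close>

definition conj_normal :: "nat fg \<times> nat \<Rightarrow> bool" where
  "conj_normal = (\<lambda>(w, j). w = 0 \<or> fst (last (wd w)) \<noteq> j)"

lemma conj_normal_exists:
  assumes "conjg x (gen j)"
  shows "\<exists>w. x = w + gen j - w \<and> conj_normal (w, j)"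
proof -
  define P where "P w \<longleftrightarrow> x = w + gen j - w" for w
  have "\<exists>w. P w" using assms by (auto simp: conjg_def P_def)
  then obtain w where w: "P w" and min: "\<And>v. P v \<Longrightarrow> len w \<le> len v"
    using arg_min_nat_lemma[of P _ len] by blast
  have "conj_normal (w, j)"
  proof (rule ccontr)
    assume "\<not> conj_normal (w, j)"
    then have ne: "wd w \<noteq> []" "fst (last (wd w)) = j" by (auto simp: conj_normal_def)
    then obtain v b where v: "wd w = v @ [(j, b)]"
      by (metis append_butlast_last_id prod.collapse)
    have "w = fw v + fw [(j, b)]" by (metis v fw_append fw_wd)
    then have "P (fw v)" using w unfolding P_def
      by (cases b) (auto simp: fw_Cons grp_norm simp del: add_uminus_conv_diff)
    then have "len w \<le> len (fw v)" by (rule min)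
    also have "\<dots> \<le> length v" by (rule len_fw)
    finally show False using v by (simp add: len_def)
  qed
  then show ?thesis using w P_def by blast
qed

lemma conj_normal_len:
  assumes "conj_normal (w, j)"
  shows "len (w + gen j - w) = 2 * len w + 1"
proof -
  have r: "reduced (wd w @ [(j, True)] @ word_inv (wd w))"
    using assms by (auto simp: conj_normal_def successively_append_iff successively_Cons
        hd_word_inv neg_eq_Pair)
  have "fw (wd w @ [(j, True)] @ word_inv (wd w)) = w + gen j - w"
    by (simp add: fw_word_inv gen_def[symmetric] grp_norm fw_Cons del: add_uminus_conv_diff)
  then show ?thesis using len_fw_eq[OF r] by (simp add: len_def)
qed

lemma conj_len: "len (v + gen j - v) \<le> 2 * len v + 1"
  using len_plus[of "v + gen j" "- v"] len_plus[of v "gen j"] by simp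

text \<open>Since \<open>w\<close> does not end in the generator \<open>j\<close>, the word of
  \<open>w'\<close> is that of \<open>w\<close>, then the letter \<open>(j, \<not> b)\<close>, then
  a rest \<open>v\<close>. Adding \<open>y\<close> on the left of \<open>w'\<close> deletes this
  letter, so the conjugating element becomes shorter.\<close>

lemma hurwitz_shorter:
  assumes w: "conj_normal (w, j)" "conj_normal (w', j')"
    and r: "wd (- w + w') \<noteq> []" "hd (wd (- w + w')) = (j, \<not> b)"
  defines "x \<equiv> w + gen j - w" and "x' \<equiv> w' + gen j' - w'"
  defines "y \<equiv> if b then x else - x"
  shows "len (y + x' - y) < len x'"
proof -
  obtain v where v: "wd (- w + w') = (j, \<not> b) # v" using r by (metis list.collapse)
  have "reduced (wd w @ wd (- w + w'))"
    using w(1) r(2) by (auto simp: conj_normal_def successively_append_iff neg_eq_Pair)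
  then have "wd (w + (- w + w')) = wd w @ wd (- w + w')" by (rule wd_plus)
  then have lw': "len w' = len w + Suc (length v)"
    by (simp add: v len_def del: add_uminus_conv_diff)
  have "- w + w' = fw ((j, \<not> b) # v)" by (metis v fw_wd)
  then have e: "- w + w' = (if b then - gen j else gen j) + fw v" by (simp add: fw_Cons)
  have "y + w' = w + (if b then gen j else - gen j) + (- w + w')"
    unfolding y_def x_def by (simp add: grp_norm del: add_uminus_conv_diff)
  also have "\<dots> = w + fw v" unfolding e by (simp add: grp_norm del: add_uminus_conv_diff)
  finally have yw: "y + w' = w + fw v" .
  have "y + x' - y = (y + w') + gen j' - (y + w')"
    by (simp add: x'_def grp_norm del: add_uminus_conv_diff)
  then have "len (y + x' - y) \<le> 2 * len (w + fw v) + 1" unfolding yw using conj_len by metis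
  also have "\<dots> \<le> 2 * (len w + length v) + 1" using len_plus[of w "fw v"] len_fw[of v] by simp
  also have "\<dots> < 2 * len w' + 1" using lw' by simp
  also have "\<dots> = len x'" unfolding x'_def by (simp add: conj_normal_len[OF w(2)])
  finally show ?thesis .
qed

text \<open>For conjugates \<open>w\<^sub>k + gen j\<^sub>k - w\<^sub>k\<close> between which no Hurwitz move shortens anything, the middle
  letters \<open>j\<^sub>k\<close> survive in the product, whose reduced word is \<open>w\<^sub>1\<close> followed by \<open>tails\<close>.\<close>

fun tails :: "(nat fg \<times> nat) list \<Rightarrow> nat word" where
  "tails [] = []"
| "tails [(w, j)] = (j, True) # wd (- w)"
| "tails ((w, j) # (w', j') # L) = (j, True) # wd (- w + w') @ tails ((w', j') # L)"

text \<open>If the condition on the first letter fails, the move by \<open>sigma_inv i\<close>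
  shortens; if the one on the last letter fails, the move by \<open>sigma i\<close> does.\<close>

definition no_cancel :: "nat fg \<times> nat \<Rightarrow> nat fg \<times> nat \<Rightarrow> bool" where
  "no_cancel = (\<lambda>(w, j) (w', j'). - w + w' \<noteq> 0 \<longrightarrow>
     hd (wd (- w + w')) \<noteq> (j, False) \<and> last (wd (- w + w')) \<noteq> (j', False))"

lemma tails_reduced:
  assumes "successively no_cancel L" "\<forall>l \<in> set L. conj_normal l" "L \<noteq> []"
  shows "reduced (tails L) \<and> tails L \<noteq> [] \<and> hd (tails L) = (snd (hd L), True) \<and>
    fw (tails L) = - fst (hd L) + sum_list (map (\<lambda>(w, j). w + gen j - w) L)"
  using assms
proof (induction L rule: tails.induct)
  case (2 w j)
  have "hd (wd (- w)) \<noteq> (j, False)" if "w \<noteq> 0"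
    using 2 that by (auto simp: conj_normal_def wd_uminus hd_word_inv neg_eq_Pair)
  then have "reduced (tails [(w, j)])" by (auto simp: successively_Cons)
  moreover have "fw (tails [(w, j)]) = gen j + - w" by (simp add: fw_Cons del: add_uminus_conv_diff)
  ultimately show ?case by (simp add: grp_norm del: add_uminus_conv_diff)
next
  case (3 w j w' j' L)
  have IH: "reduced (tails ((w', j') # L))" "tails ((w', j') # L) \<noteq> []"
    "hd (tails ((w', j') # L)) = (j', True)"
    "fw (tails ((w', j') # L)) = - w' + sum_list (map (\<lambda>(w, j). w + gen j - w) ((w', j') # L))"
    using 3 by auto
  have nc: "- w + w' \<noteq> 0 \<Longrightarrow> hd (wd (- w + w')) \<noteq> (j, False) \<and> last (wd (- w + w')) \<noteq> (j', False)"
    using "3.prems"(1) by (simp add: no_cancel_def)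
  have "reduced (wd (- w + w') @ tails ((w', j') # L))"
    using IH nc by (auto simp: successively_append_iff neg_eq_Pair)
  moreover have "hd (wd (- w + w') @ tails ((w', j') # L)) \<noteq> (j, False)"
    using IH nc by (cases "- w + w' = 0") auto
  ultimately have "reduced (tails ((w, j) # (w', j') # L))"
    by (simp add: successively_Cons)
  moreover have "fw (tails ((w, j) # (w', j') # L)) = gen j + (- w + w') + fw (tails ((w', j') # L))"
    by (simp add: fw_Cons add.assoc)
  ultimately show ?case using IH(4) by (simp add: grp_norm del: add_uminus_conv_diff)
qed simp

lemma length_tails: "length L \<le> length (tails L)"
  by (induction L rule: tails.induct) auto

text \<open>Each conjugate contributes at least its middle letter. Equality leaves no room for
  connecting words, so all conjugators agree, nor for the last conjugator, so they vanish.\<close>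

lemma tails_minimal:
  "length (tails L) = length L \<Longrightarrow> tails L = pos_word (map snd L) \<and> (\<forall>l \<in> set L. fst l = 0)"
proof (induction L rule: tails.induct)
  case (3 w j w' j' L)
  have "length (wd (- w + w')) + length (tails ((w', j') # L)) = length ((w', j') # L)"
    using "3.prems" by simp
  with length_tails[of "(w', j') # L"]
  have "length (wd (- w + w')) = 0" "length (tails ((w', j') # L)) = length ((w', j') # L)" by linarith+
  then have "- w + w' = 0" by simp
  from "3.IH"[OF \<open>length (tails ((w', j') # L)) = length ((w', j') # L)\<close>]
  have IH: "tails ((w', j') # L) = pos_word (map snd ((w', j') # L))"
    "\<forall>l \<in> set ((w', j') # L). fst l = 0" by blast+
  then have "w' = 0" by simp
  with \<open>- w + w' = 0\<close> have "w = 0" by simp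
  have "tails ((w, j) # (w', j') # L) = (j, True) # tails ((w', j') # L)"
    using \<open>- w + w' = 0\<close> by simp
  then show ?case unfolding IH(1) using IH(2) \<open>w = 0\<close> by simp
qed auto

lemma map_fst_pos_word: "map fst (pos_word xs) = xs"
  by (induction xs) auto

lemma sum_two_changed:
  fixes g g' :: "nat \<Rightarrow> nat"
  assumes "1 \<le> i" "i < n" "\<And>k. k \<noteq> i \<Longrightarrow> k \<noteq> Suc i \<Longrightarrow> g' k = g k"
    and "g' i + g' (Suc i) < g i + g (Suc i)"
  shows "sum g' {1..n} < sum g {1..n}"
proof -
  have s: "sum h {1..n} = h i + h (Suc i) + sum h ({1..n} - {i} - {Suc i})" for h :: "nat \<Rightarrow> nat"
    using assms(1,2) sum.remove[of "{1..n}" i h] sum.remove[of "{1..n} - {i}" "Suc i" h] by simp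
  have "sum g' ({1..n} - {i} - {Suc i}) = sum g ({1..n} - {i} - {Suc i})"
    by (intro sum.cong) (auto intro: assms(3))
  then show ?thesis using s[of g] s[of g'] assms(4) by simp
qed

text \<open>Induction on the total length of the images of the generators. When no Hurwitz move
  shortens it, the product of the images is a word of length at least \<open>n\<close>, with
  equality only if all conjugators vanish. This product is \<open>delta n\<close>, of length exactly
  \<open>n\<close>, so \<open>f\<close> fixes the generators.\<close>

theorem artin_characterization:
  assumes "additive_map f" "f (delta n) = delta n"
    and "\<And>i. 1 \<le> i \<Longrightarrow> i \<le> n \<Longrightarrow> \<exists>j. conjg (f (gen i)) (gen j)"
  shows "\<exists>h. braid_map n h \<and> (\<forall>x \<in> supp_in {1..n}. f x = h x)"
  using assms
proof (induction "\<Sum>i = 1..n. len (f (gen i))" arbitrary: f rule: less_induct)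
  case less
  \<comment> \<open>Here \<open>t\<close> is \<open>sigma i\<close> or \<open>sigma_inv i\<close>
    and \<open>s\<close> is its inverse: \<open>f \<circ> t\<close> is shorter, and a braid map for
    it gives one for \<open>f\<close> by composing with \<open>s\<close> on the right.\<close>
  have step: ?case
    if t: "1 \<le> i" "i < n" "additive_map t" "additive_map s" "t (delta n) = delta n" "\<And>x. t (s x) = x"
        "\<And>x. x \<in> supp_in {1..n} \<Longrightarrow> s x \<in> supp_in {1..n}"
        "\<And>h. braid_map n h \<Longrightarrow> braid_map n (h \<circ> s)"
        "\<And>k. k \<noteq> i \<Longrightarrow> k \<noteq> Suc i \<Longrightarrow> t (gen k) = gen k"
        "\<And>k. 1 \<le> k \<Longrightarrow> k \<le> n \<Longrightarrow> \<exists>k'. 1 \<le> k' \<and> k' \<le> n \<and> conjg (t (gen k)) (gen k')"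
      and lt: "len (f (t (gen i))) + len (f (t (gen (Suc i)))) < len (f (gen i)) + len (f (gen (Suc i)))"
    for i and t s :: "nat fg \<Rightarrow> nat fg"
  proof -
    have "(\<Sum>i = 1..n. len ((f \<circ> t) (gen i))) < (\<Sum>i = 1..n. len (f (gen i)))"
      using t lt by (intro sum_two_changed[of i]) auto
    moreover have "additive_map (f \<circ> t)" using less.prems(1) t(3) by (rule additive_comp)
    moreover have "(f \<circ> t) (delta n) = delta n" using t(5) less.prems(2) by simp
    moreover have "\<exists>j. conjg ((f \<circ> t) (gen k)) (gen j)" if k: "1 \<le> k" "k \<le> n" for k
    proof -
      obtain k' where k': "1 \<le> k'" "k' \<le> n" "conjg (t (gen k)) (gen k')" using t(10)[OF k] by blast
      then show ?thesis using less.prems(3)[OF k'(1,2)] conjg_additive[OF less.prems(1) k'(3)]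
        by (auto dest: conjg_trans)
    qed
    ultimately obtain h where h: "braid_map n h" "\<forall>x \<in> supp_in {1..n}. (f \<circ> t) x = h x"
      using less.hyps[of "f \<circ> t"] by blast
    have "f x = (h \<circ> s) x" if "x \<in> supp_in {1..n}" for x
      using h(2) t(7)[OF that] t(6)[of x] by (metis comp_apply)
    then show ?thesis using t(8)[OF h(1)] by blast
  qed
  have "\<forall>i. \<exists>p. 1 \<le> i \<and> i \<le> n \<longrightarrow> f (gen i) = fst p + gen (snd p) - fst p \<and> conj_normal p"
  proof
    fix i
    show "\<exists>p. 1 \<le> i \<and> i \<le> n \<longrightarrow> f (gen i) = fst p + gen (snd p) - fst p \<and> conj_normal p"
    proof (cases "1 \<le> i \<and> i \<le> n")
      case True
      then obtain j where "conjg (f (gen i)) (gen j)" using less.prems(3) by blast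
      then obtain w where "f (gen i) = w + gen j - w" "conj_normal (w, j)"
        using conj_normal_exists by blast
      then show ?thesis by (intro exI[of _ "(w, j)"]) simp
    qed auto
  qed
  then obtain p where p: "\<And>i. 1 \<le> i \<Longrightarrow> i \<le> n \<Longrightarrow> f (gen i) = fst (p i) + gen (snd (p i)) - fst (p i)"
    "\<And>i. 1 \<le> i \<Longrightarrow> i \<le> n \<Longrightarrow> conj_normal (p i)" by metis
  show ?case
  proof (cases "\<exists>i. 1 \<le> i \<and> i < n \<and> \<not> no_cancel (p i) (p (Suc i))")
    case True
    then obtain i where i: "1 \<le> i" "i < n" and nc: "\<not> no_cancel (p i) (p (Suc i))" by blast
    obtain w j w' j' where pi: "p i = (w, j)" "p (Suc i) = (w', j')" by fastforce
    have x: "f (gen i) = w + gen j - w" "conj_normal (w, j)"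
      "f (gen (Suc i)) = w' + gen j' - w'" "conj_normal (w', j')"
      using p[of i] p[of "Suc i"] pi i by auto
    let ?x = "f (gen i)" and ?y = "f (gen (Suc i))"
    note fs = additive_simps[OF less.prems(1)]
    have ne: "wd (- w + w') \<noteq> []" and
      "hd (wd (- w + w')) = (j, False) \<or> last (wd (- w + w')) = (j', False)"
      using nc by (auto simp: no_cancel_def pi)
    then consider "hd (wd (- w + w')) = (j, False)" | "last (wd (- w + w')) = (j', False)" by blast
    then show ?thesis
    proof cases
      case 1
      then have "len (?x + ?y - ?x) < len ?y"
        using hurwitz_shorter[OF x(2,4) ne, of True] x(1,3) by simp
      then have "len (f (sigma_inv i (gen i))) + len (f (sigma_inv i (gen (Suc i)))) < len ?x + len ?y"
        by (simp add: sigma_inv_gen fs)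
      then show ?thesis
      proof (rule step[OF i, of "sigma_inv i" "sigma i", rotated -1])
        show "\<exists>k'. 1 \<le> k' \<and> k' \<le> n \<and> conjg (sigma_inv i (gen k)) (gen k')" if "1 \<le> k" "k \<le> n" for k
        proof (cases "k = i")
          case True
          then show ?thesis using i by (intro exI[of _ "Suc i"]) (simp add: sigma_inv_gen conjgI)
        next
          case False
          then show ?thesis using i that
            by (cases "k = Suc i") (auto simp: sigma_inv_gen intro: exI[of _ i] exI[of _ k])
        qed
      qed (use i in \<open>auto simp: sigma_delta sigma_supp_in sigma_inv_gen intro: braid_map.sigma simp del: One_nat_def\<close>)
    next
      case 2
      \<comment> \<open>A cancellation at the end becomes one at the beginning when the two
        conjugates are exchanged.\<close>
      have e: "wd (- w' + w) = word_inv (wd (- w + w'))"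
        by (simp add: wd_uminus[symmetric] minus_add del: add_uminus_conv_diff)
      then have "wd (- w' + w) \<noteq> []" "hd (wd (- w' + w)) = (j', \<not> False)"
        unfolding e using ne 2 by (auto simp: hd_word_inv)
      then have "len (- ?y + ?x - - ?y) < len ?x"
        using hurwitz_shorter[OF x(4,2), of False] x(1,3) by simp
      then have "len (f (sigma i (gen i))) + len (f (sigma i (gen (Suc i)))) < len ?x + len ?y"
        by (simp add: sigma_gen fs)
      then show ?thesis
      proof (rule step[OF i, of "sigma i" "sigma_inv i", rotated -1])
        show "\<exists>k'. 1 \<le> k' \<and> k' \<le> n \<and> conjg (sigma i (gen k)) (gen k')" if "1 \<le> k" "k \<le> n" for k
        proof (cases "k = Suc i")
          case True
          have "conjg (- gen (Suc i) + gen i - - gen (Suc i)) (gen i)" by (rule conjgI)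
          then show ?thesis using i True by (intro exI[of _ i]) (simp add: sigma_gen)
        next
          case False
          then show ?thesis using i that
            by (cases "k = i") (auto simp: sigma_gen intro: exI[of _ "Suc i"] exI[of _ k])
        qed
      qed (use i in \<open>auto simp: sigma_delta sigma_supp_in sigma_gen intro: braid_map.sigma_inv simp del: One_nat_def\<close>)
    qed
  next
    case False
    show ?thesis
    proof (cases "n = 0")
      case True
      have "f x = id x" if "x \<in> supp_in {1..n}" for x
        by (rule additive_eq_on[OF less.prems(1) _ _ that]) (use True in auto)
      then show ?thesis using braid_map.id by blast
    next
      case n: False
      define L where "L = map p [1..<Suc n]"
      have L: "L \<noteq> []" "length L = n" "\<forall>l \<in> set L. conj_normal l"
        using n p(2) by (auto simp: L_def)
      have "successively (\<lambda>i j. no_cancel (p i) (p j)) [a..<Suc n]" if "1 \<le> a" for a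
        using that
      proof (induction "Suc n - a" arbitrary: a)
        case (Suc d)
        then have "a < Suc n" by simp
        then show ?case
          using Suc.hyps(1)[of "Suc a"] Suc.hyps(2) Suc.prems False
          by (cases "a = n") (auto simp: upt_conv_Cons successively_Cons simp del: upt_Suc)
      qed simp
      then have "successively no_cancel L" by (simp add: L_def successively_map del: upt_Suc)
      note T = tails_reduced[OF this L(3,1)]
      have "sum_list (map (\<lambda>(w, j). w + gen j - w) L) = sum_list (map (\<lambda>i. f (gen i)) [1..<Suc n])"
        unfolding L_def map_map by (intro arg_cong[of _ _ sum_list] map_cong)
          (auto simp: p(1) case_prod_beta simp del: upt_Suc)
      also have "\<dots> = f (sum_list (map gen [1..<Suc n]))"
      proof -
        have "f (sum_list (map gen xs)) = sum_list (map (\<lambda>i. f (gen i)) xs)" for xs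
          by (induction xs) (auto simp: additive_simps[OF less.prems(1)])
        then show ?thesis by simp
      qed
      also have "\<dots> = delta n" using less.prems(2) by (simp only: delta_sum_list)
      finally have ft: "fst (hd L) + fw (tails L) = delta n" using T by simp
      have "conj_normal (hd L)" using L by simp
      moreover have wt: "wd (fw (tails L)) = tails L" using T wd_fw by blast
      ultimately have "reduced (wd (fst (hd L)) @ wd (fw (tails L)))"
        unfolding wt using T
        by (auto simp: successively_append_iff conj_normal_def case_prod_beta neg_eq_Pair)
      from wd_plus[OF this] have wd: "wd (fst (hd L)) @ tails L = pos_word [1..<Suc n]"
        unfolding ft wd_delta wt ..
      then have "length (wd (fst (hd L))) + length (tails L) = n"
        by (metis length_append length_map length_upt diff_Suc_1)
      with length_tails[of L] L(2) have len: "length (tails L) = length L" "length (wd (fst (hd L))) = 0" by linarith+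
      with tails_minimal have tm: "tails L = pos_word (map snd L)" "\<forall>l \<in> set L. fst l = 0" by auto
      then have "pos_word (map snd L) = pos_word [1..<Suc n]" using wd len(2) tm(1) by simp
      then have "map snd L = [1..<Suc n]" by (metis map_fst_pos_word)
      then have "map (snd \<circ> p) [1..<Suc n] = map (\<lambda>i. i) [1..<Suc n]" by (simp add: L_def del: upt_Suc)
      then have sp: "snd (p i) = i" if "i \<in> set [1..<Suc n]" for i
        using that unfolding map_eq_conv by auto
      have "f (gen i) = id (gen i)" if "i \<in> {1..n}" for i
      proof -
        have "p i \<in> set L" using that unfolding L_def set_map set_upt by auto
        moreover have "snd (p i) = i" using that by (intro sp) auto
        ultimately have "fst (p i) = 0" "snd (p i) = i" using tm(2) by auto
        then show ?thesis using p(1)[of i] that by auto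
      qed
      then have "f x = id x" if "x \<in> supp_in {1..n}" for x
        by (rule additive_eq_on[OF less.prems(1) additive_id(1) _ that])
      then show ?thesis using braid_map.id by blast
    qed
  qed
qed

section \<open>The braid group and the Artin group acting on the free group\<close>

lemma presented_induct [consumes 1, case_names one gen inv]:
  assumes "g \<in> carrier (presented_group X R)"
    and one: "P \<one>\<^bsub>presented_group X R\<^esub>"
    and gen: "\<And>x g. x \<in> X \<Longrightarrow> g \<in> carrier (presented_group X R) \<Longrightarrow> P g \<Longrightarrow>
      P (pres_gen X R x \<otimes>\<^bsub>presented_group X R\<^esub> g)"
    and inv: "\<And>x g. x \<in> X \<Longrightarrow> g \<in> carrier (presented_group X R) \<Longrightarrow> P g \<Longrightarrow>
      P (inv\<^bsub>presented_group X R\<^esub> pres_gen X R x \<otimes>\<^bsub>presented_group X R\<^esub> g)"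
  shows "P g"
proof -
  let ?G = "presented_group X R"
  interpret G: group ?G by simp
  have letter: "pres_class X R [(x, b)] = (if b then pres_gen X R x else inv\<^bsub>?G\<^esub> pres_gen X R x)"
    if "x \<in> X" for x b
  proof (cases b)
    case False
    have "pres_class X R [(x, False)] \<otimes>\<^bsub>?G\<^esub> pres_gen X R x = \<one>\<^bsub>?G\<^esub>"
      using that pres_class_eq[OF pres_cong.cancel[of "[]" X "[]" x False R]]
      by (simp add: pres_gen_def presented_mult presented_one)
    then show ?thesis
      using that False G.inv_equality[of "pres_class X R [(x, False)]" "pres_gen X R x"]
      by (simp add: presented_carrier pres_gen_def)
  qed (simp add: pres_gen_def)
  have "P (pres_class X R w)" if "w \<in> words X" for w
    using that
  proof (induction w)
    case Nil
    then show ?case using one by (simp add: presented_one)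
  next
    case (Cons l w)
    obtain x b where l: "l = (x, b)" by force
    with Cons have x: "x \<in> X" and w: "w \<in> words X" by auto
    have "pres_class X R (l # w) = pres_class X R [(x, b)] \<otimes>\<^bsub>?G\<^esub> pres_class X R w"
      using presented_mult[of "[(x, b)]" X w R] x w by (simp add: l)
    moreover have "pres_class X R w \<in> carrier ?G" using w by (auto simp: presented_carrier)
    ultimately show ?case using Cons.IH[OF w] x gen[OF x] inv[OF x] by (auto simp: letter)
  qed
  then show ?thesis using assms(1) by (auto simp: presented_carrier)
qed

lemma braid_induct [consumes 1, case_names one gen inv]:
  assumes "b \<in> carrier (braid_group n)" "P \<one>\<^bsub>braid_group n\<^esub>"
    and "\<And>i b. 1 \<le> i \<Longrightarrow> i < n \<Longrightarrow> b \<in> carrier (braid_group n) \<Longrightarrow> P b \<Longrightarrow>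
      P (alpha n i \<otimes>\<^bsub>braid_group n\<^esub> b)"
    and "\<And>i b. 1 \<le> i \<Longrightarrow> i < n \<Longrightarrow> b \<in> carrier (braid_group n) \<Longrightarrow> P b \<Longrightarrow>
      P (inv\<^bsub>braid_group n\<^esub> alpha n i \<otimes>\<^bsub>braid_group n\<^esub> b)"
  shows "P b"
  using assms unfolding braid_group_def alpha_def
  by (induction rule: presented_induct) auto

lemma artin_induct [consumes 1, case_names one gen inv]:
  assumes "a \<in> carrier (artin_B n)" "P \<one>\<^bsub>artin_B n\<^esub>"
    and "\<And>i a. 1 \<le> i \<Longrightarrow> i \<le> n \<Longrightarrow> a \<in> carrier (artin_B n) \<Longrightarrow> P a \<Longrightarrow>
      P (beta n i \<otimes>\<^bsub>artin_B n\<^esub> a)"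
    and "\<And>i a. 1 \<le> i \<Longrightarrow> i \<le> n \<Longrightarrow> a \<in> carrier (artin_B n) \<Longrightarrow> P a \<Longrightarrow>
      P (inv\<^bsub>artin_B n\<^esub> beta n i \<otimes>\<^bsub>artin_B n\<^esub> a)"
  shows "P a"
  using assms unfolding artin_B_def beta_def
  by (induction rule: presented_induct) auto

text \<open>All permutations of a type, as total functions: equality of group elements is equality
  of functions, also on generators outside \<open>1..n\<close>.\<close>

definition perm_group :: "('b \<Rightarrow> 'b) monoid" where
  "perm_group = \<lparr>carrier = {f. bij f}, monoid.mult = (\<circ>), one = id\<rparr>"

lemma perm_group_simps [simp]:
  "carrier perm_group = {f. bij f}" "f \<otimes>\<^bsub>perm_group\<^esub> g = f \<circ> g" "\<one>\<^bsub>perm_group\<^esub> = id"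
  by (simp_all add: perm_group_def)

lemma group_perm_group [simp]: "group (perm_group :: ('b \<Rightarrow> 'b) monoid)"
proof (rule groupI)
  fix f :: "'b \<Rightarrow> 'b" assume "f \<in> carrier perm_group"
  then have f: "bij f" by simp
  then have "bij (the_inv f)" "the_inv f \<circ> f = id"
    using bij_betw_the_inv_into[of f UNIV UNIV] the_inv_f_f[of f]
    by (auto simp: fun_eq_iff bij_def)
  then show "\<exists>g\<in>carrier perm_group. g \<otimes>\<^bsub>perm_group\<^esub> f = \<one>\<^bsub>perm_group\<^esub>" by auto
qed (auto simp: bij_comp comp_assoc)

section \<open>The braid group acting on the free group\<close>

definition rho :: "nat \<Rightarrow> nat word set \<Rightarrow> nat fg \<Rightarrow> nat fg" where
  "rho n = pres_hom {1..n - 1} (braid_rels n) perm_group sigma"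

lemma rho_hom: "rho n \<in> hom (braid_group n) perm_group"
  and rho_alpha: "\<And>i. 1 \<le> i \<Longrightarrow> i < n \<Longrightarrow> rho n (alpha n i) = sigma i"
proof -
  have f: "sigma \<in> {1..n - 1} \<rightarrow> carrier perm_group" by (simp add: bij_sigma)
  have R: "word_val perm_group sigma l = word_val perm_group sigma r"
    if "(l, r) \<in> braid_rels n" for l r
    using that sigma_braid sigma_commute unfolding braid_rels_def by auto
  show "rho n \<in> hom (braid_group n) perm_group"
    unfolding rho_def braid_group_def by (rule pres_hom_hom[OF group_perm_group f]) (rule R)
  show "rho n (alpha n i) = sigma i" if "1 \<le> i" "i < n" for i
    unfolding rho_def alpha_def by (rule pres_hom_gen[OF group_perm_group f R]) (use that in auto)
qed

lemma rho_mult: "a \<in> carrier (braid_group n) \<Longrightarrow> b \<in> carrier (braid_group n) \<Longrightarrow>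
    rho n (a \<otimes>\<^bsub>braid_group n\<^esub> b) = rho n a \<circ> rho n b"
  using rho_hom by (simp add: hom_def)

lemma rho_one [simp]: "rho n \<one>\<^bsub>braid_group n\<^esub> = id"
  using hom_one[OF rho_hom group_braid group_perm_group] by simp

lemma rho_inv_left: "b \<in> carrier (braid_group n) \<Longrightarrow> rho n (inv\<^bsub>braid_group n\<^esub> b) (rho n b x) = x"
  using rho_mult[of "inv\<^bsub>braid_group n\<^esub> b" n b] group.l_inv[OF group_braid, of b n]
    group.inv_closed[OF group_braid, of b n] by (metis comp_apply id_apply rho_one)

lemma rho_alpha_inv:
  assumes "1 \<le> i" "i < n"
  shows "rho n (inv\<^bsub>braid_group n\<^esub> alpha n i) = sigma_inv i"
proof
  fix x
  have "alpha n i \<in> carrier (braid_group n)" using assms by simp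
  from rho_inv_left[OF this, of "sigma_inv i x"]
  show "rho n (inv\<^bsub>braid_group n\<^esub> alpha n i) x = sigma_inv i x"
    using rho_alpha[OF assms] by simp
qed

lemma rho_induct [consumes 1, case_names id sigma sigma_inv]:
  assumes "b \<in> carrier (braid_group n)" "P id"
    and "\<And>i f. 1 \<le> i \<Longrightarrow> i < n \<Longrightarrow> P f \<Longrightarrow> P (sigma i \<circ> f)"
    and "\<And>i f. 1 \<le> i \<Longrightarrow> i < n \<Longrightarrow> P f \<Longrightarrow> P (sigma_inv i \<circ> f)"
  shows "P (rho n b)"
  using assms(1)
proof (induction rule: braid_induct)
  case (gen i b)
  then have "rho n (alpha n i \<otimes>\<^bsub>braid_group n\<^esub> b) = sigma i \<circ> rho n b"
    using rho_mult[of "alpha n i" n b] by (simp only: rho_alpha) simp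
  then show ?case using assms(3)[OF gen(1,2,4)] by (simp only:)
next
  case (inv i b)
  interpret group "braid_group n" by simp
  have "rho n (inv\<^bsub>braid_group n\<^esub> alpha n i \<otimes>\<^bsub>braid_group n\<^esub> b) = sigma_inv i \<circ> rho n b"
    using inv rho_mult[of "inv\<^bsub>braid_group n\<^esub> alpha n i" n b] by (simp only: rho_alpha_inv) simp
  then show ?case using assms(4)[OF inv(1,2,4)] by (simp only:)
qed (use assms(2) in \<open>simp only: rho_one\<close>)

lemma additive_rho: "b \<in> carrier (braid_group n) \<Longrightarrow> additive_map (rho n b)"
  by (rule rho_induct) (auto intro!: additive_comp simp del: comp_apply)

lemma rho_delta: "b \<in> carrier (braid_group n) \<Longrightarrow> rho n b (delta n) = delta n"
  by (induction rule: rho_induct[where P = "\<lambda>f. f (delta n) = delta n"]) (auto simp: sigma_delta)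

lemma rho_supp_in: "b \<in> carrier (braid_group n) \<Longrightarrow> x \<in> supp_in {1..n} \<Longrightarrow> rho n b x \<in> supp_in {1..n}"
  by (rule rho_induct[where P = "\<lambda>f. f x \<in> supp_in {1..n}"]) (simp_all add: sigma_supp_in del: One_nat_def)

lemma rho_gen_outside: "b \<in> carrier (braid_group n) \<Longrightarrow> a \<notin> {1..n} \<Longrightarrow> rho n b (gen a) = gen a"
  by (rule rho_induct[where P = "\<lambda>f. f (gen a) = gen a"]) (auto simp: sigma_gen sigma_inv_gen)

lemma rho_gen_conj:
  assumes b: "b \<in> carrier (braid_group n)" and a: "a \<in> {1..n}"
  shows "\<exists>c \<in> {1..n}. conjg (rho n b (gen a)) (gen c)"
  using b
proof (induction rule: rho_induct)
  case (sigma i f)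
  then obtain c where c: "c \<in> {1..n}" "conjg (f (gen a)) (gen c)" by blast
  have "conjg (- gen (Suc i) + gen i - - gen (Suc i)) (gen i)" by (rule conjgI)
  then have "\<exists>d \<in> {1..n}. conjg (sigma i (gen c)) (gen d)"
    using sigma(1,2) c(1)
    by (cases "c = i"; cases "c = Suc i")
      (auto simp: sigma_gen intro: bexI[of _ i] bexI[of _ "Suc i"] bexI[of _ c])
  then show ?case using conjg_additive[OF additive_sigma c(2)] by (auto dest: conjg_trans)
next
  case (sigma_inv i f)
  then obtain c where c: "c \<in> {1..n}" "conjg (f (gen a)) (gen c)" by blast
  have "conjg (gen i + gen (Suc i) - gen i) (gen (Suc i))" by (rule conjgI)
  then have "\<exists>d \<in> {1..n}. conjg (sigma_inv i (gen c)) (gen d)"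
    using sigma_inv(1,2) c(1)
    by (cases "c = i"; cases "c = Suc i")
      (auto simp: sigma_inv_gen intro: bexI[of _ i] bexI[of _ "Suc i"] bexI[of _ c])
  then show ?case using conjg_additive[OF additive_sigma_inv c(2)] by (auto dest: conjg_trans)
qed (use a in \<open>auto intro: bexI[of _ a]\<close>)

lemma braid_map_rho: "braid_map n h \<Longrightarrow> \<exists>b \<in> carrier (braid_group n). rho n b = h"
proof (induction rule: braid_map.induct)
  case id
  interpret group "braid_group n" by simp
  show ?case by (intro bexI[of _ "\<one>\<^bsub>braid_group n\<^esub>"]) auto
next
  case (sigma f i)
  interpret group "braid_group n" by simp
  from sigma obtain b where "b \<in> carrier (braid_group n)" "rho n b = f" by blast
  then show ?case using sigma(2,3)
    by (intro bexI[of _ "b \<otimes>\<^bsub>braid_group n\<^esub> alpha n i"]) (auto simp: rho_mult rho_alpha)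
next
  case (sigma_inv f i)
  interpret group "braid_group n" by simp
  from sigma_inv obtain b where "b \<in> carrier (braid_group n)" "rho n b = f" by blast
  then show ?case using sigma_inv(2,3)
    by (intro bexI[of _ "b \<otimes>\<^bsub>braid_group n\<^esub> inv\<^bsub>braid_group n\<^esub> alpha n i"])
      (auto simp: rho_mult rho_alpha_inv)
qed

text \<open>Letting the first generator act by translation, \<open>artin_B n\<close> acts by permutations of the free
  group. The image \<open>ev n a\<close> of \<open>0\<close> is the free component of \<open>a\<close>; that it inverts the map \<open>kap n\<close>
  from the free group to \<open>artin_B n\<close> is the freeness of the \<open>u\<^sub>i\<close>.\<close>

definition Theta :: "nat \<Rightarrow> nat word set \<Rightarrow> nat fg \<Rightarrow> nat fg" where
  "Theta n = pres_hom {1..n} (artin_B_rels n) perm_group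
     (\<lambda>i. if i = 1 then (\<lambda>x. gen 1 + x) else sigma (i - 1))"

lemma Theta:
  assumes n: "n \<ge> 2"
  shows Theta_hom: "Theta n \<in> hom (artin_B n) perm_group"
    and Theta_beta: "\<And>i. 1 \<le> i \<Longrightarrow> i \<le> n \<Longrightarrow>
      Theta n (beta n i) = (if i = 1 then (\<lambda>x. gen 1 + x) else sigma (i - 1))"
proof -
  let ?f = "\<lambda>i. if i = 1 then (\<lambda>x. gen 1 + x) else sigma (i - 1) :: nat fg \<Rightarrow> nat fg"
  have c: "?f \<in> {1..n} \<rightarrow> carrier perm_group" by (auto simp: bij_sigma)
  have r1: "?f 1 \<otimes>\<^bsub>perm_group\<^esub> ?f 2 \<otimes>\<^bsub>perm_group\<^esub> ?f 1 \<otimes>\<^bsub>perm_group\<^esub> ?f 2 =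
      ?f 2 \<otimes>\<^bsub>perm_group\<^esub> ?f 1 \<otimes>\<^bsub>perm_group\<^esub> ?f 2 \<otimes>\<^bsub>perm_group\<^esub> ?f 1"
    by (rule ext) (simp add: sigma_gen grp_norm del: add_uminus_conv_diff)
  have r2: "?f i \<otimes>\<^bsub>perm_group\<^esub> ?f (i + 1) \<otimes>\<^bsub>perm_group\<^esub> ?f i =
      ?f (i + 1) \<otimes>\<^bsub>perm_group\<^esub> ?f i \<otimes>\<^bsub>perm_group\<^esub> ?f (i + 1)" if "2 \<le> i" "i \<le> n - 1" for i
    using sigma_braid[of "i - 1"] that by (simp add: comp_assoc)
  have r3: "?f i \<otimes>\<^bsub>perm_group\<^esub> ?f j = ?f j \<otimes>\<^bsub>perm_group\<^esub> ?f i"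
    if "1 \<le> i" "i + 2 \<le> j" "j \<le> n" for i j
  proof (cases "i = 1")
    case True
    then show ?thesis using that by (auto simp: sigma_gen fun_eq_iff)
  next
    case False
    then show ?thesis using sigma_commute[of "i - 1" "j - 1"] that by simp
  qed
  note L = artin_B_lift[OF group_perm_group c n r1 r2 r3]
  show "Theta n \<in> hom (artin_B n) perm_group" unfolding Theta_def by (rule L(1))
  show "Theta n (beta n i) = ?f i" if "1 \<le> i" "i \<le> n" for i
    unfolding Theta_def by (rule L(2)[OF _ _ _ _ _ that])
qed

definition ev :: "nat \<Rightarrow> nat word set \<Rightarrow> nat fg" where
  "ev n a = Theta n a 0"

text \<open>Indices outside \<open>1..n\<close> give the identity. Thus \<open>kap n\<close> is a
  homomorphism on the whole free group and \<open>beta_kap_gen\<close> holds for every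
  index.\<close>

definition ugen :: "nat \<Rightarrow> nat \<Rightarrow> nat word set" where
  "ugen n = rec_nat \<one>\<^bsub>artin_B n\<^esub> (\<lambda>i u. if i = 0 then beta n 1
     else if Suc i \<le> n then beta n (Suc i) \<otimes>\<^bsub>artin_B n\<^esub> u \<otimes>\<^bsub>artin_B n\<^esub> inv\<^bsub>artin_B n\<^esub> beta n (Suc i)
     else \<one>\<^bsub>artin_B n\<^esub>)"

lemma ugen_0: "ugen n 0 = \<one>\<^bsub>artin_B n\<^esub>"
  and ugen_1: "ugen n (Suc 0) = beta n 1"
  and ugen_Suc: "1 \<le> i \<Longrightarrow> Suc i \<le> n \<Longrightarrow>
    ugen n (Suc i) = beta n (Suc i) \<otimes>\<^bsub>artin_B n\<^esub> ugen n i \<otimes>\<^bsub>artin_B n\<^esub> inv\<^bsub>artin_B n\<^esub> beta n (Suc i)"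
  by (simp_all add: ugen_def)

lemma ugen_large: "n \<ge> 1 \<Longrightarrow> n < i \<Longrightarrow> ugen n i = \<one>\<^bsub>artin_B n\<^esub>"
  by (cases i) (simp_all add: ugen_def)

definition kap :: "nat \<Rightarrow> nat fg \<Rightarrow> nat word set" where
  "kap n x = word_val (artin_B n) (ugen n) (wd x)"

section \<open>The affine action and the free component of an element\<close>

locale artin_group =
  fixes n :: nat
  assumes n2: "n \<ge> 2"
begin

abbreviation "A \<equiv> artin_B n"
abbreviation "B \<equiv> braid_group n"

abbreviation mult_A (infixl \<open>\<cdot>\<close> 70) where "a \<cdot> b \<equiv> a \<otimes>\<^bsub>A\<^esub> b"
abbreviation inv_A (\<open>inv\<^sub>A _\<close> [81] 80) where "inv\<^sub>A a \<equiv> inv\<^bsub>A\<^esub> a"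

sublocale A: group A by simp
sublocale B: group B by simp

lemma Theta_mult: "a \<in> carrier A \<Longrightarrow> a' \<in> carrier A \<Longrightarrow>
    Theta n (a \<cdot> a') x = Theta n a (Theta n a' x)"
  using Theta_hom[OF n2] by (simp add: hom_def)

lemma Theta_one [simp]: "Theta n \<one>\<^bsub>A\<^esub> = id"
  using hom_one[OF Theta_hom[OF n2] group_artin_B group_perm_group] by simp

lemma Theta_beta_inv:
  assumes "1 \<le> i" "i \<le> n"
  shows "Theta n (inv\<^sub>A beta n i) = (if i = 1 then (\<lambda>x. - gen 1 + x) else sigma_inv (i - 1))"
proof
  fix x
  let ?g = "if i = 1 then (\<lambda>x. - gen 1 + x) else sigma_inv (i - 1)"
  have c: "beta n i \<in> carrier A" using assms by simp
  have "x = Theta n (beta n i) (?g x)"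
    using Theta_beta[OF n2 assms] by (simp del: add_uminus_conv_diff)
  then have "Theta n (inv\<^sub>A beta n i) x = Theta n (inv\<^sub>A beta n i \<cdot> beta n i) (?g x)"
    using Theta_mult[of "inv\<^sub>A beta n i" "beta n i" "?g x"] c by simp
  then show "Theta n (inv\<^sub>A beta n i) x = ?g x" using c by simp
qed

lemma pi_B_closed [simp]: "a \<in> carrier A \<Longrightarrow> pi_B n a \<in> carrier B"
  using pi_B_hom[OF n2] by (auto simp: hom_def)

lemma pi_B_one [simp]: "pi_B n \<one>\<^bsub>A\<^esub> = \<one>\<^bsub>B\<^esub>"
  using hom_one[OF pi_B_hom[OF n2] group_artin_B group_braid] .

sublocale pi: group_hom A B "pi_B n"
  using pi_B_hom[OF n2] by unfold_locales

sublocale s: group_hom B A "section_B n"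
  using section_B_hom by unfold_locales

lemma ev_Theta: "a \<in> carrier A \<Longrightarrow> a' \<in> carrier A \<Longrightarrow> ev n (a \<cdot> a') = Theta n a (ev n a')"
  by (simp add: ev_def Theta_mult)

text \<open>Each generator acts by a translation or by an automorphism, so every element acts
  affinely: the automorphism of its braid component, then the translation by its free component.
  Compatibility with products makes \<open>ev n\<close> a crossed homomorphism
  (\<open>ev_mult\<close>).\<close>

lemma Theta_eq: "a \<in> carrier A \<Longrightarrow> Theta n a x = ev n a + rho n (pi_B n a) x"
proof (induction arbitrary: x rule: artin_induct)
  case one
  then show ?case by (simp add: ev_def)
next
  case (gen i a)
  have c: "beta n i \<in> carrier A" using gen by simp
  have "Theta n (beta n i \<cdot> a) x = Theta n (beta n i) (ev n a + rho n (pi_B n a) x)"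
    using gen(4)[of x] c gen(3) by (simp only: Theta_mult)
  then show ?case using gen(1-3) c
    by (cases "i = 1")
      (auto simp: ev_Theta Theta_beta[OF n2] pi_B_beta[OF n2] rho_mult rho_alpha add.assoc)
next
  case (inv i a)
  have c: "beta n i \<in> carrier A" using inv by simp
  have "Theta n (inv\<^sub>A beta n i \<cdot> a) x = Theta n (inv\<^sub>A beta n i) (ev n a + rho n (pi_B n a) x)"
    using inv(4)[of x] c inv(3) by (simp only: Theta_mult A.inv_closed)
  then show ?case using inv(1-3) c
    by (cases "i = 1")
      (auto simp: ev_Theta Theta_beta_inv pi_B_beta[OF n2] rho_mult rho_alpha_inv add.assoc simp del: add_uminus_conv_diff)
qed

lemma ev_mult: "a \<in> carrier A \<Longrightarrow> a' \<in> carrier A \<Longrightarrow>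
    ev n (a \<cdot> a') = ev n a + rho n (pi_B n a) (ev n a')"
  using Theta_mult[of a a' 0] Theta_eq[of a "ev n a'"] by (simp add: ev_def)

lemma ev_one [simp]: "ev n \<one>\<^bsub>A\<^esub> = 0"
  by (simp add: ev_def)

lemma ev_beta: "1 \<le> i \<Longrightarrow> i \<le> n \<Longrightarrow> ev n (beta n i) = (if i = 1 then gen 1 else 0)"
  and ev_beta_inv: "1 \<le> i \<Longrightarrow> i \<le> n \<Longrightarrow> ev n (inv\<^sub>A beta n i) = (if i = 1 then - gen 1 else 0)"
  by (simp_all add: ev_def Theta_beta[OF n2] Theta_beta_inv)

lemma ev_supp_in: "a \<in> carrier A \<Longrightarrow> ev n a \<in> supp_in {1..n}"
proof (induction rule: artin_induct)
  case (gen i a)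
  then show ?case using n2
    by (auto simp: ev_mult ev_beta intro!: supp_in_closed rho_supp_in simp del: One_nat_def)
next
  case (inv i a)
  then show ?case using n2
    by (auto simp: ev_mult ev_beta_inv intro!: supp_in_closed rho_supp_in
        simp del: One_nat_def add_uminus_conv_diff)
qed (simp add: supp_in_closed)

lemma ev_section: "b \<in> carrier B \<Longrightarrow> ev n (section_B n b) = 0"
proof (induction rule: braid_induct)
  case (gen i b)
  then show ?case
    by (simp add: section_B_alpha ev_mult ev_beta additive_zero[OF additive_rho])
next
  case (inv i b)
  then show ?case
    by (simp add: section_B_alpha ev_mult ev_beta_inv additive_zero[OF additive_rho])
qed simp

end

section \<open>The semidirect product structure of the Artin group\<close>

context group
begin

text \<open>The relation \<open>x \<otimes> g = g \<otimes> y\<close> in the form that rewrites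
  inside products associated to the right.\<close>

lemma conj_rel_mult:
  assumes "x \<otimes> g = g \<otimes> y" "x \<in> carrier G" "y \<in> carrier G" "g \<in> carrier G" "z \<in> carrier G"
  shows "x \<otimes> (g \<otimes> z) = g \<otimes> (y \<otimes> z)"
  using assms by (metis m_assoc)

lemma conj_rel_inv:
  assumes "x \<otimes> g = g \<otimes> y" "x \<in> carrier G" "y \<in> carrier G" "g \<in> carrier G"
  shows "y \<otimes> inv g = inv g \<otimes> x"
proof -
  have "inv g \<otimes> (x \<otimes> g) \<otimes> inv g = inv g \<otimes> (g \<otimes> y) \<otimes> inv g" using assms(1) by simp
  then show ?thesis using assms(2-) by (simp add: m_assoc) (simp add: m_assoc[symmetric])
qed

lemma conj_rel_inv_left:
  assumes "x \<otimes> g = g \<otimes> y" "x \<in> carrier G" "y \<in> carrier G" "g \<in> carrier G"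
  shows "inv x \<otimes> g = g \<otimes> inv y"
proof -
  have e: "inv x \<otimes> (x \<otimes> g) = g" "g \<otimes> y \<otimes> inv y = g"
    using assms(2-) by (simp add: m_assoc[symmetric]) (simp add: assms(2-) m_assoc)
  have "inv x \<otimes> g = inv x \<otimes> (g \<otimes> y) \<otimes> inv y" using e(2) assms(2-) by (simp add: m_assoc)
  also have "\<dots> = g \<otimes> inv y" using e(1) by (simp only: assms(1)[symmetric])
  finally show ?thesis .
qed

lemma conj_commute:
  assumes "x \<otimes> g = g \<otimes> y" "y \<otimes> u = u \<otimes> y"
    and c: "x \<in> carrier G" "y \<in> carrier G" "g \<in> carrier G" "u \<in> carrier G"
  shows "x \<otimes> (g \<otimes> u \<otimes> inv g) = g \<otimes> u \<otimes> inv g \<otimes> x"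
proof -
  have "x \<otimes> (g \<otimes> u \<otimes> inv g) = g \<otimes> (y \<otimes> (u \<otimes> inv g))"
    using conj_rel_mult[OF assms(1), of "u \<otimes> inv g"] c by (simp add: m_assoc)
  also have "\<dots> = g \<otimes> (u \<otimes> (y \<otimes> inv g))"
    using conj_rel_mult[OF assms(2), of "inv g"] c by simp
  also have "\<dots> = g \<otimes> (u \<otimes> (inv g \<otimes> x))" using conj_rel_inv[OF assms(1)] c by simp
  finally show ?thesis using c by (simp add: m_assoc)
qed

text \<open>The element \<open>b \<otimes> c\<close> conjugates \<open>a\<close> to \<open>x\<close>
  and \<open>b\<close> to \<open>c\<close>, so the claim is the first relation transported by it.
  This is the induction step of \<open>ugen_beta_four_braid\<close>.\<close>

lemma four_braid_conj:
  assumes "a \<otimes> b \<otimes> a \<otimes> b = b \<otimes> a \<otimes> b \<otimes> a" "b \<otimes> c \<otimes> b = c \<otimes> b \<otimes> c" "a \<otimes> c = c \<otimes> a"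
    and c: "a \<in> carrier G" "b \<in> carrier G" "c \<in> carrier G"
  defines "x \<equiv> b \<otimes> a \<otimes> inv b"
  shows "x \<otimes> c \<otimes> x \<otimes> c = c \<otimes> x \<otimes> c \<otimes> x"
proof -
  define h where "h = b \<otimes> c"
  have carr: "x \<in> carrier G" "h \<in> carrier G" using c by (simp_all add: x_def h_def)
  have xh: "x \<otimes> h = h \<otimes> a"
    using c assms(3) by (simp add: x_def h_def m_assoc) (simp add: m_assoc[symmetric])
  have ch: "c \<otimes> h = h \<otimes> b" using c assms(2) by (simp add: h_def m_assoc)
  note X = xh conj_rel_mult[OF xh] and C = ch conj_rel_mult[OF ch]
  have "x \<otimes> c \<otimes> x \<otimes> c \<otimes> h = h \<otimes> (a \<otimes> b \<otimes> a \<otimes> b)"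
    using carr c by (simp add: m_assoc X C)
  also have "\<dots> = h \<otimes> (b \<otimes> a \<otimes> b \<otimes> a)" by (simp only: assms(1))
  also have "\<dots> = c \<otimes> x \<otimes> c \<otimes> x \<otimes> h"
    using carr c by (simp add: m_assoc X C)
  finally show ?thesis using carr c by simp
qed

end

context artin_group
begin

lemma ugen_closed [simp]: "ugen n i \<in> carrier A"
proof (induction i)
  case (Suc i)
  then show ?case using n2 ugen_Suc[of i n] ugen_large[of n "Suc i"] ugen_1
    by (cases "i = 0"; cases "Suc i \<le> n") auto
qed (simp add: ugen_0)

lemma word_val_ugen_push:
  "word_val A (ugen n) (push l w) = word_val A (ugen n) [l] \<cdot> word_val A (ugen n) w"
proof -
  have c: "word_val A (ugen n) w \<in> carrier A" for w
    by (rule word_val_closed[where X = UNIV]) (auto simp: words_def)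
  show ?thesis
  proof (cases w)
    case (Cons m v)
    then show ?thesis using c[of v]
      by (cases "m = neg l"; cases l) (auto simp: push_def A.m_assoc[symmetric])
  qed (cases l, simp add: push_def)
qed

lemma kap_closed [simp]: "kap n x \<in> carrier A"
  unfolding kap_def by (rule word_val_closed[where X = UNIV]) (auto simp: words_def)

lemma kap_0 [simp]: "kap n 0 = \<one>\<^bsub>A\<^esub>"
  and kap_gen [simp]: "kap n (gen i) = ugen n i"
  by (simp_all add: kap_def)

lemma kap_plus [simp]: "kap n (x + y) = kap n x \<cdot> kap n y"
proof -
  have c: "word_val A (ugen n) w \<in> carrier A" for w
    by (rule word_val_closed[where X = UNIV]) (auto simp: words_def)
  have "word_val A (ugen n) (foldr push u w) = word_val A (ugen n) u \<cdot> word_val A (ugen n) w" for u w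
  proof (induction u)
    case (Cons l u)
    then show ?case using c by (cases l) (simp add: word_val_ugen_push A.m_assoc)
  qed (simp add: c)
  then show ?thesis by (simp add: kap_def plus_fg_def wd_Abs_fg foldr_push_reduced)
qed

lemma kap_uminus [simp]: "kap n (- x) = inv\<^sub>A kap n x"
  using kap_plus[of "- x" x] by (intro A.inv_equality[symmetric]) (simp_all del: kap_plus)

lemma kap_minus [simp]: "kap n (x - y) = kap n x \<cdot> inv\<^sub>A kap n y"
  using kap_plus[of x "- y"] by simp

lemma beta_commute:
  "1 \<le> i \<Longrightarrow> i + 2 \<le> j \<Longrightarrow> j \<le> n \<Longrightarrow> beta n j \<cdot> beta n i = beta n i \<cdot> beta n j"
  using artin_B_relations(3)[of i j n] by simp

lemma beta_ugen_above:
  "1 \<le> j \<Longrightarrow> j + 2 \<le> k \<Longrightarrow> k \<le> n \<Longrightarrow> beta n k \<cdot> ugen n j = ugen n j \<cdot> beta n k"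
proof (induction j rule: dec_induct)
  case base
  then show ?case using beta_commute[of 1 k] by (simp add: ugen_1)
next
  case (step j)
  have s: "ugen n (Suc j) = beta n (Suc j) \<cdot> ugen n j \<cdot> inv\<^sub>A beta n (Suc j)"
    using step by (intro ugen_Suc) auto
  show ?case unfolding s
    by (rule A.conj_commute[OF beta_commute[of "Suc j" k] step.IH]) (use step in auto)
qed

text \<open>In the base case \<open>j = Suc k\<close>, \<open>ugen n j\<close> is
  \<open>ugen n (k - 1)\<close> conjugated by \<open>beta n (Suc k) \<cdot> beta n k\<close>. This
  conjugation carries \<open>beta n (Suc k)\<close>, which commutes with
  \<open>ugen n (k - 1)\<close>, to \<open>beta n k\<close>.\<close>

lemma beta_ugen_below:
  assumes k: "2 \<le> k" "k < j" "j \<le> n"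
  shows "beta n k \<cdot> ugen n j = ugen n j \<cdot> beta n k"
proof -
  have "Suc k \<le> j" using k by simp
  then show ?thesis using k(3)
  proof (induction j rule: dec_induct)
    case base
    let ?g = "beta n (Suc k) \<cdot> beta n k"
    obtain m where m: "k = Suc m" "1 \<le> m" using k(1) by (cases k) auto
    have c: "beta n k \<in> carrier A" "beta n (Suc k) \<in> carrier A" using base k by auto
    have u: "ugen n (Suc k) = ?g \<cdot> ugen n m \<cdot> inv\<^sub>A ?g"
      using ugen_Suc[of k n] ugen_Suc[of m n] base k m c by (simp add: A.m_assoc A.inv_mult_group)
    have bg: "beta n k \<cdot> ?g = ?g \<cdot> beta n (Suc k)"
      using artin_B_relations(2)[of k n] base k c by (simp add: A.m_assoc)
    have bu: "beta n (Suc k) \<cdot> ugen n m = ugen n m \<cdot> beta n (Suc k)"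
      using beta_ugen_above[of m "Suc k"] base m by simp
    show ?case unfolding u by (rule A.conj_commute[OF bg bu]) (use c in auto)
  next
    case (step j)
    have s: "ugen n (Suc j) = beta n (Suc j) \<cdot> ugen n j \<cdot> inv\<^sub>A beta n (Suc j)"
      using step k by (intro ugen_Suc) auto
    have "beta n k \<cdot> beta n (Suc j) = beta n (Suc j) \<cdot> beta n k"
      using beta_commute[of k "Suc j"] step k by simp
    then show ?case unfolding s
      by (rule A.conj_commute) (use step k in auto)
  qed
qed

lemma ugen_beta_four_braid:
  "1 \<le> i \<Longrightarrow> i < n \<Longrightarrow> ugen n i \<cdot> beta n (Suc i) \<cdot> ugen n i \<cdot> beta n (Suc i) =
    beta n (Suc i) \<cdot> ugen n i \<cdot> beta n (Suc i) \<cdot> ugen n i"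
proof (induction i rule: dec_induct)
  case base
  then show ?case using artin_B_relations(1)[OF n2] by (simp add: ugen_1 numeral_2_eq_2)
next
  case (step i)
  have s: "ugen n (Suc i) = beta n (Suc i) \<cdot> ugen n i \<cdot> inv\<^sub>A beta n (Suc i)"
    using step by (intro ugen_Suc) auto
  show ?case unfolding s
  proof (rule A.four_braid_conj)
    show "beta n (Suc i) \<cdot> beta n (Suc (Suc i)) \<cdot> beta n (Suc i) =
      beta n (Suc (Suc i)) \<cdot> beta n (Suc i) \<cdot> beta n (Suc (Suc i))"
      using artin_B_relations(2)[of "Suc i" n] step by simp
    show "ugen n i \<cdot> beta n (Suc (Suc i)) = beta n (Suc (Suc i)) \<cdot> ugen n i"
      using beta_ugen_above[of i "Suc (Suc i)"] step by simp
  qed (use step in auto)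
qed

lemma beta_kap_gen:
  assumes i: "1 \<le> i" "i < n"
  shows "beta n (Suc i) \<cdot> kap n (gen a) = kap n (sigma i (gen a)) \<cdot> beta n (Suc i)"
proof -
  let ?b = "beta n (Suc i)" and ?u = "ugen n i" and ?v = "ugen n (Suc i)"
  have b: "?b \<in> carrier A" using i by simp
  have v: "?v = ?b \<cdot> ?u \<cdot> inv\<^sub>A ?b" using i by (intro ugen_Suc) auto
  have vb: "?v \<cdot> ?b = ?b \<cdot> ?u" using b by (simp add: v A.m_assoc)
  consider "a = i" | "a = Suc i" | "1 \<le> a" "a < i" | "Suc i < a" "a \<le> n" | "a = 0 \<or> n < a"
    using i by linarith
  then show ?thesis
  proof cases
    case 1
    then show ?thesis using vb by (simp add: sigma_gen)
  next
    case 2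
    \<comment> \<open>Written in terms of \<open>?v\<close>, the conjugate of \<open>?u\<close> by
      \<open>?b\<close>, the relation \<open>ugen_beta_four_braid\<close> becomes the formula for
      the image of \<open>gen (Suc i)\<close> under \<open>sigma i\<close>.\<close>
    have "?v \<cdot> (?b \<cdot> ?v) \<cdot> ?b = ?u \<cdot> ?v \<cdot> ?b \<cdot> ?b"
    proof -
      have "?v \<cdot> (?b \<cdot> ?v) \<cdot> ?b = (?v \<cdot> ?b) \<cdot> (?v \<cdot> ?b)" using b by (simp add: A.m_assoc)
      also have "\<dots> = ?b \<cdot> ?u \<cdot> ?b \<cdot> ?u" unfolding vb using b by (simp add: A.m_assoc)
      also have "\<dots> = ?u \<cdot> ?b \<cdot> ?u \<cdot> ?b" using ugen_beta_four_braid[OF i] by simp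
      also have "\<dots> = ?u \<cdot> (?v \<cdot> ?b) \<cdot> ?b" unfolding vb using b by (simp add: A.m_assoc)
      finally show ?thesis using b by (simp add: A.m_assoc)
    qed
    then have "?v \<cdot> (?b \<cdot> ?v) = ?u \<cdot> ?v \<cdot> ?b"
      by (rule A.right_cancel[THEN iffD1, rotated -1]) (use b in simp_all)
    then have e: "?b \<cdot> ?v = inv\<^sub>A ?v \<cdot> (?u \<cdot> ?v \<cdot> ?b)"
      by (subst A.inv_solve_left) (use b in simp_all)
    have k: "kap n (sigma i (gen (Suc i))) = inv\<^sub>A ?v \<cdot> ?u \<cdot> ?v"
      by (simp add: sigma_gen)
    have "inv\<^sub>A ?v \<cdot> ?u \<cdot> ?v \<cdot> ?b = inv\<^sub>A ?v \<cdot> (?u \<cdot> ?v \<cdot> ?b)"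
      using b by (simp add: A.m_assoc)
    then show ?thesis by (simp only: 2 e k kap_gen)
  next
    case 3
    then show ?thesis using beta_ugen_above[of a "Suc i"] i by (simp add: sigma_gen)
  next
    case 4
    then show ?thesis using beta_ugen_below[of "Suc i" a] i by (simp add: sigma_gen)
  next
    case 5
    then have "ugen n a = \<one>\<^bsub>A\<^esub>" using ugen_0[of n] ugen_large[of n a] n2 by (elim disjE) simp_all
    moreover have "a \<noteq> i" "a \<noteq> Suc i" using 5 i by linarith+
    ultimately show ?thesis using b by (simp add: sigma_gen)
  qed
qed

lemma beta_kap:
  assumes i: "1 \<le> i" "i < n"
  shows "beta n (Suc i) \<cdot> kap n x = kap n (sigma i x) \<cdot> beta n (Suc i)"
proof (induction x rule: fg_induct)
  case zero
  then show ?case using i by simp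
next
  case (gen a x)
  have b: "beta n (Suc i) \<in> carrier A" using i by simp
  show ?case using A.conj_rel_mult[OF beta_kap_gen[OF i, of a, symmetric], of "kap n x"] gen b
    by (simp add: A.m_assoc del: kap_gen)
next
  case (neg a x)
  have b: "beta n (Suc i) \<in> carrier A" using i by simp
  have "inv\<^sub>A kap n (sigma i (gen a)) \<cdot> beta n (Suc i) = beta n (Suc i) \<cdot> inv\<^sub>A kap n (gen a)"
    by (rule A.conj_rel_inv_left[OF beta_kap_gen[OF i, of a, symmetric]]) (use b in auto)
  from A.conj_rel_mult[OF this, of "kap n x"] show ?case using neg b
    by (simp add: A.m_assoc del: kap_gen add_uminus_conv_diff)
qed

lemma section_kap:
  assumes "b \<in> carrier B"
  shows "section_B n b \<cdot> kap n x = kap n (rho n b x) \<cdot> section_B n b"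
  using assms
proof (induction arbitrary: x rule: braid_induct)
  case (gen i b)
  have c: "beta n (Suc i) \<in> carrier A" "section_B n b \<in> carrier A" using gen by auto
  have "section_B n (alpha n i \<otimes>\<^bsub>B\<^esub> b) \<cdot> kap n x
      = beta n (Suc i) \<cdot> (section_B n b \<cdot> kap n x)"
    using gen c by (simp add: section_B_alpha A.m_assoc)
  also have "\<dots> = beta n (Suc i) \<cdot> kap n (rho n b x) \<cdot> section_B n b"
    using gen c by (simp add: A.m_assoc)
  also have "\<dots> = kap n (sigma i (rho n b x)) \<cdot> (beta n (Suc i) \<cdot> section_B n b)"
    using c by (simp add: beta_kap[OF gen(1,2)] A.m_assoc)
  finally show ?case using gen c by (simp add: section_B_alpha rho_mult rho_alpha)
next
  case (inv i b)
  have c: "beta n (Suc i) \<in> carrier A" "section_B n b \<in> carrier A" using inv by auto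
  have "kap n y \<cdot> beta n (Suc i) = beta n (Suc i) \<cdot> kap n (sigma_inv i y)" for y
    using beta_kap[OF inv(1,2), of "sigma_inv i y"] by simp
  from A.conj_rel_inv[OF this] have k:
    "inv\<^sub>A beta n (Suc i) \<cdot> kap n y = kap n (sigma_inv i y) \<cdot> inv\<^sub>A beta n (Suc i)" for y
    using c by simp
  have "section_B n (inv\<^bsub>B\<^esub> alpha n i \<otimes>\<^bsub>B\<^esub> b) \<cdot> kap n x
      = inv\<^sub>A beta n (Suc i) \<cdot> (section_B n b \<cdot> kap n x)"
    using inv c by (simp add: section_B_alpha A.m_assoc)
  also have "\<dots> = inv\<^sub>A beta n (Suc i) \<cdot> kap n (rho n b x) \<cdot> section_B n b"
    using inv c by (simp add: A.m_assoc)
  also have "\<dots> = kap n (sigma_inv i (rho n b x)) \<cdot> (inv\<^sub>A beta n (Suc i) \<cdot> section_B n b)"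
    using c by (simp add: k A.m_assoc)
  finally show ?case using inv c by (simp add: section_B_alpha rho_mult rho_alpha_inv)
qed simp

text \<open>Products of a free part and a lifted braid are stable under left multiplication by the
  generators, because \<open>beta_kap\<close> moves a braid generator past the free part.\<close>

lemma decomposition: "a \<in> carrier A \<Longrightarrow> a = kap n (ev n a) \<cdot> section_B n (pi_B n a)"
proof (induction rule: artin_induct)
  case (gen i a)
  let ?k = "kap n (ev n a)" and ?s = "section_B n (pi_B n a)"
  have c: "beta n i \<in> carrier A" "?s \<in> carrier A" using gen by auto
  have a: "beta n i \<cdot> a = beta n i \<cdot> ?k \<cdot> ?s"
    using arg_cong[OF gen(4), of "\<lambda>x. beta n i \<cdot> x"] c by (simp add: A.m_assoc)
  show ?case
  proof (cases "i = 1")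
    case True
    have e: "ev n (beta n i \<cdot> a) = gen 1 + ev n a" "pi_B n (beta n i \<cdot> a) = pi_B n a"
      using gen(1-3) c by (simp_all add: True ev_mult ev_beta pi_B_beta[OF n2])
    show ?thesis unfolding e unfolding a by (simp add: True ugen_1)
  next
    case False
    then obtain j where j: "i = Suc j" "1 \<le> j" "j < n" using gen by (cases i) auto
    have e: "ev n (beta n i \<cdot> a) = sigma j (ev n a)"
      "pi_B n (beta n i \<cdot> a) = alpha n j \<otimes>\<^bsub>B\<^esub> pi_B n a"
      using gen(1-3) c j by (simp_all add: ev_mult ev_beta pi_B_beta[OF n2] rho_alpha)
    have "section_B n (alpha n j \<otimes>\<^bsub>B\<^esub> pi_B n a) = beta n i \<cdot> ?s"
      using gen(3) j by (simp add: section_B_alpha)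
    moreover have "beta n i \<cdot> ?k = kap n (sigma j (ev n a)) \<cdot> beta n i"
      using beta_kap[OF j(2,3)] j by simp
    ultimately show ?thesis unfolding e unfolding a using c by (simp add: A.m_assoc)
  qed
next
  case (inv i a)
  let ?k = "kap n (ev n a)" and ?s = "section_B n (pi_B n a)"
  have c: "beta n i \<in> carrier A" "?s \<in> carrier A" using inv by auto
  have a: "inv\<^sub>A beta n i \<cdot> a = inv\<^sub>A beta n i \<cdot> ?k \<cdot> ?s"
    using arg_cong[OF inv(4), of "\<lambda>x. inv\<^sub>A beta n i \<cdot> x"] c by (simp add: A.m_assoc)
  show ?case
  proof (cases "i = 1")
    case True
    have e: "ev n (inv\<^sub>A beta n i \<cdot> a) = - gen 1 + ev n a"
      "pi_B n (inv\<^sub>A beta n i \<cdot> a) = pi_B n a"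
      using inv(1-3) c by (simp_all add: True ev_mult ev_beta_inv pi_B_beta[OF n2])
    show ?thesis unfolding e unfolding a by (simp add: True ugen_1 del: add_uminus_conv_diff)
  next
    case False
    then obtain j where j: "i = Suc j" "1 \<le> j" "j < n" using inv by (cases i) auto
    have e: "ev n (inv\<^sub>A beta n i \<cdot> a) = sigma_inv j (ev n a)"
      "pi_B n (inv\<^sub>A beta n i \<cdot> a) = inv\<^bsub>B\<^esub> alpha n j \<otimes>\<^bsub>B\<^esub> pi_B n a"
      using inv(1-3) c j by (simp_all add: ev_mult ev_beta_inv pi_B_beta[OF n2] rho_alpha_inv)
    have "section_B n (inv\<^bsub>B\<^esub> alpha n j \<otimes>\<^bsub>B\<^esub> pi_B n a) = inv\<^sub>A beta n i \<cdot> ?s"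
      using inv(3) j by (simp add: section_B_alpha)
    moreover have "inv\<^sub>A beta n i \<cdot> ?k = kap n (sigma_inv j (ev n a)) \<cdot> inv\<^sub>A beta n i"
      using A.conj_rel_inv[of ?k "beta n i" "kap n (sigma_inv j (ev n a))"]
        beta_kap[OF j(2,3), of "sigma_inv j (ev n a)"] c by (simp add: j)
    ultimately show ?thesis unfolding e unfolding a using c by (simp add: A.m_assoc)
  qed
qed simp

lemma pi_ugen [simp]: "pi_B n (ugen n i) = \<one>\<^bsub>B\<^esub>"
proof (induction i)
  case (Suc i)
  consider "i = 0" | "1 \<le> i" "Suc i \<le> n" | "n < Suc i" by linarith
  then show ?case
  proof cases
    case 2
    then show ?thesis using Suc by (simp add: ugen_Suc)
  qed (use n2 in \<open>simp_all add: ugen_1 ugen_large pi_B_beta\<close>)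
qed (simp add: ugen_0)

lemma pi_kap [simp]: "pi_B n (kap n x) = \<one>\<^bsub>B\<^esub>"
  by (induction x rule: fg_induct) (simp_all del: add_uminus_conv_diff)

lemma ev_inv_kernel: "a \<in> carrier A \<Longrightarrow> pi_B n a = \<one>\<^bsub>B\<^esub> \<Longrightarrow> ev n (inv\<^sub>A a) = - ev n a"
  using ev_mult[of "inv\<^sub>A a" a] by (simp add: eq_neg_iff_add_eq_0)

lemma ev_ugen: "1 \<le> i \<Longrightarrow> i \<le> n \<Longrightarrow> ev n (ugen n i) = gen i"
proof (induction i rule: dec_induct)
  case base
  then show ?case using n2 by (simp add: ugen_1 ev_beta)
next
  case (step i)
  then have "beta n (Suc i) \<in> carrier A" by simp
  then show ?case using step
    by (simp add: ugen_Suc A.m_assoc ev_mult ev_beta ev_beta_inv pi_B_beta[OF n2] rho_alpha sigma_gen)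
qed

lemma ev_kap: "x \<in> supp_in {1..n} \<Longrightarrow> ev n (kap n x) = x"
  by (induction rule: supp_in_induct)
    (simp_all add: ev_mult ev_ugen ev_inv_kernel del: add_uminus_conv_diff)

lemma F_B_iff: "a \<in> F_B n \<longleftrightarrow> a \<in> carrier A \<and> pi_B n a = \<one>\<^bsub>B\<^esub>"
  by (simp add: F_B_def kernel_def)

lemma F_B_eq_kap: "a \<in> F_B n \<Longrightarrow> a = kap n (ev n a)"
  using decomposition[of a] by (simp add: F_B_iff)

lemma kap_in_F_B [simp]: "kap n x \<in> F_B n"
  by (simp add: F_B_iff)

text \<open>Conjugation by \<open>a\<close> acts on the free group through its braid component,
  followed by the inner automorphism of its free component. On conjugacy classes only the braid
  component is visible.\<close>

lemma conj_kap:
  assumes a: "a \<in> carrier A"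
  shows "a \<cdot> kap n x = kap n (ev n a + rho n (pi_B n a) x - ev n a) \<cdot> a"
proof -
  let ?k = "kap n (ev n a)" and ?s = "section_B n (pi_B n a)"
  have c: "?s \<in> carrier A" using a by simp
  have "?k \<cdot> ?s \<cdot> kap n x = ?k \<cdot> (?s \<cdot> kap n x)" using c by (simp add: A.m_assoc)
  also have "\<dots> = kap n (ev n a + rho n (pi_B n a) x - ev n a) \<cdot> (?k \<cdot> ?s)"
    using c section_kap[OF pi_B_closed[OF a], of x] by (simp add: A.m_assoc) (simp add: A.m_assoc[symmetric])
  finally show ?thesis using decomposition[OF a] by simp
qed

end

section \<open>Faithfulness of the Artin action\<close>

text \<open>The braids fixing the first string form the image of \<open>artin_B n\<close> under \<open>theta\<close>; forgetting that
  string recovers \<open>pi_B\<close>, and the trace it leaves on the first generator recovers \<open>ev\<close>.\<close>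

definition theta :: "nat \<Rightarrow> nat word set \<Rightarrow> nat word set" where
  "theta n = pres_hom {1..n} (artin_B_rels n) (braid_group (Suc n))
     (\<lambda>i. if i = 1 then alpha (Suc n) 1 \<otimes>\<^bsub>braid_group (Suc n)\<^esub> alpha (Suc n) 1 else alpha (Suc n) i)"

definition forget :: "nat fg \<Rightarrow> nat fg" where
  "forget = fext (\<lambda>a. if a \<le> 1 then 0 else gen (a - 1))"

definition exch :: "nat \<Rightarrow> nat \<Rightarrow> nat" where
  "exch j k = (if k = j then Suc j else if k = Suc j then j else k)"

lemma exch_simps [simp]: "exch j j = Suc j" "exch j (Suc j) = j" "exch j (exch j k) = k"
  by (auto simp: exch_def)

lemma forget_gen [simp]: "forget (gen a) = (if a \<le> 1 then 0 else gen (a - 1))"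
  by (simp add: forget_def)

lemma additive_forget [simp]: "additive_map forget"
  by (simp add: forget_def)

lemmas forget_simps [simp] = additive_simps[OF additive_forget]

lemma forget_sigma: "1 \<le> i \<Longrightarrow> forget (sigma (Suc i) x) = sigma i (forget x)"
proof -
  assume "1 \<le> i"
  then have "forget \<circ> sigma (Suc i) = sigma i \<circ> forget"
    by (intro additive_eq additive_comp) (auto simp: sigma_gen)
  then show ?thesis by (metis comp_apply)
qed

lemma forget_sigma_square: "forget (sigma 1 (sigma 1 x)) = forget x"
proof -
  have "forget \<circ> (sigma 1 \<circ> sigma 1) = forget"
    by (intro additive_eq additive_comp) (auto simp: sigma_gen)
  then show ?thesis by (metis comp_apply)
qed

lemma forget_sigma_inv: "1 \<le> i \<Longrightarrow> forget (sigma_inv (Suc i) x) = sigma_inv i (forget x)"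
  using forget_sigma[of i "sigma_inv (Suc i) x"] by (metis sigma_inv_sigma sigma_sigma_inv)

lemma forget_sigma_inv_square: "forget (sigma_inv 1 (sigma_inv 1 x)) = forget x"
  using forget_sigma_square[of "sigma_inv 1 (sigma_inv 1 x)"] by simp

context artin_group
begin

abbreviation "C \<equiv> braid_group (Suc n)"
abbreviation "al \<equiv> alpha (Suc n)"

abbreviation mult_C (infixl \<open>\<odot>\<close> 70) where "a \<odot> b \<equiv> a \<otimes>\<^bsub>C\<^esub> b"

sublocale C: group C by simp

lemma al_braid: "1 \<le> i \<Longrightarrow> i < n \<Longrightarrow> al i \<odot> al (Suc i) \<odot> al i = al (Suc i) \<odot> al i \<odot> al (Suc i)"
  using braid_relations(1)[of i "Suc n"] by simp

lemma al_commute: "1 \<le> i \<Longrightarrow> i + 2 \<le> j \<Longrightarrow> j \<le> n \<Longrightarrow> al i \<odot> al j = al j \<odot> al i"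
  using braid_relations(2)[of i j "Suc n"] by simp

lemma theta_hom: "theta n \<in> hom A C"
  and theta_beta: "\<And>i. 1 \<le> i \<Longrightarrow> i \<le> n \<Longrightarrow>
    theta n (beta n i) = (if i = 1 then al 1 \<odot> al 1 else al i)"
proof -
  let ?f = "\<lambda>i. if i = 1 then al 1 \<odot> al 1 else al i"
  have a: "al 1 \<in> carrier C" "al 2 \<in> carrier C" using n2 by auto
  have f: "?f \<in> {1..n} \<rightarrow> carrier C" using a by auto
  have r1: "?f 1 \<odot> ?f 2 \<odot> ?f 1 \<odot> ?f 2 = ?f 2 \<odot> ?f 1 \<odot> ?f 2 \<odot> ?f 1"
  proof -
    let ?x = "al 1" and ?y = "al 2"
    have b: "?x \<odot> ?y \<odot> ?x = ?y \<odot> ?x \<odot> ?y"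
      using al_braid[of 1] n2 by (simp add: numeral_2_eq_2)
    have "?x \<odot> ?x \<odot> ?y \<odot> (?x \<odot> ?x) \<odot> ?y = ?x \<odot> (?x \<odot> ?y \<odot> ?x) \<odot> (?x \<odot> ?y)"
      using a by (simp add: C.m_assoc)
    also have "\<dots> = ?x \<odot> (?y \<odot> ?x \<odot> ?y) \<odot> (?x \<odot> ?y)" by (simp only: b)
    also have "\<dots> = (?x \<odot> ?y \<odot> ?x) \<odot> (?y \<odot> ?x \<odot> ?y)"
      using a by (simp add: C.m_assoc)
    also have "\<dots> = (?y \<odot> ?x \<odot> ?y) \<odot> (?x \<odot> ?y \<odot> ?x)" by (simp only: b)
    also have "\<dots> = ?y \<odot> ?x \<odot> (?y \<odot> ?x \<odot> ?y) \<odot> ?x" using a by (simp add: C.m_assoc)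
    also have "\<dots> = ?y \<odot> ?x \<odot> (?x \<odot> ?y \<odot> ?x) \<odot> ?x" by (simp only: b)
    also have "\<dots> = ?y \<odot> (?x \<odot> ?x) \<odot> ?y \<odot> (?x \<odot> ?x)" using a by (simp add: C.m_assoc)
    finally show ?thesis by simp
  qed
  have r2: "?f i \<odot> ?f (i + 1) \<odot> ?f i = ?f (i + 1) \<odot> ?f i \<odot> ?f (i + 1)"
    if "2 \<le> i" "i \<le> n - 1" for i
    using al_braid[of i] that by simp
  have r3: "?f i \<odot> ?f j = ?f j \<odot> ?f i" if "1 \<le> i" "i + 2 \<le> j" "j \<le> n" for i j
  proof -
    have e: "al i \<odot> al j = al j \<odot> al i" using al_commute that by simp
    have c: "al i \<in> carrier C" "al j \<in> carrier C" using that by auto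
    have e2: "al i \<odot> al i \<odot> al j = al j \<odot> (al i \<odot> al i)"
      using C.conj_rel_mult[OF e c(1) c(1) c(2) c(1)] c e by (simp add: C.m_assoc)
    show ?thesis
    proof (cases "i = 1")
      case True
      then show ?thesis using e2[unfolded True] that by simp
    next
      case False
      then show ?thesis using e that by simp
    qed
  qed
  note L = artin_B_lift[OF group_braid f n2 r1 r2 r3]
  show "theta n \<in> hom A C" unfolding theta_def by (rule L(1))
  show "theta n (beta n i) = ?f i" if "1 \<le> i" "i \<le> n" for i
    unfolding theta_def by (rule L(2)[OF _ _ _ _ _ that])
qed

sublocale th: group_hom A C "theta n"
  using theta_hom by unfold_locales

lemma rho_theta_beta: "1 \<le> i \<Longrightarrow> i \<le> n \<Longrightarrow>
    rho (Suc n) (theta n (beta n i)) = (if i = 1 then sigma 1 \<circ> sigma 1 else sigma i)"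
  using n2 by (simp add: theta_beta rho_mult rho_alpha)

lemma rho_theta_beta_inv:
  assumes "1 \<le> i" "i \<le> n"
  shows "rho (Suc n) (theta n (inv\<^sub>A beta n i)) = (if i = 1 then sigma_inv 1 \<circ> sigma_inv 1 else sigma_inv i)"
    (is "_ = ?g")
proof
  fix x
  have c: "beta n i \<in> carrier A" using assms by simp
  have "x = rho (Suc n) (theta n (beta n i)) (?g x)" by (simp add: rho_theta_beta[OF assms])
  then show "rho (Suc n) (theta n (inv\<^sub>A beta n i)) x = ?g x"
    using rho_inv_left[of "theta n (beta n i)" "Suc n" "?g x"] c by simp
qed

text \<open>Once the first generator is killed, \<open>sigma 1 \<circ> sigma 1\<close> acts
  trivially, just as \<open>pi_B n\<close> kills \<open>beta n 1\<close>; the other generators shift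
  by one.\<close>

lemma forget_rho_theta:
  "a \<in> carrier A \<Longrightarrow> forget (rho (Suc n) (theta n a) x) = rho n (pi_B n a) (forget x)"
proof (induction arbitrary: x rule: artin_induct)
  case (gen i a)
  have c: "beta n i \<in> carrier A" using gen by simp
  have "forget (rho (Suc n) (theta n (beta n i)) y) = rho n (pi_B n (beta n i)) (forget y)" for y
  proof (cases "i = 1")
    case True
    then show ?thesis using gen(1,2) forget_sigma_square
      by (simp add: rho_theta_beta pi_B_beta[OF n2])
  next
    case False
    then obtain j where "i = Suc j" "1 \<le> j" "j < n" using gen by (cases i) auto
    then show ?thesis using forget_sigma[of j] by (simp add: rho_theta_beta pi_B_beta[OF n2] rho_alpha)
  qed
  then show ?case using gen(3,4) c by (simp add: rho_mult)
next
  case (inv i a)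
  have c: "beta n i \<in> carrier A" using inv by simp
  have "forget (rho (Suc n) (theta n (inv\<^sub>A beta n i)) y) = rho n (pi_B n (inv\<^sub>A beta n i)) (forget y)" for y
  proof (cases "i = 1")
    case True
    then show ?thesis using inv(1,2) forget_sigma_inv_square c
      by (simp add: rho_theta_beta_inv pi_B_beta[OF n2] del: th.hom_inv)
  next
    case False
    then obtain j where "i = Suc j" "1 \<le> j" "j < n" using inv by (cases i) auto
    then show ?thesis using forget_sigma_inv[of j] c
      by (simp add: rho_theta_beta_inv pi_B_beta[OF n2] rho_alpha_inv del: th.hom_inv)
  qed
  then show ?case using inv(3,4) c by (simp add: rho_mult)
qed simp

text \<open>\<open>W\<close> is determined up to powers of \<open>gen 1\<close>, which
  \<open>forget\<close> kills, so the second condition does not depend on its choice.\<close>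

definition traces :: "nat word set \<Rightarrow> bool" where
  "traces a \<longleftrightarrow> (\<exists>W. rho (Suc n) (theta n a) (gen 1) = W + gen 1 - W \<and> forget W = - ev n a)"

text \<open>The conjugators of a product combine in reverse order; the minus sign in
  \<open>traces\<close> turns this into the crossed homomorphism rule for
  \<open>ev n\<close>.\<close>

lemma traces_mult:
  assumes a: "a \<in> carrier A" "traces a" and b: "b \<in> carrier A" "traces b"
  shows "traces (a \<cdot> b)"
proof -
  let ?f = "rho (Suc n) (theta n a)"
  obtain V where V: "?f (gen 1) = V + gen 1 - V" "forget V = - ev n a" using a by (auto simp: traces_def)
  obtain W where W: "rho (Suc n) (theta n b) (gen 1) = W + gen 1 - W" "forget W = - ev n b"
    using b by (auto simp: traces_def)
  have add: "additive_map ?f" using a by (intro additive_rho) simp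
  have "rho (Suc n) (theta n (a \<cdot> b)) (gen 1) = ?f (W + gen 1 - W)"
    using a b W by (simp add: rho_mult)
  also have "\<dots> = (?f W + V) + gen 1 - (?f W + V)"
    by (simp add: additive_simps[OF add] V(1) grp_norm del: add_uminus_conv_diff One_nat_def)
  finally have "rho (Suc n) (theta n (a \<cdot> b)) (gen 1) = (?f W + V) + gen 1 - (?f W + V)" .
  moreover have "forget (?f W + V) = - ev n (a \<cdot> b)"
    using a b by (simp add: forget_rho_theta V W ev_mult minus_add additive_simps[OF additive_rho]
        del: add_uminus_conv_diff)
  ultimately show ?thesis unfolding traces_def by blast
qed

lemma traces: "a \<in> carrier A \<Longrightarrow> traces a"
proof (induction rule: artin_induct)
  case one
  show ?case unfolding traces_def by (rule exI[of _ 0]) simp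
next
  case (gen i a)
  have "traces (beta n i)"
  proof (cases "i = 1")
    case True
    have "rho (Suc n) (theta n (beta n i)) (gen 1) = - gen 2 + gen 1 - (- gen 2)"
      using gen(1,2) True by (simp add: rho_theta_beta sigma_gen numeral_2_eq_2)
    moreover have "forget (- gen 2) = - ev n (beta n i)" using gen(1,2) True by (simp add: ev_beta)
    ultimately show ?thesis unfolding traces_def by blast
  next
    case False
    then show ?thesis using gen(1,2) unfolding traces_def
      by (intro exI[of _ 0]) (simp add: rho_theta_beta sigma_gen ev_beta)
  qed
  then show ?case using gen by (intro traces_mult) auto
next
  case (inv i a)
  have c: "beta n i \<in> carrier A" using inv by simp
  have "traces (inv\<^sub>A beta n i)"
  proof (cases "i = 1")
    case True
    have "rho (Suc n) (theta n (inv\<^sub>A beta n i)) (gen 1) = (gen 1 + gen 2) + gen 1 - (gen 1 + gen 2)"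
      unfolding rho_theta_beta_inv[OF inv(1,2)] using True
      by (simp add: sigma_inv_gen grp_norm numeral_2_eq_2 del: add_uminus_conv_diff)
    moreover have "forget (gen 1 + gen 2) = - ev n (inv\<^sub>A beta n i)"
      using inv(1,2) True by (simp add: ev_beta_inv)
    ultimately show ?thesis unfolding traces_def by blast
  next
    case False
    then show ?thesis using inv(1,2) unfolding traces_def
      by (intro exI[of _ 0]) (simp add: rho_theta_beta_inv sigma_inv_gen ev_beta_inv del: th.hom_inv)
  qed
  then show ?case using inv c by (intro traces_mult) auto
qed


text \<open>\<open>coset_rep k\<close> sends string \<open>k\<close> to the first position.\<close>

definition coset_rep :: "nat \<Rightarrow> nat word set" where
  "coset_rep = rec_nat \<one>\<^bsub>C\<^esub> (\<lambda>k t. if k = 0 then \<one>\<^bsub>C\<^esub> else t \<odot> al k)"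

lemma coset_rep_1: "coset_rep (Suc 0) = \<one>\<^bsub>C\<^esub>"
  and coset_rep_Suc: "1 \<le> k \<Longrightarrow> coset_rep (Suc k) = coset_rep k \<odot> al k"
  by (simp_all add: coset_rep_def)

lemma coset_rep_closed: "1 \<le> k \<Longrightarrow> k \<le> Suc n \<Longrightarrow> coset_rep k \<in> carrier C"
  by (induction k rule: dec_induct) (simp_all add: coset_rep_1 coset_rep_Suc)

lemma coset_rep_al_above: "1 \<le> k \<Longrightarrow> k < j \<Longrightarrow> j \<le> n \<Longrightarrow> coset_rep k \<odot> al j = al j \<odot> coset_rep k"
proof (induction k rule: dec_induct)
  case base
  then show ?case by (simp add: coset_rep_1)
next
  case (step k)
  have c: "al k \<in> carrier C" "al j \<in> carrier C" "coset_rep k \<in> carrier C"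
    using step by (auto intro: coset_rep_closed)
  have "coset_rep (Suc k) \<odot> al j = coset_rep k \<odot> (al k \<odot> al j)"
    using step c by (simp add: coset_rep_Suc C.m_assoc)
  also have "al k \<odot> al j = al j \<odot> al k" using al_commute[of k j] step by simp
  also have "coset_rep k \<odot> (al j \<odot> al k) = (coset_rep k \<odot> al j) \<odot> al k"
    using c by (simp add: C.m_assoc)
  also have "\<dots> = al j \<odot> coset_rep k \<odot> al k" using step by simp
  finally show ?case using step c by (simp add: coset_rep_Suc C.m_assoc)
qed

lemma coset_rep_al_below:
  assumes "1 \<le> j" "j + 2 \<le> k" "k \<le> Suc n"
  shows "coset_rep k \<odot> al j = al (Suc j) \<odot> coset_rep k"
  using assms(2,3)
proof (induction k rule: dec_induct)
  case base
  have c: "al j \<in> carrier C" "al (Suc j) \<in> carrier C" "coset_rep j \<in> carrier C"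
    using base assms(1) by (auto intro: coset_rep_closed)
  have t: "coset_rep (j + 2) = coset_rep j \<odot> al j \<odot> al (Suc j)" using assms(1) by (simp add: coset_rep_Suc)
  have "coset_rep (j + 2) \<odot> al j = coset_rep j \<odot> (al j \<odot> al (Suc j) \<odot> al j)"
    unfolding t using c by (simp add: C.m_assoc)
  also have "\<dots> = (coset_rep j \<odot> al (Suc j)) \<odot> (al j \<odot> al (Suc j))"
    using al_braid[of j] base assms(1) c by (simp add: C.m_assoc)
  also have "\<dots> = al (Suc j) \<odot> coset_rep j \<odot> (al j \<odot> al (Suc j))"
    using coset_rep_al_above[of j "Suc j"] base assms(1) by simp
  finally show ?case unfolding t using c by (simp add: C.m_assoc)
next
  case (step k)
  have c: "al j \<in> carrier C" "al (Suc j) \<in> carrier C" "al k \<in> carrier C" "coset_rep k \<in> carrier C"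
    using step assms(1) by (auto intro: coset_rep_closed)
  have t: "coset_rep (Suc k) = coset_rep k \<odot> al k" using step by (intro coset_rep_Suc) simp
  have e: "al k \<odot> al j = al j \<odot> al k" using al_commute[of j k] step assms(1) by simp
  have "coset_rep (Suc k) \<odot> al j = coset_rep k \<odot> (al k \<odot> al j)"
    unfolding t using c by (simp add: C.m_assoc)
  also have "\<dots> = (coset_rep k \<odot> al j) \<odot> al k" unfolding e using c by (simp add: C.m_assoc)
  also have "\<dots> = al (Suc j) \<odot> coset_rep k \<odot> al k" using step by simp
  finally show ?case unfolding t using c by (simp add: C.m_assoc)
qed

text \<open>For \<open>x = al j\<close> and \<open>y = al (Suc j)\<close> the braid relation gives
  \<open>x y y x^-1 = y^-1 x x y\<close>, and \<open>y\<close> commutes with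
  \<open>coset_rep j\<close>. So the element for \<open>Suc j\<close> is the one for
  \<open>j\<close> conjugated by the inverse of \<open>beta n (Suc j)\<close>.\<close>

lemma coset_rep_al_square:
  "1 \<le> j \<Longrightarrow> j \<le> n \<Longrightarrow> \<exists>a \<in> carrier A. coset_rep j \<odot> (al j \<odot> al j) = theta n a \<odot> coset_rep j"
proof (induction j rule: dec_induct)
  case base
  then show ?case using n2 by (intro bexI[of _ "beta n 1"]) (simp_all add: coset_rep_1 theta_beta)
next
  case (step j)
  then obtain a where a: "a \<in> carrier A" "coset_rep j \<odot> (al j \<odot> al j) = theta n a \<odot> coset_rep j" by auto
  let ?x = "al j" and ?y = "al (Suc j)" and ?t = "coset_rep j" and ?b = "beta n (Suc j)"
  have c: "?x \<in> carrier C" "?y \<in> carrier C" "?t \<in> carrier C" "?b \<in> carrier A" "theta n a \<in> carrier C"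
    using step a by (auto intro: coset_rep_closed)
  have thb: "theta n ?b = ?y" using step by (simp add: theta_beta)
  have t: "coset_rep (Suc j) = ?t \<odot> ?x" using step by (intro coset_rep_Suc)
  have ty: "?t \<odot> ?y = ?y \<odot> ?t" using coset_rep_al_above[of j "Suc j"] step by simp
  have xyx: "?x \<odot> ?y \<odot> ?x = ?y \<odot> ?x \<odot> ?y" using al_braid[of j] step by simp
  have "?y \<odot> ?x \<odot> ?y \<odot> ?y = (?x \<odot> ?y \<odot> ?x) \<odot> ?y" by (simp only: xyx)
  also have "\<dots> = ?x \<odot> (?y \<odot> ?x \<odot> ?y)" using c by (simp add: C.m_assoc)
  also have "\<dots> = ?x \<odot> (?x \<odot> ?y \<odot> ?x)" by (simp only: xyx)
  also have "\<dots> = ?x \<odot> ?x \<odot> ?y \<odot> ?x" using c by (simp add: C.m_assoc)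
  finally have br: "?y \<odot> ?x \<odot> ?y \<odot> ?y = ?x \<odot> ?x \<odot> ?y \<odot> ?x" .
  have "?y \<odot> (coset_rep (Suc j) \<odot> (?y \<odot> ?y)) = (?y \<odot> ?t) \<odot> (?x \<odot> ?y \<odot> ?y)"
    unfolding t using c by (simp add: C.m_assoc)
  also have "\<dots> = ?t \<odot> (?y \<odot> ?x \<odot> ?y \<odot> ?y)" unfolding ty[symmetric] using c by (simp add: C.m_assoc)
  also have "\<dots> = (?t \<odot> (?x \<odot> ?x)) \<odot> (?y \<odot> ?x)" unfolding br using c by (simp add: C.m_assoc)
  also have "\<dots> = theta n a \<odot> (?t \<odot> ?y) \<odot> ?x" unfolding a(2) using c by (simp add: C.m_assoc)
  also have "\<dots> = theta n a \<odot> ?y \<odot> coset_rep (Suc j)" unfolding ty t using c by (simp add: C.m_assoc)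
  finally have e: "?y \<odot> (coset_rep (Suc j) \<odot> (?y \<odot> ?y)) = theta n a \<odot> ?y \<odot> coset_rep (Suc j)" .
  have ct: "coset_rep (Suc j) \<in> carrier C" unfolding t using c by simp
  have "coset_rep (Suc j) \<odot> (?y \<odot> ?y) = inv\<^bsub>C\<^esub> ?y \<odot> (theta n a \<odot> ?y \<odot> coset_rep (Suc j))"
    by (subst C.inv_solve_left) (use c ct e in simp_all)
  also have "\<dots> = theta n (inv\<^sub>A ?b \<cdot> a \<cdot> ?b) \<odot> coset_rep (Suc j)"
    using c ct a(1) by (simp add: thb C.m_assoc)
  finally show ?case using c a(1) by blast
qed

text \<open>Right multiplication by \<open>al j\<close> permutes the cosets of the image of
  \<open>theta n\<close> like the transposition \<open>exch j\<close>. The case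
  \<open>k = Suc j\<close> produces the square of \<open>al j\<close>, hence
  \<open>coset_rep_al_square\<close>.\<close>

lemma coset_rep_al:
  assumes k: "1 \<le> k" "k \<le> Suc n" and j: "1 \<le> j" "j \<le> n"
  shows "\<exists>a \<in> carrier A. coset_rep k \<odot> al j = theta n a \<odot> coset_rep (exch j k)"
proof -
  consider "k < j" | "k = j" | "k = Suc j" | "j + 2 \<le> k" by linarith
  then show ?thesis
  proof cases
    case 1
    then show ?thesis using coset_rep_al_above[of k j] k j
      by (intro bexI[of _ "beta n j"]) (simp_all add: theta_beta exch_def)
  next
    case 2
    have "coset_rep (Suc j) \<in> carrier C" using j by (intro coset_rep_closed) auto
    then show ?thesis using j 2
      by (intro bexI[of _ "\<one>\<^bsub>A\<^esub>"]) (simp_all add: coset_rep_Suc)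
  next
    case 3
    obtain a where a: "a \<in> carrier A" "coset_rep j \<odot> (al j \<odot> al j) = theta n a \<odot> coset_rep j"
      using coset_rep_al_square[OF j] by blast
    have "coset_rep j \<in> carrier C" using j by (intro coset_rep_closed) auto
    then have "coset_rep k \<odot> al j = theta n a \<odot> coset_rep j"
      using a(2) j by (simp add: 3 coset_rep_Suc C.m_assoc)
    then show ?thesis using a(1) by (intro bexI[of _ a]) (simp_all add: 3)
  next
    case 4
    then show ?thesis using coset_rep_al_below[of j k] k j
      by (intro bexI[of _ "beta n (Suc j)"]) (simp_all add: theta_beta exch_def)
  qed
qed

lemma coset_rep_al_inv:
  assumes k: "1 \<le> k" "k \<le> Suc n" and j: "1 \<le> j" "j \<le> n"
  shows "\<exists>a \<in> carrier A. coset_rep k \<odot> inv\<^bsub>C\<^esub> al j = theta n a \<odot> coset_rep (exch j k)"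
proof -
  let ?k = "exch j k"
  have k': "1 \<le> ?k" "?k \<le> Suc n" using k j by (auto simp: exch_def)
  have c: "coset_rep k \<in> carrier C" "coset_rep ?k \<in> carrier C" "al j \<in> carrier C"
    using coset_rep_closed k k' j by auto
  obtain a where a: "a \<in> carrier A" "coset_rep ?k \<odot> al j = theta n a \<odot> coset_rep k"
    using coset_rep_al[OF k' j] by auto
  have ca: "theta n a \<in> carrier C" using a(1) by simp
  have "theta n a \<odot> (coset_rep k \<odot> inv\<^bsub>C\<^esub> al j) = coset_rep ?k"
    using c ca by (simp add: C.m_assoc[symmetric] a(2)[symmetric]) (simp add: C.m_assoc c)
  then have "coset_rep k \<odot> inv\<^bsub>C\<^esub> al j = inv\<^bsub>C\<^esub> theta n a \<odot> coset_rep ?k"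
    by (subst C.inv_solve_left) (use c ca in simp_all)
  then show ?thesis using a(1) by (intro bexI[of _ "inv\<^sub>A a"]) simp_all
qed

lemma coset_decomposition:
  assumes "b \<in> carrier C"
  shows "\<exists>a \<in> carrier A. \<exists>k. 1 \<le> k \<and> k \<le> Suc n \<and> b = theta n a \<odot> coset_rep k"
proof -
  have step: "\<exists>a \<in> carrier A. \<exists>k. 1 \<le> k \<and> k \<le> Suc n \<and> theta n a' \<odot> coset_rep k' \<odot> g = theta n a \<odot> coset_rep k"
    if a': "a' \<in> carrier A" "1 \<le> k'" "k' \<le> Suc n" and j: "1 \<le> j" "j \<le> n" and g: "g \<in> {al j, inv\<^bsub>C\<^esub> al j}"
    for a' k' j g
  proof -
    let ?k = "exch j k'"
    have k: "1 \<le> ?k" "?k \<le> Suc n" using a' j by (auto simp: exch_def)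
    have c: "coset_rep k' \<in> carrier C" "coset_rep ?k \<in> carrier C" "g \<in> carrier C"
      using coset_rep_closed k a' j g by auto
    obtain a where a: "a \<in> carrier A" "coset_rep k' \<odot> g = theta n a \<odot> coset_rep ?k"
      using coset_rep_al[OF a'(2,3) j] coset_rep_al_inv[OF a'(2,3) j] g by blast
    have "theta n a' \<odot> coset_rep k' \<odot> g = theta n (a' \<cdot> a) \<odot> coset_rep ?k"
      using a a' c by (simp add: C.m_assoc)
    then show ?thesis using a(1) a'(1) k by (intro bexI[of _ "a' \<cdot> a"] exI[of _ ?k]) simp_all
  qed
  \<comment> \<open>The induction adds generators on the left, whereas the cosets are moved from the
    right; hence the statement concerns the inverse of \<open>b\<close>.\<close>
  have "\<exists>a \<in> carrier A. \<exists>k. 1 \<le> k \<and> k \<le> Suc n \<and> inv\<^bsub>C\<^esub> b = theta n a \<odot> coset_rep k" if "b \<in> carrier C" for b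
    using that
  proof (induction rule: braid_induct)
    case one
    show ?case by (intro bexI[of _ "\<one>\<^bsub>A\<^esub>"] exI[of _ "Suc 0"]) (simp_all add: coset_rep_1)
  next
    case (gen i b)
    then obtain a k where a: "a \<in> carrier A" "1 \<le> k" "k \<le> Suc n" "inv\<^bsub>C\<^esub> b = theta n a \<odot> coset_rep k" by blast
    have "inv\<^bsub>C\<^esub> (al i \<odot> b) = theta n a \<odot> coset_rep k \<odot> inv\<^bsub>C\<^esub> al i"
      using gen a(4) by (simp add: C.inv_mult_group)
    then show ?case using step[OF a(1-3), of i "inv\<^bsub>C\<^esub> al i"] gen(1,2) by simp
  next
    case (inv i b)
    then obtain a k where a: "a \<in> carrier A" "1 \<le> k" "k \<le> Suc n" "inv\<^bsub>C\<^esub> b = theta n a \<odot> coset_rep k" by blast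
    have "inv\<^bsub>C\<^esub> (inv\<^bsub>C\<^esub> al i \<odot> b) = theta n a \<odot> coset_rep k \<odot> al i"
      using inv a(4) by (simp add: C.inv_mult_group)
    then show ?case using step[OF a(1-3), of i "al i"] inv(1,2) by simp
  qed
  from this[of "inv\<^bsub>C\<^esub> b"] show ?thesis using assms by simp
qed

lemma rho_coset_rep: "1 \<le> k \<Longrightarrow> k \<le> Suc n \<Longrightarrow> conjg (rho (Suc n) (coset_rep k) (gen k)) (gen 1)"
proof (induction k rule: dec_induct)
  case base
  then show ?case by (simp add: coset_rep_1)
next
  case (step k)
  have c: "coset_rep k \<in> carrier C" "al k \<in> carrier C" using step coset_rep_closed[of k] by simp_all
  have "conjg (- gen (Suc k) + gen k - - gen (Suc k)) (gen k)" by (rule conjgI)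
  then have "conjg (sigma k (gen (Suc k))) (gen k)" by (simp add: sigma_gen)
  then have "conjg (rho (Suc n) (coset_rep k) (sigma k (gen (Suc k)))) (rho (Suc n) (coset_rep k) (gen k))"
    by (rule conjg_additive[OF additive_rho[OF c(1)]])
  moreover have ih: "conjg (rho (Suc n) (coset_rep k) (gen k)) (gen 1)" using step by simp
  ultimately have "conjg (rho (Suc n) (coset_rep k) (sigma k (gen (Suc k)))) (gen 1)"
    by (rule conjg_trans)
  then show ?case using step(1,4) c by (simp add: coset_rep_Suc rho_mult rho_alpha)
qed

text \<open>A trivial action sends no generator to the class of another, so \<open>k = 1\<close> and
  \<open>b\<close> is the image of \<open>a\<close>. Forgetting the first string and faithfulness
  for \<open>n\<close> make the braid component of \<open>a\<close> trivial. The conjugator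
  \<open>W\<close> commutes with \<open>gen 1\<close>, so it is a power of it, and the free
  component vanishes as well.\<close>

lemma faithful_step:
  assumes faithful: "\<And>b. b \<in> carrier B \<Longrightarrow> rho n b = id \<Longrightarrow> b = \<one>\<^bsub>B\<^esub>"
    and b: "b \<in> carrier C" "rho (Suc n) b = id"
  shows "b = \<one>\<^bsub>C\<^esub>"
proof -
  obtain a k where a: "a \<in> carrier A" "1 \<le> k" "k \<le> Suc n" "b = theta n a \<odot> coset_rep k"
    using coset_decomposition[OF b(1)] by blast
  have c: "theta n a \<in> carrier C" "coset_rep k \<in> carrier C" using a coset_rep_closed by auto
  obtain W where W: "rho (Suc n) (theta n a) (gen 1) = W + gen 1 - W" "forget W = - ev n a"
    using traces[OF a(1)] by (auto simp: traces_def)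
  have "rho (Suc n) b = rho (Suc n) (theta n a) \<circ> rho (Suc n) (coset_rep k)"
    unfolding a(4) using c by (rule rho_mult)
  then have "rho (Suc n) (theta n a) (rho (Suc n) (coset_rep k) (gen k)) = gen k"
    using b(2) by (metis comp_apply id_apply)
  moreover have "conjg (rho (Suc n) (theta n a) (rho (Suc n) (coset_rep k) (gen k))) (rho (Suc n) (theta n a) (gen 1))"
    by (rule conjg_additive[OF additive_rho[OF c(1)] rho_coset_rep[OF a(2,3)]])
  ultimately have "conjg (gen k) (rho (Suc n) (theta n a) (gen 1))" by simp
  moreover have "conjg (rho (Suc n) (theta n a) (gen 1)) (gen 1)" unfolding W by (rule conjgI)
  ultimately have "conjg (gen k) (gen 1)" by (rule conjg_trans)
  from conjg_expo[OF this, of k] have k: "k = 1" by (simp split: if_splits)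
  then have ba: "b = theta n a" using a(4) c by (simp add: coset_rep_1)
  have fix1: "rho n (pi_B n a) (forget x) = forget x" for x
    using forget_rho_theta[OF a(1), of x] b(2) ba by simp
  have "rho n (pi_B n a) = id"
  proof (rule additive_eq)
    fix c :: nat
    show "rho n (pi_B n a) (gen c) = id (gen c)"
    proof (cases "c = 0")
      case True
      then show ?thesis using rho_gen_outside[of "pi_B n a" n c] a(1) by simp
    next
      case False
      then show ?thesis using fix1[of "gen (Suc c)"] by simp
    qed
  qed (use a in \<open>auto intro: additive_rho\<close>)
  then have pi: "pi_B n a = \<one>\<^bsub>B\<^esub>" using faithful a(1) by simp
  have "W + gen 1 - W = gen 1" using W(1) b(2) ba by simp
  then have "W + gen 1 = gen 1 + W" by (metis diff_add_cancel)
  from centralizer_gen[OF this] obtain j where "W = npow j (gen 1) \<or> W = - npow j (gen 1)" by blast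
  then have "forget W = 0" using additive_npow[OF additive_forget, of j "gen 1"] by auto
  then have ev: "ev n a = 0" using W(2) by simp
  have "a = kap n (ev n a) \<cdot> section_B n (pi_B n a)" by (rule decomposition[OF a(1)])
  also have "\<dots> = \<one>\<^bsub>A\<^esub>" unfolding ev pi by simp
  finally have "a = \<one>\<^bsub>A\<^esub>" .
  then show ?thesis using ba by simp
qed

end

text \<open>The group is cyclic. If a power of the generator acts trivially, so does its square, a
  twist; then \<open>npow m (gen 1 + gen 2)\<close> commutes with \<open>gen 1\<close>, is a power
  of it up to sign, and its exponent at generator \<open>2\<close> gives
  \<open>m = 0\<close>.\<close>

lemma faithful_base:
  assumes b: "b \<in> carrier (braid_group 2)" "rho 2 b = id"
  shows "b = \<one>\<^bsub>braid_group 2\<^esub>"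
proof -
  let ?B = "braid_group 2" and ?x = "alpha 2 1"
  interpret B: group ?B by simp
  have x: "?x \<in> carrier ?B" by simp
  have "\<exists>k :: int. b = ?x [^]\<^bsub>?B\<^esub> k" using b(1)
  proof (induction rule: braid_induct)
    case one
    show ?case by (rule exI[of _ 0]) simp
  next
    case (gen i b)
    then obtain k :: int where "b = ?x [^]\<^bsub>?B\<^esub> k" by blast
    moreover have "i = 1" using gen by simp
    ultimately show ?case using B.int_pow_mult[OF x, of 1 k] x by (intro exI[of _ "1 + k"]) simp
  next
    case (inv i b)
    then obtain k :: int where "b = ?x [^]\<^bsub>?B\<^esub> k" by blast
    moreover have "i = 1" using inv by simp
    ultimately show ?case using B.int_pow_mult[OF x, of "-1" k] x
      by (intro exI[of _ "-1 + k"]) (simp add: B.int_pow_neg)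
  qed
  then obtain k :: int where k: "b = ?x [^]\<^bsub>?B\<^esub> k" by blast
  have pos: "m = 0" if "rho 2 (?x [^]\<^bsub>?B\<^esub> (m :: nat)) = id" for m
  proof -
    have "rho 2 (?x [^]\<^bsub>?B\<^esub> (m :: nat)) = sigma 1 ^^ m" for m
    proof (induction m)
      case (Suc m)
      then show ?case using x rho_alpha[of 1 2] by (simp add: rho_mult funpow_Suc_right del: funpow.simps)
    qed (use rho_one[of 2] in simp)
    with that have m: "sigma 1 ^^ m = id" by simp
    have "((\<lambda>x. sigma 1 (sigma 1 x)) ^^ m) = (sigma 1 ^^ m) \<circ> (sigma 1 ^^ m)"
    proof -
      have "(\<lambda>x. sigma 1 (sigma 1 x)) ^^ m = sigma 1 ^^ (2 * m)"
        by (induction m) (simp_all add: fun_eq_iff)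
      then show ?thesis by (simp only: mult_2 funpow_add)
    qed
    then have "pconj {1, Suc 1} (- npow m (gen 1 + gen (Suc 1))) (gen 1) = gen 1"
      using sigma_twist[where i = 1 and m = m and x = "gen 1"] m by simp
    then have "- npow m (gen 1 + gen 2) + gen 1 - - npow m (gen 1 + gen 2) = (gen 1 :: nat fg)"
      by (simp add: pconj_gen numeral_2_eq_2)
    then have "- npow m (gen 1 + gen 2) + gen 1 = gen 1 + - npow m (gen (1 :: nat) + gen 2)"
      by (metis diff_add_cancel)
    from centralizer_gen[OF this] obtain j where "- npow m (gen (1 :: nat) + gen 2) = npow j (gen 1) \<or>
        - npow m (gen (1 :: nat) + gen 2) = - npow j (gen 1)" by blast
    then have "expo 2 (- npow m (gen (1 :: nat) + gen 2)) = 0" by (auto simp del: expo_simps(3)) simp_all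
    then show "m = 0" by simp
  qed
  have "k = 0"
  proof (cases "k \<ge> 0")
    case True
    then have "b = ?x [^]\<^bsub>?B\<^esub> nat k" unfolding k int_pow_def2 by simp
    then have "rho 2 (?x [^]\<^bsub>?B\<^esub> nat k) = id" using b(2) by (simp only:)
    then show ?thesis using pos[of "nat k"] True by linarith
  next
    case False
    then have "b = inv\<^bsub>?B\<^esub> (?x [^]\<^bsub>?B\<^esub> nat (- k))"
      unfolding k int_pow_def2 by simp
    then have i: "inv\<^bsub>?B\<^esub> b = ?x [^]\<^bsub>?B\<^esub> nat (- k)"
      using B.inv_inv[OF B.nat_pow_closed[OF x, of "nat (- k)"]] by (simp only:)
    moreover have "rho 2 (inv\<^bsub>?B\<^esub> b) = id"
    proof
      fix y show "rho 2 (inv\<^bsub>?B\<^esub> b) y = id y" using rho_inv_left[OF b(1), of y] b(2) by simp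
    qed
    ultimately have "rho 2 (?x [^]\<^bsub>?B\<^esub> nat (- k)) = id" by (simp only:)
    then show ?thesis using pos[of "nat (- k)"] False by linarith
  qed
  then show ?thesis using k by simp
qed

theorem rho_faithful:
  assumes "n \<ge> 2" "b \<in> carrier (braid_group n)" "rho n b = id"
  shows "b = \<one>\<^bsub>braid_group n\<^esub>"
  using assms
proof (induction n arbitrary: b rule: dec_induct)
  case base
  show ?case by (rule faithful_base[OF base])
next
  case (step n)
  interpret artin_group n using step by unfold_locales simp
  show ?case by (rule faithful_step[OF step.IH step.prems])
qed

section \<open>Degrees\<close>

text \<open>The relations leave the value at \<open>beta n 1\<close> free. With \<open>c = 0\<close>
  only the braid component counts; with \<open>c = 1\<close> the degree separates
  \<open>epsilon n\<close> from the inner automorphisms.\<close>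

definition deg :: "nat \<Rightarrow> int \<Rightarrow> nat word set \<Rightarrow> int" where
  "deg n c = pres_hom {1..n} (artin_B_rels n) integer_group (\<lambda>i. if i = 1 then c else 1)"

context artin_group
begin

lemma deg_hom: "deg n c \<in> hom A integer_group"
  and deg_beta: "\<And>i. 1 \<le> i \<Longrightarrow> i \<le> n \<Longrightarrow> deg n c (beta n i) = (if i = 1 then c else 1)"
proof -
  let ?f = "\<lambda>i :: nat. if i = 1 then c else 1"
  have f: "?f \<in> {1..n} \<rightarrow> carrier integer_group" by simp
  have r1: "?f 1 \<otimes>\<^bsub>integer_group\<^esub> ?f 2 \<otimes>\<^bsub>integer_group\<^esub> ?f 1 \<otimes>\<^bsub>integer_group\<^esub> ?f 2 =
      ?f 2 \<otimes>\<^bsub>integer_group\<^esub> ?f 1 \<otimes>\<^bsub>integer_group\<^esub> ?f 2 \<otimes>\<^bsub>integer_group\<^esub> ?f 1"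
    by simp
  have r2: "?f i \<otimes>\<^bsub>integer_group\<^esub> ?f (i + 1) \<otimes>\<^bsub>integer_group\<^esub> ?f i =
      ?f (i + 1) \<otimes>\<^bsub>integer_group\<^esub> ?f i \<otimes>\<^bsub>integer_group\<^esub> ?f (i + 1)" if "2 \<le> i" "i \<le> n - 1" for i
    using that by simp
  have r3: "?f i \<otimes>\<^bsub>integer_group\<^esub> ?f j = ?f j \<otimes>\<^bsub>integer_group\<^esub> ?f i"
    if "1 \<le> i" "i + 2 \<le> j" "j \<le> n" for i j
    by simp
  note L = artin_B_lift[OF group_integer_group f n2 r1 r2 r3]
  show "deg n c \<in> hom A integer_group" unfolding deg_def by (rule L(1))
  show "deg n c (beta n i) = ?f i" if "1 \<le> i" "i \<le> n" for i
    unfolding deg_def by (rule L(2)[OF _ _ _ _ _ that])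
qed

lemma deg_mult: "a \<in> carrier A \<Longrightarrow> b \<in> carrier A \<Longrightarrow> deg n c (a \<cdot> b) = deg n c a + deg n c b"
  using hom_mult[OF deg_hom] by simp

lemma deg_one: "deg n c \<one>\<^bsub>A\<^esub> = 0"
  using deg_mult[of "\<one>\<^bsub>A\<^esub>" "\<one>\<^bsub>A\<^esub>" c] by simp

lemma deg_inv: "a \<in> carrier A \<Longrightarrow> deg n c (inv\<^sub>A a) = - deg n c a"
  using deg_mult[of "inv\<^sub>A a" a c] by (simp add: deg_one)

lemma deg_pow: "a \<in> carrier A \<Longrightarrow> deg n c (a [^]\<^bsub>A\<^esub> (k :: nat)) = int k * deg n c a"
  by (induction k) (simp_all add: deg_one deg_mult algebra_simps)

lemma deg_ugen: "1 \<le> i \<Longrightarrow> i \<le> n \<Longrightarrow> deg n c (ugen n i) = c"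
proof (induction i rule: dec_induct)
  case base
  then show ?case by (simp add: ugen_1 deg_beta)
next
  case (step i)
  then show ?case by (simp add: ugen_Suc deg_mult deg_inv)
qed


section \<open>The centralizer of the free subgroup\<close>

definition tau :: "nat \<Rightarrow> nat word set" where
  "tau = rec_nat \<one>\<^bsub>B\<^esub> (\<lambda>k t. alpha n (Suc k) \<otimes>\<^bsub>B\<^esub> t)"

lemma tau_0 [simp]: "tau 0 = \<one>\<^bsub>B\<^esub>"
  and tau_Suc: "tau (Suc k) = alpha n (Suc k) \<otimes>\<^bsub>B\<^esub> tau k"
  by (simp_all add: tau_def)

lemma tau_closed: "k < n \<Longrightarrow> tau k \<in> carrier B"
  by (induction k) (simp_all add: tau_Suc)

lemma rho_tau_Suc: "Suc k < n \<Longrightarrow> rho n (tau (Suc k)) x = sigma (Suc k) (rho n (tau k) x)"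
  using tau_closed[of k] by (simp add: tau_Suc rho_mult rho_alpha)

lemma rho_tau:
  "k < n \<Longrightarrow> rho n (tau k) (gen i) =
    (if i = 1 then gen (Suc k) else if 2 \<le> i \<and> i \<le> Suc k
     then - gen (Suc k) + gen (i - 1) + gen (Suc k) else gen i)"
proof (induction k)
  case (Suc k)
  have e: "rho n (tau (Suc k)) (gen i) = sigma (Suc k) (rho n (tau k) (gen i))"
    using Suc.prems by (rule rho_tau_Suc)
  have IH: "rho n (tau k) (gen i) = (if i = 1 then gen (Suc k) else if 2 \<le> i \<and> i \<le> Suc k
     then - gen (Suc k) + gen (i - 1) + gen (Suc k) else gen i)"
    using Suc by simp
  consider "i = 1" | "2 \<le> i" "i \<le> Suc k" | "i = Suc (Suc k)" | "i = 0 \<or> i > Suc (Suc k)"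
    by linarith
  then show ?case unfolding e IH
    by cases (simp_all add: sigma_gen, auto simp: sigma_gen)
qed auto

definition rotb :: "nat word set" where
  "rotb = tau (n - 1)"

text \<open>The braid \<open>rotb\<close> permutes the generators cyclically only up to conjugation
  by \<open>gen n\<close>; the factor \<open>ugen n n\<close> compensates for this.\<close>

definition psi :: "nat word set" where
  "psi = ugen n n \<cdot> section_B n (rotb)"

definition rot :: "nat fg \<Rightarrow> nat fg" where
  "rot x = gen n + rho n (rotb) x - gen n"

lemma rotb_closed [simp]: "rotb \<in> carrier B"
  unfolding rotb_def using n2 by (intro tau_closed) simp

lemma psi_closed [simp]: "psi \<in> carrier A"
  by (simp add: psi_def)

lemma pi_psi: "pi_B n psi = rotb"
  using n2 by (simp add: psi_def pi_B_section_B)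

lemma ev_psi: "ev n psi = gen n"
  using n2 by (simp add: psi_def ev_mult ev_section ev_ugen)

lemma additive_rot: "additive_map rot"
  unfolding additive_map_def rot_def
  by (simp add: additive_plus[OF additive_rho] grp_norm del: add_uminus_conv_diff)

lemma rot_gen: "1 \<le> i \<Longrightarrow> i \<le> n \<Longrightarrow> rot (gen i) = (if i = 1 then gen n else gen (i - 1))"
  using n2 rho_tau[of "n - 1" i] unfolding rot_def rotb_def
  by (auto simp: grp_norm simp del: add_uminus_conv_diff)

lemma psi_kap: "psi \<cdot> kap n x = kap n (rot x) \<cdot> psi"
  using conj_kap[OF psi_closed, of x] by (simp only: ev_psi pi_psi rot_def)

lemma psi_pow_kap:
  "psi [^]\<^bsub>A\<^esub> (m :: nat) \<cdot> kap n x = kap n ((rot ^^ m) x) \<cdot> psi [^]\<^bsub>A\<^esub> m"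
proof (induction m arbitrary: x)
  case (Suc m)
  have "psi [^]\<^bsub>A\<^esub> Suc m \<cdot> kap n x = psi [^]\<^bsub>A\<^esub> m \<cdot> (psi \<cdot> kap n x)"
    by (simp add: A.m_assoc)
  also have "\<dots> = psi [^]\<^bsub>A\<^esub> m \<cdot> kap n (rot x) \<cdot> psi"
    unfolding psi_kap by (simp add: A.m_assoc)
  also have "\<dots> = kap n ((rot ^^ m) (rot x)) \<cdot> psi [^]\<^bsub>A\<^esub> m \<cdot> psi"
    unfolding Suc ..
  finally show ?case by (simp add: A.m_assoc funpow_swap1)
qed simp

lemma rot_pow_low: "m < i \<Longrightarrow> i \<le> n \<Longrightarrow> (rot ^^ m) (gen i) = gen (i - m)"
  by (induction m) (auto simp: rot_gen)

lemma rot_pow_n: "x \<in> supp_in {1..n} \<Longrightarrow> (rot ^^ n) x = x"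
proof -
  assume x: "x \<in> supp_in {1..n}"
  have add: "additive_map (rot ^^ m)" for m
    by (induction m) (simp_all only: funpow.simps additive_id additive_comp additive_rot)
  have "(rot ^^ n) (gen i) = id (gen i)" if i: "i \<in> {1..n}" for i
  proof -
    obtain j where j: "i = Suc j" "j < n" using i by (cases i) auto
    have "(rot ^^ Suc j) (gen i) = gen n"
      using rot_pow_low[of j i] j n2 by (simp add: rot_gen)
    then have "(rot ^^ (n - i)) ((rot ^^ i) (gen i)) = gen i"
      using rot_pow_low[of "n - i" n] j by simp
    moreover have "n - i + i = n" using i by simp
    ultimately show ?thesis by (metis comp_apply funpow_add id_apply)
  qed
  from additive_eq_on[OF add additive_id(1) this x] show ?thesis by simp
qed

definition zeta :: "nat word set" where
  "zeta = psi [^]\<^bsub>A\<^esub> n"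

definition central_on_F :: "nat word set \<Rightarrow> bool" where
  "central_on_F z \<longleftrightarrow> z \<in> carrier A \<and> (\<forall>x \<in> supp_in {1..n}. z \<cdot> kap n x = kap n x \<cdot> z)"

lemma central_zeta: "central_on_F zeta"
  unfolding central_on_F_def zeta_def using psi_pow_kap[of n] by (simp add: rot_pow_n)

lemma central_mult: "central_on_F y \<Longrightarrow> central_on_F z \<Longrightarrow> central_on_F (y \<cdot> z)"
  unfolding central_on_F_def by (simp add: A.m_assoc) (simp add: A.m_assoc[symmetric])

lemma central_inv: "central_on_F z \<Longrightarrow> central_on_F (inv\<^sub>A z)"
  unfolding central_on_F_def using A.conj_rel_inv_left by simp

lemma central_one: "central_on_F \<one>\<^bsub>A\<^esub>"
  by (simp add: central_on_F_def)

lemma central_pow: "central_on_F z \<Longrightarrow> central_on_F (z [^]\<^bsub>A\<^esub> (k :: nat))"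
  by (induction k) (simp_all add: central_one central_mult)

lemma central_rho:
  assumes z: "central_on_F z" and x: "x \<in> supp_in {1..n}"
  shows "ev n z + rho n (pi_B n z) x - ev n z = x"
proof -
  have c: "z \<in> carrier A" using z by (simp add: central_on_F_def)
  have "kap n (ev n z + rho n (pi_B n z) x - ev n z) \<cdot> z = kap n x \<cdot> z"
    using conj_kap[OF c, of x] z x by (simp only: central_on_F_def)
  then have "kap n (ev n z + rho n (pi_B n z) x - ev n z) = kap n x"
    using c A.right_cancel kap_closed by metis
  then have "ev n (kap n (ev n z + rho n (pi_B n z) x - ev n z)) = ev n (kap n x)" by (simp only:)
  moreover have "ev n z + rho n (pi_B n z) x - ev n z \<in> supp_in {1..n}"
    using c x by (intro supp_in_closed ev_supp_in rho_supp_in pi_B_closed)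
  ultimately show ?thesis using x by (simp only: ev_kap)
qed

text \<open>The braid component of an element centralizing \<open>F_n\<close> acts as conjugation by
  the negative of its free component. So the free component determines this action and, by
  faithfulness, the braid component.\<close>

lemma central_eqI:
  assumes y: "central_on_F y" and z: "central_on_F z" and e: "ev n y = ev n z"
  shows "y = z"
proof -
  have c: "y \<in> carrier A" "z \<in> carrier A" using y z by (simp_all add: central_on_F_def)
  let ?b = "inv\<^bsub>B\<^esub> pi_B n z \<otimes>\<^bsub>B\<^esub> pi_B n y"
  have "rho n ?b = id"
  proof (rule additive_eq)
    show "additive_map (rho n ?b)" using c by (intro additive_rho) simp
    fix a
    have "rho n (pi_B n y) (gen a) = rho n (pi_B n z) (gen a)"
    proof (cases "a \<in> {1..n}")
      case True
      then have g: "gen a \<in> supp_in {1..n}" by (intro supp_in_closed)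
      have "ev n z + rho n (pi_B n y) (gen a) - ev n z = gen a" using central_rho[OF y g] e by simp
      then have "ev n z + rho n (pi_B n y) (gen a) - ev n z = ev n z + rho n (pi_B n z) (gen a) - ev n z"
        using central_rho[OF z g] by simp
      then have "- ev n z + (ev n z + rho n (pi_B n y) (gen a) - ev n z) + ev n z
          = - ev n z + (ev n z + rho n (pi_B n z) (gen a) - ev n z) + ev n z" by (simp only:)
      then show ?thesis by (simp add: grp_norm del: add_uminus_conv_diff)
    next
      case False
      then show ?thesis using c by (simp add: rho_gen_outside del: atLeastAtMost_iff)
    qed
    then show "rho n ?b (gen a) = id (gen a)" using c by (simp add: rho_mult rho_inv_left)
  qed simp
  then have "?b = \<one>\<^bsub>B\<^esub>" using c n2 by (intro rho_faithful) auto
  then have "pi_B n y = pi_B n z" using c by (metis B.inv_equality B.inv_inv B.inv_closed pi_B_closed)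
  then show ?thesis using decomposition[OF c(1)] decomposition[OF c(2)] e by (simp only:)
qed

text \<open>By the crossed homomorphism rule, one more factor \<open>psi\<close> applies
  \<open>rot\<close>, which lowers the indices by one, and then adds \<open>gen n\<close> at the
  end.\<close>

lemma ev_psi_pow: "m \<le> n \<Longrightarrow> ev n (psi [^]\<^bsub>A\<^esub> m) = sum_list (map gen [Suc n - m..<Suc n])"
proof (induction m)
  case (Suc m)
  let ?s = "\<lambda>a b. sum_list (map gen [a..<b]) :: nat fg"
  have "ev n (psi [^]\<^bsub>A\<^esub> Suc m) = ev n (psi \<cdot> psi [^]\<^bsub>A\<^esub> m)"
    using A.nat_pow_Suc2[OF psi_closed] by simp
  also have "\<dots> = gen n + rho n (rotb) (?s (Suc n - m) (Suc n))"
    using Suc by (simp add: ev_mult ev_psi pi_psi)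
  also have "\<dots> = rot (?s (Suc n - m) (Suc n)) + gen n"
    by (simp add: rot_def)
  also have "rot (?s (Suc n - m) (Suc n)) = ?s (n - m) n"
  proof -
    have "rot (sum_list (map gen xs)) = sum_list (map (\<lambda>i. rot (gen i)) xs)" for xs
      by (induction xs) (simp_all add: additive_simps[OF additive_rot])
    then have R: "rot (?s (Suc n - m) (Suc n)) = sum_list (map (\<lambda>i. rot (gen i)) [Suc n - m..<Suc n])" .
    have M: "map (\<lambda>i. rot (gen i)) [Suc n - m..<Suc n] = map (\<lambda>i. gen (i - 1)) [Suc n - m..<Suc n]"
      using Suc.prems by (intro map_cong) (auto simp: rot_gen)
    have u: "[Suc n - m..<Suc n] = map Suc [n - m..<n]"
      using Suc.prems by (simp add: map_Suc_upt Suc_diff_le)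
    show ?thesis unfolding R M unfolding u by (simp add: comp_def)
  qed
  also have "?s (n - m) n + gen n = ?s (Suc n - Suc m) (Suc n)" using Suc.prems by simp
  finally show ?case .
qed simp

lemma ev_zeta: "ev n zeta = delta n"
  unfolding zeta_def delta_sum_list using ev_psi_pow[of n] by simp

lemma zeta_closed [simp]: "zeta \<in> carrier A"
  by (simp add: zeta_def)

lemma ev_zeta_pow: "ev n (zeta [^]\<^bsub>A\<^esub> (k :: nat)) = npow k (delta n)"
proof (induction k)
  case (Suc k)
  have "ev n (zeta [^]\<^bsub>A\<^esub> Suc k) = ev n (zeta \<cdot> zeta [^]\<^bsub>A\<^esub> k)"
    using A.nat_pow_Suc2[OF zeta_closed] by simp
  also have "\<dots> = delta n + rho n (pi_B n zeta) (npow k (delta n))"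
    using Suc by (simp add: ev_mult ev_zeta)
  also have "rho n (pi_B n zeta) (npow k (delta n)) = npow k (delta n)"
    by (simp add: additive_npow[OF additive_rho] rho_delta)
  finally show ?case by simp
qed simp

text \<open>Braids fix \<open>delta n\<close>, so \<open>ev n z\<close> commutes with
  \<open>delta n\<close> and is a power of it up to sign. The powers of \<open>zeta\<close> realise
  these free components, and \<open>central_eqI\<close> applies.\<close>

lemma central_on_F_cases:
  assumes z: "central_on_F z"
  shows "\<exists>k :: nat. z = zeta [^]\<^bsub>A\<^esub> k \<or> z = inv\<^sub>A (zeta [^]\<^bsub>A\<^esub> k)"
proof -
  have c: "z \<in> carrier A" using z by (simp add: central_on_F_def)
  have "ev n z + delta n - ev n z = delta n"
    using central_rho[OF z delta_supp_in] c by (simp add: rho_delta)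
  then have comm: "ev n z + delta n = delta n + ev n z" by (metis diff_add_cancel)
  have "n \<ge> 1" using n2 by simp
  from centralizer_delta[OF this comm]
  obtain k where "ev n z = npow k (delta n) \<or> ev n z = - npow k (delta n)" by blast
  then show ?thesis
  proof
    assume "ev n z = npow k (delta n)"
    then have "z = zeta [^]\<^bsub>A\<^esub> k"
      by (intro central_eqI z central_pow central_zeta) (simp add: ev_zeta_pow)
    then show ?thesis by blast
  next
    assume e: "ev n z = - npow k (delta n)"
    have "0 = ev n (inv\<^sub>A z \<cdot> z)" using c by simp
    also have "\<dots> = ev n (inv\<^sub>A z) + - npow k (delta n)"
    proof -
      have p: "pi_B n (inv\<^sub>A z) \<in> carrier B" using c by (intro pi_B_closed) simp
      have "rho n (pi_B n (inv\<^sub>A z)) (- npow k (delta n)) = - npow k (delta n)"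
        by (simp only: additive_uminus[OF additive_rho[OF p]] additive_npow[OF additive_rho[OF p]]
            rho_delta[OF p])
      moreover have "ev n (inv\<^sub>A z \<cdot> z) = ev n (inv\<^sub>A z) + rho n (pi_B n (inv\<^sub>A z)) (ev n z)"
        using c by (intro ev_mult) simp_all
      ultimately show ?thesis by (simp only: e)
    qed
    finally have "ev n (inv\<^sub>A z) = npow k (delta n)" by simp
    then have "inv\<^sub>A z = zeta [^]\<^bsub>A\<^esub> k"
      by (intro central_eqI central_inv z central_pow central_zeta) (simp add: ev_zeta_pow)
    then have "z = inv\<^sub>A (zeta [^]\<^bsub>A\<^esub> k)" using c A.inv_inv by metis
    then show ?thesis by blast
  qed
qed

lemma deg_zeta: "deg n 0 zeta = int n * int (n - 1)"
proof -
  have "deg n 0 (section_B n (tau k)) = int k" if "k < n" for k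
    using that
  proof (induction k)
    case (Suc k)
    have "section_B n (tau k) \<in> carrier A" using tau_closed[of k] Suc by simp
    then show ?case using Suc tau_closed[of k]
      by (simp add: tau_Suc section_B_alpha deg_mult deg_beta)
  qed (simp add: deg_one)
  then have "deg n 0 (section_B n rotb) = int (n - 1)" unfolding rotb_def using n2 by simp
  then have "deg n 0 psi = int (n - 1)" using n2
    by (simp add: psi_def deg_mult deg_ugen)
  then show ?thesis by (simp add: zeta_def deg_pow)
qed


section \<open>Automorphisms that are the identity on the free subgroup\<close>

lemma rigidity:
  assumes n3: "n \<ge> 3" and hom: "\<phi> \<in> hom A A" and surj: "\<phi> ` carrier A = carrier A"
    and fixed: "\<And>x. x \<in> supp_in {1..n} \<Longrightarrow> \<phi> (kap n x) = kap n x" and a: "a \<in> carrier A"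
  shows "\<phi> a = a"
proof -
  interpret phi: group_hom A A \<phi> using hom by unfold_locales
  define N where "N = int n * int (n - 1)"
  \<comment> \<open>This excludes \<open>d 2 = -1\<close> below; for \<open>n = 2\<close> the value
    would be 2 and that case would remain.\<close>
  have N: "N \<ge> 6"
    using mult_mono[of 3 "int n" 2 "int (n - 1)"] n3 by (simp add: N_def)
  \<comment> \<open>Conjugations by \<open>a\<close> and by \<open>\<phi> a\<close> agree on
    \<open>F_n\<close>: apply \<open>\<phi>\<close>, which is the identity there, to the relation
    \<open>conj_kap\<close>.\<close>
  have cen: "central_on_F (inv\<^sub>A a \<cdot> \<phi> a)" if a: "a \<in> carrier A" for a
    unfolding central_on_F_def
  proof (intro conjI ballI)
    fix x assume x: "x \<in> supp_in {1..n}"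
    let ?y = "ev n a + rho n (pi_B n a) x - ev n a"
    have y: "?y \<in> supp_in {1..n}" using a x by (intro supp_in_closed ev_supp_in rho_supp_in pi_B_closed)
    have e: "a \<cdot> kap n x = kap n ?y \<cdot> a" by (rule conj_kap[OF a])
    have "\<phi> (a \<cdot> kap n x) = \<phi> (kap n ?y \<cdot> a)" by (simp only: e)
    then have "\<phi> a \<cdot> \<phi> (kap n x) = \<phi> (kap n ?y) \<cdot> \<phi> a"
      by (simp only: phi.hom_mult a kap_closed)
    then have e': "\<phi> a \<cdot> kap n x = kap n ?y \<cdot> \<phi> a" by (simp only: fixed x y)
    have "inv\<^sub>A a \<cdot> \<phi> a \<cdot> kap n x = inv\<^sub>A a \<cdot> (\<phi> a \<cdot> kap n x)"
      using a by (intro A.m_assoc) simp_all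
    also have "\<dots> = (inv\<^sub>A a \<cdot> kap n ?y) \<cdot> \<phi> a"
      unfolding e' using a by (intro A.m_assoc[symmetric]) simp_all
    also have "inv\<^sub>A a \<cdot> kap n ?y = kap n x \<cdot> inv\<^sub>A a"
      by (rule A.conj_rel_inv[OF e[symmetric], symmetric]) (use a in simp_all)
    finally show "inv\<^sub>A a \<cdot> \<phi> a \<cdot> kap n x = kap n x \<cdot> (inv\<^sub>A a \<cdot> \<phi> a)"
      using a by (simp add: A.m_assoc)
  qed (use a in simp)
  have z: "\<exists>k :: int. deg n 0 (inv\<^sub>A a \<cdot> \<phi> a) = k * N \<and> (k = 0 \<longrightarrow> \<phi> a = a)"
    if a: "a \<in> carrier A" for a
  proof -
    obtain k :: nat where k: "inv\<^sub>A a \<cdot> \<phi> a = zeta [^]\<^bsub>A\<^esub> k \<or>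
        inv\<^sub>A a \<cdot> \<phi> a = inv\<^sub>A (zeta [^]\<^bsub>A\<^esub> k)"
      using central_on_F_cases[OF cen[OF a]] by blast
    have zero: "\<phi> a = a" if "k = 0"
    proof -
      have "inv\<^sub>A a \<cdot> \<phi> a = \<one>\<^bsub>A\<^esub>" using k that by (elim disjE) simp_all
      then have "a \<cdot> (inv\<^sub>A a \<cdot> \<phi> a) = a" using a by simp
      then show ?thesis using a by (simp add: A.m_assoc[symmetric])
    qed
    have dz: "deg n 0 (zeta [^]\<^bsub>A\<^esub> k) = int k * N"
      "deg n 0 (inv\<^sub>A (zeta [^]\<^bsub>A\<^esub> k)) = - int k * N"
      by (simp_all add: deg_inv deg_pow deg_zeta N_def)
    from k show ?thesis
    proof
      assume "inv\<^sub>A a \<cdot> \<phi> a = zeta [^]\<^bsub>A\<^esub> k"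
      then show ?thesis using dz(1) zero by (intro exI[of _ "int k"]) simp
    next
      assume "inv\<^sub>A a \<cdot> \<phi> a = inv\<^sub>A (zeta [^]\<^bsub>A\<^esub> k)"
      then show ?thesis using dz(2) zero by (intro exI[of _ "- int k"]) simp
    qed
  qed
  \<comment> \<open>The braid relations make \<open>d\<close> constant on \<open>2..n\<close>, and
    \<open>beta n 1\<close> is fixed and of degree 0, so \<open>\<phi>\<close> multiplies all
    degrees by \<open>d 2\<close>. Surjectivity then leaves \<open>d 2 = 1\<close> or
    \<open>d 2 = -1\<close>.\<close>
  define d where "d i = deg n 0 (\<phi> (beta n i))" for i
  have d_const: "d i = d 2" if "2 \<le> i" "i \<le> n" for i
    using that
  proof (induction i rule: dec_induct)
    case (step i)
    have c: "beta n i \<in> carrier A" "beta n (Suc i) \<in> carrier A" using step by auto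
    have "\<phi> (beta n i \<cdot> beta n (Suc i) \<cdot> beta n i)
        = \<phi> (beta n (Suc i) \<cdot> beta n i \<cdot> beta n (Suc i))"
      using artin_B_relations(2)[of i n] step by simp
    from arg_cong[OF this, of "deg n 0"] have "d i + d (Suc i) + d i = d (Suc i) + d i + d (Suc i)"
      using c by (simp add: d_def deg_mult)
    then show ?case using step by simp
  qed simp
  have phi1: "\<phi> (beta n 1) = beta n 1"
  proof -
    have "kap n (gen 1) = beta n 1" by (simp add: ugen_1)
    moreover have "gen 1 \<in> supp_in {1..n}" using n2 by (intro supp_in_closed) simp
    ultimately show ?thesis using fixed by metis
  qed
  have deg_phi: "deg n 0 (\<phi> a) = d 2 * deg n 0 a" if "a \<in> carrier A" for a
    using that
  proof (induction rule: artin_induct)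
    case one
    then show ?case by (simp add: deg_one)
  next
    case (gen i a)
    have c: "beta n i \<in> carrier A" using gen by simp
    have "deg n 0 (\<phi> (beta n i)) = d 2 * deg n 0 (beta n i)"
    proof (cases "i = 1")
      case True
      then show ?thesis using phi1 gen(1,2) by (simp add: deg_beta)
    next
      case False
      then show ?thesis using d_const[of i] gen(1,2) by (simp add: deg_beta d_def)
    qed
    then show ?case using gen c by (simp add: deg_mult algebra_simps)
  next
    case (inv i a)
    have c: "beta n i \<in> carrier A" using inv by simp
    have "deg n 0 (\<phi> (beta n i)) = d 2 * deg n 0 (beta n i)"
    proof (cases "i = 1")
      case True
      then show ?thesis using phi1 inv(1,2) by (simp add: deg_beta)
    next
      case False
      then show ?thesis using d_const[of i] inv(1,2) by (simp add: deg_beta d_def)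
    qed
    then show ?case using inv c by (simp add: deg_mult deg_inv algebra_simps)
  qed
  have b2: "beta n 2 \<in> carrier A" using n2 by simp
  then obtain c where c: "c \<in> carrier A" "\<phi> c = beta n 2" using surj by (metis imageE)
  have "d 2 * deg n 0 c = 1" using deg_phi[OF c(1)] c(2) n2 by (simp add: deg_beta)
  then have "\<bar>d 2\<bar> = 1" using zmult_eq_1_iff[of "d 2" "deg n 0 c"] by auto
  have fix_beta: "\<phi> (beta n i) = beta n i" if i: "1 \<le> i" "i \<le> n" for i
  proof (cases "i = 1")
    case True
    then show ?thesis using phi1 by simp
  next
    case False
    have ci: "beta n i \<in> carrier A" using i by simp
    obtain k :: int where k: "deg n 0 (inv\<^sub>A beta n i \<cdot> \<phi> (beta n i)) = k * N"
        "k = 0 \<longrightarrow> \<phi> (beta n i) = beta n i"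
      using z[OF ci] by blast
    have "deg n 0 (inv\<^sub>A beta n i \<cdot> \<phi> (beta n i)) = - deg n 0 (beta n i) + deg n 0 (\<phi> (beta n i))"
      using ci by (simp add: deg_mult deg_inv)
    also have "\<dots> = d 2 - 1" using False i d_const[of i] by (simp add: deg_beta d_def)
    finally have kN: "d 2 - 1 = k * N" using k(1) by simp
    have "d 2 - 1 = 0"
    proof (rule ccontr)
      assume "d 2 - 1 \<noteq> 0"
      moreover have "N dvd d 2 - 1" unfolding kN by simp
      ultimately have "\<bar>N\<bar> \<le> \<bar>d 2 - 1\<bar>" by (rule dvd_imp_le_int)
      then show False using N \<open>\<bar>d 2\<bar> = 1\<close> by linarith
    qed
    then have "k = 0" using kN N by simp
    then show ?thesis using k(2) by simp
  qed
  show ?thesis using a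
  proof (induction rule: artin_induct)
    case (inv i a)
    have "beta n i \<in> carrier A" using inv by simp
    then show ?case using inv fix_beta[of i] by simp
  qed (simp_all add: fix_beta)
qed

end

section \<open>Automorphisms preserving the free subgroup\<close>

definition exponent_sum :: "'a fg \<Rightarrow> int" where
  "exponent_sum = fext (\<lambda>_. 1)"

lemma additive_exponent_sum [simp]: "additive_map exponent_sum"
  by (simp add: exponent_sum_def)

lemma exponent_sum_simps [simp]: "exponent_sum (x + y) = exponent_sum x + exponent_sum y" "exponent_sum 0 = 0" "exponent_sum (- x) = - exponent_sum x"
  "exponent_sum (x - y) = exponent_sum x - exponent_sum y" "exponent_sum (gen a) = 1"
  by (simp_all add: exponent_sum_def)

lemma exponent_sum_npow [simp]: "exponent_sum (npow k x) = int k * exponent_sum x"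
  by (induction k) (auto simp: algebra_simps)

lemma exponent_sum_delta: "exponent_sum (delta n) = int n"
  by (induction n) (simp_all add: delta_Suc)

lemma conjg_exponent_sum: "conjg x y \<Longrightarrow> exponent_sum x = exponent_sum y"
  by (auto simp: conjg_def)

lemma conjg_signed_npow:
  "conjg x y \<Longrightarrow> conjg (if b then npow k x else - npow k x) (if b then npow k y else - npow k y)"
  by (simp add: conjg_npow conjg_uminus)

context artin_group
begin

lemma rho_pow:
  assumes "b \<in> carrier B"
  shows "rho n (b [^]\<^bsub>B\<^esub> (k :: nat)) = rho n b ^^ k"
proof (induction k)
  case (Suc k)
  have "rho n (b [^]\<^bsub>B\<^esub> Suc k) = rho n (b [^]\<^bsub>B\<^esub> k) \<circ> rho n b"
    using assms by (simp only: B.nat_pow_Suc rho_mult B.nat_pow_closed)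
  then show ?case unfolding Suc funpow_Suc_right .
qed (simp only: B.nat_pow_0 rho_one funpow.simps)

lemma twist_in_braid:
  assumes "1 \<le> i" "i < n"
  shows "\<exists>b \<in> carrier B. \<forall>x. rho n b x = pconj {i, Suc i} (- npow m (gen i + gen (Suc i))) x"
proof -
  have a: "alpha n i \<in> carrier B" using assms by simp
  have "rho n (alpha n i \<otimes>\<^bsub>B\<^esub> alpha n i) = (\<lambda>x. sigma i (sigma i x))"
    using a assms by (simp add: rho_mult rho_alpha comp_def)
  then have "rho n ((alpha n i \<otimes>\<^bsub>B\<^esub> alpha n i) [^]\<^bsub>B\<^esub> m) x = pconj {i, Suc i} (- npow m (gen i + gen (Suc i))) x" for x
    using rho_pow[of "alpha n i \<otimes>\<^bsub>B\<^esub> alpha n i" m] a sigma_twist[where i = i and m = m and x = x] by simp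
  then show ?thesis using a by (intro bexI[of _ "(alpha n i \<otimes>\<^bsub>B\<^esub> alpha n i) [^]\<^bsub>B\<^esub> m"]) simp_all
qed

lemma kap_eqD:
  assumes "kap n x = kap n y" "x \<in> supp_in {1..n}" "y \<in> supp_in {1..n}"
  shows "x = y"
proof -
  have "ev n (kap n x) = ev n (kap n y)" by (simp only: assms(1))
  then show ?thesis using assms(2,3) by (simp only: ev_kap)
qed

lemma additive_ev_kap: "additive_map (\<lambda>x. ev n (kap n x))"
  by (simp add: additive_map_def ev_mult)

end

text \<open>Extensionality is left out, so that the plain composition
  \<open>\<phi> \<circ> epsilon n\<close> is an instance too.\<close>

locale F_automorphism = artin_group +
  fixes \<phi>
  assumes n3: "n \<ge> 3" and hom: "\<phi> \<in> hom A A" and surj: "\<phi> ` carrier A = carrier A"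
    and inj: "inj_on \<phi> (carrier A)" and F: "\<phi> ` F_B n = F_B n"
begin

sublocale phi: group_hom A A \<phi>
  using hom by unfold_locales

text \<open>The restriction of \<open>\<phi>\<close> to \<open>F_n\<close>, transported to the free
  group. It is additive everywhere, with value 0 on the generators outside \<open>1..n\<close>,
  since \<open>kap n\<close> kills these.\<close>

definition f :: "nat fg \<Rightarrow> nat fg" where
  "f x = ev n (\<phi> (kap n x))"

lemma phi_kap: "\<phi> (kap n x) = kap n (f x)"
proof -
  have "\<phi> (kap n x) \<in> F_B n" using F kap_in_F_B by blast
  then show ?thesis unfolding f_def by (rule F_B_eq_kap)
qed

lemma f_supp_in [simp]: "f x \<in> supp_in {1..n}"
  unfolding f_def by (intro ev_supp_in phi.hom_closed kap_closed)

lemma additive_f [simp]: "additive_map f"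
proof -
  have "f (x + y) = f x + f y" for x y
  proof (rule kap_eqD)
    have "kap n (f (x + y)) = \<phi> (kap n x \<cdot> kap n y)" by (simp only: phi_kap[symmetric] kap_plus)
    also have "\<dots> = kap n (f x) \<cdot> kap n (f y)" by (simp only: phi.hom_mult kap_closed phi_kap)
    finally show "kap n (f (x + y)) = kap n (f x + f y)" by (simp only: kap_plus)
  qed (intro supp_in_closed f_supp_in)+
  then show ?thesis by (simp add: additive_map_def)
qed

lemmas f_simps [simp] = additive_simps[OF additive_f]

lemma f_surj:
  assumes y: "y \<in> supp_in {1..n}"
  shows "\<exists>x \<in> supp_in {1..n}. f x = y"
proof -
  have "kap n y \<in> \<phi> ` F_B n" unfolding F by simp
  then obtain a where a: "a \<in> F_B n" "kap n y = \<phi> a" by blast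
  have s: "ev n a \<in> supp_in {1..n}" using a(1) by (intro ev_supp_in) (simp add: F_B_iff)
  have "kap n y = \<phi> (kap n (ev n a))" using a(2) F_B_eq_kap[OF a(1)] by simp
  then have "kap n y = kap n (f (ev n a))" by (simp only: phi_kap)
  then have "y = f (ev n a)" using y by (intro kap_eqD f_supp_in)
  then show ?thesis using s by (intro bexI[of _ "ev n a"]) simp_all
qed

lemma f_nonzero:
  assumes "x \<in> supp_in {1..n}" "x \<noteq> 0"
  shows "f x \<noteq> 0"
proof
  assume "f x = 0"
  then have "\<phi> (kap n x) = \<phi> \<one>\<^bsub>A\<^esub>" using phi_kap[of x] by simp
  then have "kap n x = \<one>\<^bsub>A\<^esub>" by (rule inj_onD[OF inj]) simp_all
  then have "kap n x = kap n 0" by simp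
  then have "x = 0" using assms(1) by (intro kap_eqD) (simp_all add: supp_in_closed)
  then show False using assms(2) by simp
qed

lemma f_equivariant:
  assumes a: "a \<in> carrier A" and x: "x \<in> supp_in {1..n}"
  shows "conjg (rho n (pi_B n (\<phi> a)) (f x)) (f (rho n (pi_B n a) x))"
proof -
  let ?y = "ev n a + rho n (pi_B n a) x - ev n a"
  let ?z = "ev n (\<phi> a) + rho n (pi_B n (\<phi> a)) (f x) - ev n (\<phi> a)"
  have pa: "\<phi> a \<in> carrier A" using a by simp
  have z: "?z \<in> supp_in {1..n}"
    using pa by (intro supp_in_closed ev_supp_in rho_supp_in pi_B_closed f_supp_in)
  have "kap n (f ?y) \<cdot> \<phi> a = \<phi> (kap n ?y \<cdot> a)" by (simp only: phi.hom_mult kap_closed a phi_kap)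
  also have "\<dots> = \<phi> (a \<cdot> kap n x)" by (simp only: conj_kap[OF a])
  also have "\<dots> = \<phi> a \<cdot> kap n (f x)" by (simp only: phi.hom_mult kap_closed a phi_kap)
  also have "\<dots> = kap n ?z \<cdot> \<phi> a" by (rule conj_kap[OF pa])
  finally have "kap n (f ?y) = kap n ?z" using pa A.right_cancel kap_closed by metis
  then have "f ?y = ?z" by (rule kap_eqD[OF _ f_supp_in z])
  then have "f (ev n a) + f (rho n (pi_B n a) x) - f (ev n a) = ?z" by simp
  then have "conjg ?z (f (rho n (pi_B n a) x))" by (metis conjgI)
  then show ?thesis by (simp only: conjg_conj_iff)
qed

text \<open>Surjectivity of \<open>\<phi>\<close> allows the braid to be prescribed on the side of
  the images; \<open>equivariant_in\<close> prescribes it on the side of the arguments.\<close>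

lemma equivariant_out:
  assumes b: "b \<in> carrier B"
  shows "\<exists>c \<in> carrier B. \<forall>x \<in> supp_in {1..n}. conjg (rho n b (f x)) (f (rho n c x))"
proof -
  have "section_B n b \<in> \<phi> ` carrier A" unfolding surj using b by simp
  then obtain a where a: "a \<in> carrier A" "section_B n b = \<phi> a" by blast
  have "pi_B n (\<phi> a) = b" using pi_B_section_B[OF n2 b] a(2) by simp
  then show ?thesis using f_equivariant[OF a(1)] a(1) by (intro bexI[of _ "pi_B n a"]) simp_all
qed

lemma equivariant_in:
  assumes c: "c \<in> carrier B"
  shows "\<exists>b \<in> carrier B. \<forall>x \<in> supp_in {1..n}. conjg (rho n b (f x)) (f (rho n c x))"
proof -
  have s: "section_B n c \<in> carrier A" using c by simp
  show ?thesis using f_equivariant[OF s] s pi_B_section_B[OF n2 c]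
    by (intro bexI[of _ "pi_B n (\<phi> (section_B n c))"]) simp_all
qed

lemma gen_supp_in: "1 \<le> i \<Longrightarrow> i \<le> n \<Longrightarrow> gen i \<in> supp_in {1..n}"
  by (intro supp_in_closed) simp

text \<open>\<open>f\<close> carries a finite orbit of classes to a finite one, so the images of
  \<open>f x\<close> under all powers of twists stay within finitely many classes.\<close>

lemma image_classification:
  assumes x: "x \<in> supp_in {1..n}" "x \<noteq> 0" and K: "finite K"
    and orbit: "\<And>c. c \<in> carrier B \<Longrightarrow> \<exists>z \<in> K. conjg (rho n c x) z"
  shows "\<exists>b k. (\<exists>j \<in> {1..n}. conjg (f x) (if b then npow k (gen j) else - npow k (gen j))) \<or>
    conjg (f x) (if b then npow k (delta n) else - npow k (delta n))"
proof -
  have "\<exists>z \<in> f ` K. conjg (pconj {i, Suc i} (- npow m (gen i + gen (Suc i))) (f x)) z"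
    if i: "1 \<le> i" "i < n" for i m
  proof -
    obtain b where b: "b \<in> carrier B"
        "\<And>y. rho n b y = pconj {i, Suc i} (- npow m (gen i + gen (Suc i))) y"
      using twist_in_braid[OF i, of m] by blast
    obtain c where c: "c \<in> carrier B" "conjg (rho n b (f x)) (f (rho n c x))"
      using equivariant_out[OF b(1)] x(1) by blast
    obtain z where z: "z \<in> K" "conjg (rho n c x) z" using orbit[OF c(1)] by blast
    have "conjg (rho n b (f x)) (f z)"
      by (rule conjg_trans[OF c(2) conjg_additive[OF additive_f z(2)]])
    then show ?thesis using z(1) unfolding b(2) by blast
  qed
  from bounded_twists_classification[OF n3 f_supp_in f_nonzero[OF x] finite_imageI[OF K] this]
  consider k j where "j \<in> {1..n}" "conjg (f x) (npow k (gen j))"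
    | k j where "j \<in> {1..n}" "conjg (f x) (- npow k (gen j))"
    | k where "conjg (f x) (npow k (delta n))" | k where "conjg (f x) (- npow k (delta n))"
    by blast
  then show ?thesis
  proof cases
    case (1 k j)
    then show ?thesis by (intro exI[of _ True] exI[of _ k] disjI1 bexI[of _ j]) simp_all
  next
    case (2 k j)
    then show ?thesis by (intro exI[of _ False] exI[of _ k] disjI1 bexI[of _ j]) simp_all
  next
    case (3 k)
    then show ?thesis by (intro exI[of _ True] exI[of _ k] disjI2) simp
  next
    case (4 k)
    then show ?thesis by (intro exI[of _ False] exI[of _ k] disjI2) simp
  qed
qed

lemma f_gen_orbit:
  assumes i: "1 \<le> i" "i \<le> n"
  shows "\<exists>b \<in> carrier B. conjg (f (gen i)) (rho n b (f (gen 1)))"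
proof -
  obtain k where k: "i = Suc k" "k < n" using i by (cases i) auto
  have t: "tau k \<in> carrier B" using k by (intro tau_closed)
  have "rho n (tau k) (gen 1) = gen i" using rho_tau[of k 1] k by simp
  moreover obtain b where "b \<in> carrier B" "conjg (rho n b (f (gen 1))) (f (rho n (tau k) (gen 1)))"
    using equivariant_in[OF t] gen_supp_in[of 1] n2 by auto
  ultimately show ?thesis by (intro bexI[of _ b]) (simp_all add: conjg_sym)
qed

text \<open>The generators lie in one braid orbit, so their images share exponent and sign. Were
  they conjugate to a power of \<open>delta n\<close>, every value of \<open>f\<close> would have
  equal exponents at \<open>1\<close> and \<open>2\<close>; and the common exponent \<open>k\<close>
  divides every exponent at \<open>1\<close>. Surjectivity rules out the former and forces
  \<open>k = 1\<close>.\<close>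

lemma f_gen_conj:
  "\<exists>b. \<forall>i. 1 \<le> i \<longrightarrow> i \<le> n \<longrightarrow> (\<exists>j \<in> {1..n}. conjg (f (gen i)) (if b then gen j else - gen j))"
proof -
  have g1: "gen 1 \<in> supp_in {1..n}" "gen (1 :: nat) \<noteq> 0" using gen_supp_in[of 1] n2
    by (auto simp flip: wd_Nil_iff)
  have orb: "\<exists>z \<in> gen ` {1..n}. conjg (rho n c (gen 1)) z" if "c \<in> carrier B" for c
    using rho_gen_conj[OF that, of 1] n2 by auto
  obtain b k where bk: "(\<exists>j \<in> {1..n}. conjg (f (gen 1)) (if b then npow k (gen j) else - npow k (gen j))) \<or>
    conjg (f (gen 1)) (if b then npow k (delta n) else - npow k (delta n))"
    using image_classification[OF g1 _ orb] by blast
  have add: "rho n c (if b then npow k x else - npow k x) = (if b then npow k (rho n c x) else - npow k (rho n c x))"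
    if "c \<in> carrier B" for c x
    using additive_rho[OF that] by (simp add: additive_npow additive_uminus)
  have "\<not> conjg (f (gen 1)) (if b then npow k (delta n) else - npow k (delta n))"
  proof
    assume d: "conjg (f (gen 1)) (if b then npow k (delta n) else - npow k (delta n))"
    have fi: "conjg (f (gen i)) (if b then npow k (delta n) else - npow k (delta n))" if i: "i \<in> {1..n}" for i
    proof -
      obtain c where c: "c \<in> carrier B" "conjg (f (gen i)) (rho n c (f (gen 1)))"
        using f_gen_orbit i by auto
      have "conjg (rho n c (f (gen 1))) (if b then npow k (delta n) else - npow k (delta n))"
        using conjg_additive[OF additive_rho[OF c(1)] d] unfolding add[OF c(1)] rho_delta[OF c(1)] .
      with c(2) show ?thesis by (rule conjg_trans)
    qed
    have "additive_map (\<lambda>x. expo a (f x))" for a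
      by (simp add: additive_map_def)
    from additive_eq_on[OF this this, of "{1..n}" 1 2]
    have eq: "expo 1 (f x) = expo 2 (f x)" if "x \<in> supp_in {1..n}" for x
      using that conjg_expo[OF fi] n2 by (simp add: expo_delta del: One_nat_def)
    obtain x where "x \<in> supp_in {1..n}" "f x = gen 1" using f_surj[OF g1(1)] by blast
    then show False using eq[of x] by simp
  qed
  then obtain j where j: "j \<in> {1..n}" "conjg (f (gen 1)) (if b then npow k (gen j) else - npow k (gen j))"
    using bk by blast
  have fi: "\<exists>j \<in> {1..n}. conjg (f (gen i)) (if b then npow k (gen j) else - npow k (gen j))" if i: "i \<in> {1..n}" for i
  proof -
    obtain c where c: "c \<in> carrier B" "conjg (f (gen i)) (rho n c (f (gen 1)))"
      using f_gen_orbit i by auto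
    obtain l where l: "l \<in> {1..n}" "conjg (rho n c (gen j)) (gen l)"
      using rho_gen_conj[OF c(1) j(1)] by blast
    have "conjg (rho n c (f (gen 1))) (if b then npow k (rho n c (gen j)) else - npow k (rho n c (gen j)))"
      using conjg_additive[OF additive_rho[OF c(1)] j(2)] unfolding add[OF c(1)] .
    from conjg_trans[OF conjg_trans[OF c(2) this] conjg_signed_npow[OF l(2)]] l(1)
    show ?thesis by blast
  qed
  have "int k dvd expo 1 (f x)" if "x \<in> supp_in {1..n}" for x
    using that
  proof (induction rule: supp_in_induct)
    case (gen a x)
    obtain j where "j \<in> {1..n}" "conjg (f (gen a)) (if b then npow k (gen j) else - npow k (gen j))"
      using fi[OF gen(1)] by blast
    then show ?case using gen(3) conjg_expo[of "f (gen a)" _ 1] by simp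
  next
    case (neg a x)
    obtain j where "j \<in> {1..n}" "conjg (f (gen a)) (if b then npow k (gen j) else - npow k (gen j))"
      using fi[OF neg(1)] by blast
    then show ?case using neg(3) conjg_expo[of "f (gen a)" _ 1] by simp
  qed simp
  moreover obtain x where "x \<in> supp_in {1..n}" "f x = gen 1" using f_surj[OF g1(1)] by blast
  ultimately have "int k dvd expo 1 (gen (1 :: nat))" by metis
  then have "k = 1" by simp
  then have "\<exists>j \<in> {1..n}. conjg (f (gen i)) (if b then gen j else - gen j)" if "i \<in> {1..n}" for i
    using fi[OF that] by (cases b) simp_all
  then show ?thesis by (intro exI[of _ b]) (simp del: One_nat_def)
qed

text \<open>Braids fix the class of \<open>f (delta n)\<close>, but some braid moves the class of a
  nontrivial power of a generator to that of another. So a power of \<open>delta n\<close> remains,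
  and comparing total exponents shows that it is the first power.\<close>

lemma f_delta_conj:
  assumes pos: "\<And>i. 1 \<le> i \<Longrightarrow> i \<le> n \<Longrightarrow> \<exists>j. conjg (f (gen i)) (gen j)"
  shows "conjg (f (delta n)) (delta n)"
proof -
  let ?s = "\<lambda>b k x :: nat fg. if b then npow k x else - npow k x"
  have nz: "delta n \<noteq> 0" using exponent_sum_delta[of n] n2 by auto
  have tot: "exponent_sum (f (delta n)) = int n"
  proof -
    have "additive_map (\<lambda>x. exponent_sum (f x))" by (simp add: additive_map_def)
    moreover have "exponent_sum (f (gen i)) = exponent_sum (gen i)" if "i \<in> {1..n}" for i
      using pos[of i] that by (auto dest: conjg_exponent_sum)
    ultimately have "exponent_sum (f (delta n)) = exponent_sum (delta n)"
      by (intro additive_eq_on[OF _ additive_exponent_sum _ delta_supp_in])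
    then show ?thesis by (simp add: exponent_sum_delta)
  qed
  have fixed: "conjg (rho n b (f (delta n))) (f (delta n))" if "b \<in> carrier B" for b
    using equivariant_out[OF that] delta_supp_in[of n] by (auto simp: rho_delta)
  have "\<exists>z \<in> {delta n}. conjg (rho n c (delta n)) z" if "c \<in> carrier B" for c
    using rho_delta[OF that] by simp
  from image_classification[OF delta_supp_in nz _ this] obtain b k where
    "(\<exists>j \<in> {1..n}. conjg (f (delta n)) (?s b k (gen j))) \<or> conjg (f (delta n)) (?s b k (delta n))"
    by auto
  then show ?thesis
  proof
    assume "\<exists>j \<in> {1..n}. conjg (f (delta n)) (?s b k (gen j))"
    then obtain j where j: "j \<in> {1..n}" "conjg (f (delta n)) (?s b k (gen j))" by blast
    have "k \<noteq> 0" using conjg_exponent_sum[OF j(2)] tot n2 by (auto split: if_splits)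
    have "\<exists>c \<in> carrier B. \<exists>l. l \<noteq> j \<and> conjg (rho n c (gen j)) (gen l)"
    proof (cases "j < n")
      case True
      then show ?thesis using j(1)
        by (intro bexI[of _ "alpha n j"] exI[of _ "Suc j"]) (simp_all add: rho_alpha sigma_gen)
    next
      case False
      then obtain i where i: "j = Suc i" "1 \<le> i" "i < n" using j(1) n2 by (cases j) auto
      have "conjg (- gen (Suc i) + gen i - - gen (Suc i)) (gen i)" by (rule conjgI)
      then show ?thesis using i
        by (intro bexI[of _ "alpha n i"] exI[of _ i]) (simp_all add: rho_alpha sigma_gen)
    qed
    then obtain c l where c: "c \<in> carrier B" "l \<noteq> j" "conjg (rho n c (gen j)) (gen l)" by blast
    have "rho n c (?s b k (gen j)) = ?s b k (rho n c (gen j))"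
      using additive_rho[OF c(1)] by (simp add: additive_npow additive_uminus)
    then have "conjg (rho n c (f (delta n))) (?s b k (rho n c (gen j)))"
      using conjg_additive[OF additive_rho[OF c(1)] j(2)] by simp
    then have "conjg (rho n c (f (delta n))) (?s b k (gen l))"
      using conjg_signed_npow[OF c(3)] by (rule conjg_trans)
    then have "expo j (f (delta n)) = expo j (?s b k (gen l))"
      using conjg_expo[OF fixed[OF c(1)], of j] conjg_expo by metis
    then have "expo j (?s b k (gen j)) = expo j (?s b k (gen l))" using conjg_expo[OF j(2), of j] by argo
    then show ?thesis using c(2) \<open>k \<noteq> 0\<close> by (cases b) simp_all
  next
    assume d: "conjg (f (delta n)) (?s b k (delta n))"
    have e: "int n = (if b then int k * int n else - (int k * int n))"
      using conjg_exponent_sum[OF d] unfolding tot by (cases b) (simp_all add: exponent_sum_delta)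
    have "b"
    proof (rule ccontr)
      assume "\<not> b"
      with e have "int n = - (int k * int n)" by simp
      moreover have "0 \<le> int k * int n" by simp
      ultimately show False using n2 by linarith
    qed
    with e have "int n * 1 = int n * int k" by simp
    then have "k = 1" using n2 by (simp only: mult_cancel_left) simp
    then show ?thesis using d \<open>b\<close> by simp
  qed
qed

text \<open>On \<open>F_n\<close>, \<open>\<phi>\<close> is a braid automorphism followed by
  conjugation by \<open>g\<close>, which is the effect of conjugation by
  \<open>kap n g \<cdot> section_B n b\<close>. Once this is divided out, \<open>rigidity\<close>
  applies.\<close>

lemma inner_of_positive:
  assumes pos: "\<And>i. 1 \<le> i \<Longrightarrow> i \<le> n \<Longrightarrow> \<exists>j. conjg (f (gen i)) (gen j)"
  shows "\<exists>c \<in> carrier A. \<forall>a \<in> carrier A. \<phi> a = c \<cdot> a \<cdot> inv\<^sub>A c"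
proof -
  obtain g0 where g0: "f (delta n) = g0 + delta n - g0"
    using f_delta_conj[OF pos] by (auto simp: conjg_def)
  text \<open>\<open>g0\<close> may involve generators outside \<open>1..n\<close>, which the retraction \<open>ev n \<circ> kap n\<close> kills.\<close>
  define g where "g = ev n (kap n g0)"
  note add = additive_simps[OF additive_ev_kap]
  have "ev n (kap n (f (delta n))) = g + delta n - g"
    unfolding g0 g_def by (simp only: add ev_kap[OF delta_supp_in])
  then have fd: "f (delta n) = g + delta n - g" by (simp only: ev_kap[OF f_supp_in])
  have g: "g \<in> supp_in {1..n}" unfolding g_def by (intro ev_supp_in kap_closed)
  define h where "h x = - g + f x - (- g)" for x
  have "additive_map ((\<lambda>x. - g + x - (- g)) \<circ> f)" by (rule additive_comp[OF additive_conj additive_f])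
  moreover have "h = (\<lambda>x. - g + x - (- g)) \<circ> f" by (rule ext) (simp only: h_def comp_apply)
  ultimately have hadd: "additive_map h" by (simp only:)
  have hd: "h (delta n) = delta n"
    unfolding h_def fd by (simp add: grp_norm del: add_uminus_conv_diff)
  have hg: "\<exists>j. conjg (h (gen i)) (gen j)" if i: "1 \<le> i" "i \<le> n" for i
    using pos[OF i] unfolding h_def conjg_conj_iff .
  obtain h' where h': "braid_map n h'" "\<forall>x \<in> supp_in {1..n}. h x = h' x"
    using artin_characterization[OF hadd hd hg] by blast
  obtain b where b: "b \<in> carrier B" "rho n b = h'" using braid_map_rho[OF h'(1)] by blast
  have fx: "f x = g + rho n b x - g" if "x \<in> supp_in {1..n}" for x
  proof -
    have "- g + f x - (- g) = rho n b x" using h'(2) that by (simp only: b(2) h_def)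
    then have "g + (- g + f x - (- g)) - g = g + rho n b x - g" by (simp only:)
    then show ?thesis by (simp add: grp_norm del: add_uminus_conv_diff)
  qed
  define c where "c = kap n g \<cdot> section_B n b"
  have c: "c \<in> carrier A" unfolding c_def using b(1) by simp
  have ev_c: "ev n c = g" "pi_B n c = b"
    unfolding c_def using b(1) g by (simp_all add: ev_mult ev_kap ev_section pi_B_section_B[OF n2])
  define \<chi> where "\<chi> a = inv\<^sub>A c \<cdot> \<phi> a \<cdot> c" for a
  have "\<chi> a = a" if a: "a \<in> carrier A" for a
  proof (rule rigidity[OF n3 _ _ _ a])
    show "\<chi> \<in> hom A A"
    proof (rule homI)
      fix x y assume xy: "x \<in> carrier A" "y \<in> carrier A"
      then show "\<chi> x \<in> carrier A" using c by (simp add: \<chi>_def)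
      have cc: "c \<cdot> (inv\<^sub>A c \<cdot> z) = z" if "z \<in> carrier A" for z
        using c that by (simp add: A.m_assoc[symmetric])
      show "\<chi> (x \<cdot> y) = \<chi> x \<cdot> \<chi> y" using xy c by (simp add: \<chi>_def A.m_assoc cc)
    qed
    show "\<chi> ` carrier A = carrier A"
    proof (intro equalityI subsetI)
      fix y assume "y \<in> \<chi> ` carrier A"
      then show "y \<in> carrier A" using c by (auto simp: \<chi>_def)
    next
      fix y assume y: "y \<in> carrier A"
      then have "c \<cdot> y \<cdot> inv\<^sub>A c \<in> \<phi> ` carrier A" unfolding surj using c by simp
      then obtain x where x: "x \<in> carrier A" "\<phi> x = c \<cdot> y \<cdot> inv\<^sub>A c" by (metis imageE)
      have "inv\<^sub>A c \<cdot> (c \<cdot> y) = y" using c y by (simp add: A.m_assoc[symmetric])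
      then have "\<chi> x = y" unfolding \<chi>_def x(2) using c y by (simp add: A.m_assoc)
      then show "y \<in> \<chi> ` carrier A" using x(1) by blast
    qed
    fix x :: "nat fg" assume x: "x \<in> supp_in {1..n}"
    have "c \<cdot> kap n x = kap n (f x) \<cdot> c"
      using conj_kap[OF c, of x] unfolding ev_c fx[OF x] .
    then have "\<chi> (kap n x) = inv\<^sub>A c \<cdot> (c \<cdot> kap n x)"
      unfolding \<chi>_def phi_kap using c by (simp add: A.m_assoc)
    then show "\<chi> (kap n x) = kap n x" using c by (simp add: A.m_assoc[symmetric])
  qed
  then have "\<phi> a = c \<cdot> a \<cdot> inv\<^sub>A c" if a: "a \<in> carrier A" for a
  proof -
    have pa: "\<phi> a \<in> carrier A" using a by simp
    have "c \<cdot> \<chi> a \<cdot> inv\<^sub>A c = \<phi> a"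
    proof -
      have "c \<cdot> \<chi> a = \<phi> a \<cdot> c"
        unfolding \<chi>_def using c pa by (simp add: A.m_assoc[symmetric])
      then show ?thesis using c pa by (simp add: A.m_assoc)
    qed
    then show ?thesis using \<open>\<And>a. a \<in> carrier A \<Longrightarrow> \<chi> a = a\<close>[OF a] by simp
  qed
  then show ?thesis using c by blast
qed

end

context artin_group
begin

lemma pi_epsilon: "a \<in> F_B n \<Longrightarrow> epsilon n a \<in> F_B n"
proof -
  interpret e: group_hom A A "epsilon n" using epsilon_hom[OF n2] by unfold_locales
  have "pi_B n (epsilon n (kap n x)) = \<one>\<^bsub>B\<^esub>" for x
  proof (induction x rule: fg_induct)
    have u: "pi_B n (epsilon n (ugen n i)) = \<one>\<^bsub>B\<^esub>" for i
    proof (induction i)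
      case (Suc i)
      consider "i = 0" | "1 \<le> i" "Suc i \<le> n" | "n < Suc i" by linarith
      then show ?case
      proof cases
        case 2
        then have "beta n (Suc i) \<in> carrier A" by simp
        then show ?thesis using 2 Suc by (simp add: ugen_Suc epsilon_beta[OF n2])
      qed (use n2 in \<open>simp_all add: ugen_1 ugen_large epsilon_beta[OF n2] pi_B_beta\<close>)
    qed (simp add: ugen_0)
    {
      case (gen a x)
      then show ?case by (simp add: u)
    next
      case (neg a x)
      then show ?case by (simp add: u del: add_uminus_conv_diff)
    }
  qed simp
  moreover assume "a \<in> F_B n"
  ultimately have "pi_B n (epsilon n a) = \<one>\<^bsub>B\<^esub>" using F_B_eq_kap by metis
  then show ?thesis using \<open>a \<in> F_B n\<close> by (simp add: F_B_iff)
qed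

lemma epsilon_F_B: "epsilon n ` F_B n = F_B n"
proof (intro equalityI subsetI)
  fix a assume "a \<in> F_B n"
  then have "a = epsilon n (epsilon n a)" "epsilon n a \<in> F_B n"
    using epsilon_epsilon[OF n2] pi_epsilon by (simp_all add: F_B_iff)
  then show "a \<in> epsilon n ` F_B n" by blast
qed (use pi_epsilon in blast)

theorem F_automorphism_cases:
  assumes n3: "n \<ge> 3" and phi: "\<phi> \<in> auto A" "\<phi> ` F_B n = F_B n"
  shows "(\<exists>c \<in> carrier A. \<forall>a \<in> carrier A. \<phi> a = c \<cdot> a \<cdot> inv\<^sub>A c) \<or>
    (\<exists>c \<in> carrier A. \<forall>a \<in> carrier A. \<phi> (epsilon n a) = c \<cdot> a \<cdot> inv\<^sub>A c)"
proof -
  have bij: "\<phi> \<in> hom A A" "bij_betw \<phi> (carrier A) (carrier A)"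
    using phi(1) by (auto simp: auto_def Bij_def)
  interpret F_automorphism n \<phi>
    using n3 bij phi(2) by unfold_locales (auto simp: bij_betw_def)
  obtain b where b: "\<And>i. 1 \<le> i \<Longrightarrow> i \<le> n \<Longrightarrow> \<exists>j \<in> {1..n}. conjg (f (gen i)) (if b then gen j else - gen j)"
    using f_gen_conj by blast
  show ?thesis
  proof (cases b)
    case True
    then have "\<exists>j. conjg (f (gen i)) (gen j)" if "1 \<le> i" "i \<le> n" for i using b[OF that] by auto
    from inner_of_positive[OF this] show ?thesis by blast
  next
    case False
    have ebij: "epsilon n \<in> hom A A" "bij_betw (epsilon n) (carrier A) (carrier A)"
      using epsilon_auto[OF n2] by (auto simp: auto_def Bij_def)
    have ebij': "bij_betw (\<phi> \<circ> epsilon n) (carrier A) (carrier A)"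
      using ebij(2) bij(2) by (rule bij_betw_trans)
    interpret e: F_automorphism n "\<phi> \<circ> epsilon n"
    proof unfold_locales
      show "\<phi> \<circ> epsilon n \<in> hom A A" using ebij(1) bij(1) by (rule Group.hom_compose)
      show "(\<phi> \<circ> epsilon n) ` F_B n = F_B n" by (simp only: image_comp[symmetric] epsilon_F_B phi(2))
    qed (use n3 ebij' in \<open>auto simp: bij_betw_def\<close>)
    \<comment> \<open>\<open>epsilon n\<close> inverts \<open>beta n 1\<close> itself, so the two
      maps have opposite signs at \<open>gen 1\<close>, and hence at all generators, as each map has
      one common sign.\<close>
    have f1: "e.f (gen 1) = - f (gen 1)"
    proof -
      have c: "beta n 1 \<in> carrier A" using n2 by simp
      have "(\<phi> \<circ> epsilon n) (kap n (gen 1)) = \<phi> (inv\<^sub>A kap n (gen 1))"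
        using n2 by (simp add: ugen_1 epsilon_beta[OF n2])
      also have "\<dots> = kap n (f (- gen 1))" by (simp only: kap_uminus[symmetric] phi_kap)
      finally have "e.f (gen 1) = ev n (kap n (f (- gen 1)))" by (simp only: e.f_def)
      also have "\<dots> = f (- gen 1)" by (rule ev_kap[OF f_supp_in])
      finally show ?thesis by simp
    qed
    obtain b' where b': "\<And>i. 1 \<le> i \<Longrightarrow> i \<le> n \<Longrightarrow>
        \<exists>j \<in> {1..n}. conjg (e.f (gen i)) (if b' then gen j else - gen j)"
      using e.f_gen_conj by blast
    have b'
    proof (rule ccontr)
      assume "\<not> b'"
      then obtain j where "conjg (e.f (gen 1)) (- gen j)" using b'[of 1] n2 by auto
      moreover obtain l where "conjg (f (gen 1)) (- gen l)" using b[of 1] n2 False by auto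
      ultimately have "exponent_sum (e.f (gen 1)) = -1" "exponent_sum (f (gen 1)) = -1"
        using conjg_exponent_sum by fastforce+
      then show False using arg_cong[OF f1, of exponent_sum] by simp
    qed
    then have "\<exists>j. conjg (e.f (gen i)) (gen j)" if "1 \<le> i" "i \<le> n" for i using b'[OF that] by auto
    from e.inner_of_positive[OF this] show ?thesis by simp
  qed
qed

end

section \<open>Groups that split over a normal subgroup of index two\<close>

text \<open>The purely group-theoretic part of the final statement: \<open>N\<close> stands for the
  inner automorphisms and \<open>e\<close> for \<open>epsilon n\<close>.\<close>

locale split_index_two = group P for P (structure) +
  fixes N e
  assumes N: "N \<lhd> P" and e: "e \<in> carrier P" "e \<otimes> e = \<one>" "e \<notin> N"
    and cover: "\<And>x. x \<in> carrier P \<Longrightarrow> x \<in> N \<or> (\<exists>i \<in> N. x = i \<otimes> e)"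
begin

lemma N_subgroup: "subgroup N P"
  using N by (rule normal_imp_subgroup)

lemma N_carrier: "i \<in> N \<Longrightarrow> i \<in> carrier P"
  using N_subgroup by (rule subgroup.mem_carrier)

lemma inv_e: "inv e = e"
  using e by (intro inv_equality)

lemma coset_not_N: "i \<in> N \<Longrightarrow> i \<otimes> e \<notin> N"
proof
  assume i: "i \<in> N" "i \<otimes> e \<in> N"
  then have "inv i \<otimes> (i \<otimes> e) \<in> N"
    using N_subgroup by (meson subgroup.m_closed subgroup.m_inv_closed)
  then show False using e i(1) N_carrier by (simp add: m_assoc[symmetric])
qed

lemma conj_e: "i \<in> N \<Longrightarrow> e \<otimes> i \<otimes> e \<in> N"
  using N e(1) inv_e by (metis normal_inv_iff)

lemma subgroup_e: "subgroup {\<one>, e} P"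
  by (rule subgroupI) (use e inv_e in auto)

lemma internal_semidirect: "internal_semidirect P N {\<one>, e}"
  unfolding internal_semidirect_def
proof (intro conjI N subgroup_e)
  show "N \<inter> {\<one>, e} = {\<one>}" using e(3) N_subgroup subgroup.one_closed by auto
  show "N <#> {\<one>, e} = carrier P"
  proof (intro equalityI subsetI)
    fix x assume "x \<in> N <#> {\<one>, e}"
    then show "x \<in> carrier P" using e(1) N_carrier unfolding set_mult_def by auto
  next
    fix x assume "x \<in> carrier P"
    from cover[OF this] show "x \<in> N <#> {\<one>, e}"
    proof
      assume "x \<in> N"
      then have "x = x \<otimes> \<one>" using N_carrier by simp
      then show ?thesis using \<open>x \<in> N\<close> unfolding set_mult_def by blast
    next
      assume "\<exists>i \<in> N. x = i \<otimes> e"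
      then show ?thesis unfolding set_mult_def by blast
    qed
  qed
qed

lemma Mod_iso_C2: "P Mod N \<cong> C2"
proof -
  define s where "s x = (if x \<in> N then 0 else 1 :: int)" for x
  have hom: "s \<in> hom P C2"
  proof (rule homI)
    fix x y assume x: "x \<in> carrier P" and y: "y \<in> carrier P"
    show "s x \<in> carrier C2" by (simp add: s_def carrier_integer_mod_group)
    have "(x \<otimes> y \<in> N) = (x \<in> N \<longleftrightarrow> y \<in> N)"
    proof (cases "x \<in> N")
      case xN: True
      have "y \<in> N" if "x \<otimes> y \<in> N"
      proof -
        have "inv x \<otimes> (x \<otimes> y) \<in> N"
          using N_subgroup xN that by (meson subgroup.m_closed subgroup.m_inv_closed)
        then show ?thesis using x y by (simp add: m_assoc[symmetric])
      qed
      then show ?thesis using xN N_subgroup by (auto intro: subgroup.m_closed)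
    next
      case False
      then obtain i where i: "i \<in> N" "x = i \<otimes> e" using cover[OF x] by blast
      show ?thesis
      proof (cases "y \<in> N")
        case True
        have "x \<otimes> y = i \<otimes> (e \<otimes> y \<otimes> e) \<otimes> e"
          using i e y N_carrier by (simp add: m_assoc)
        moreover have "i \<otimes> (e \<otimes> y \<otimes> e) \<in> N"
          using N_subgroup i(1) conj_e[OF True] by (rule subgroup.m_closed)
        ultimately show ?thesis using coset_not_N False True by simp
      next
        case yN: False
        then obtain j where j: "j \<in> N" "y = j \<otimes> e" using cover[OF y] by blast
        have "x \<otimes> y = i \<otimes> (e \<otimes> j \<otimes> e)" using i j e N_carrier by (simp add: m_assoc)
        moreover have "i \<otimes> (e \<otimes> j \<otimes> e) \<in> N"
          using N_subgroup i(1) conj_e[OF j(1)] by (rule subgroup.m_closed)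
        ultimately show ?thesis using False yN by simp
      qed
    qed
    then show "s (x \<otimes> y) = s x \<otimes>\<^bsub>C2\<^esub> s y" by (simp add: s_def)
  qed
  interpret s: group_hom P C2 s
    using hom by (simp add: group_hom_def group_hom_axioms_def group_axioms)
  have "kernel P C2 s = N" using N_carrier by (auto simp: kernel_def s_def split: if_splits)
  moreover have "s ` carrier P = carrier C2"
  proof -
    have "s \<one> = 0" "s e = 1" using e(3) N_subgroup subgroup.one_closed by (auto simp: s_def)
    then have "{0, 1} \<subseteq> s ` carrier P" using e(1) one_closed by (metis empty_subsetI imageI insert_subset)
    moreover have "s ` carrier P \<subseteq> {0, 1}" by (auto simp: s_def)
    moreover have "carrier C2 = {0, 1}" by (auto simp: carrier_integer_mod_group)
    ultimately show ?thesis by auto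
  qed
  ultimately show ?thesis using s.FactGroup_iso by simp
qed

text \<open>\<open>h\<close> identifies the quotient by \<open>K\<close> with \<open>N\<close>, and
  \<open>d\<close> lifts conjugation by \<open>e\<close> to \<open>G\<close>. A pair
  \<open>(X, k)\<close> corresponds to the image of \<open>X\<close> times the \<open>k\<close>-th
  power of \<open>e\<close>.\<close>

lemma semidirect_iso:
  fixes G :: "('g, 'm) monoid_scheme"
  assumes G: "group G" and h: "h \<in> hom G P" "h ` carrier G = N" and K: "kernel G P h = K"
    and act0: "\<And>X. \<theta> 0 X = X" and act1: "\<And>X. X \<in> carrier (G Mod K) \<Longrightarrow> \<theta> 1 X = d ` X"
    and d: "\<And>g. g \<in> carrier G \<Longrightarrow> d g \<in> carrier G"
      "\<And>g. g \<in> carrier G \<Longrightarrow> d ` (K #>\<^bsub>G\<^esub> g) = K #>\<^bsub>G\<^esub> d g"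
      "\<And>g. g \<in> carrier G \<Longrightarrow> h (d g) = e \<otimes> h g \<otimes> e"
  shows "P \<cong> semidirect (G Mod K) C2 \<theta>"
proof -
  interpret h: group_hom G P h using G h(1) by (simp add: group_hom_def group_hom_axioms_def group_axioms)
  let ?Q = "G Mod K" and ?S = "semidirect (G Mod K) C2 \<theta>"
  have Kn: "K \<lhd> G" using h.normal_kernel K by simp
  define q where "q X = the_elem (h ` X)" for X
  have qhom: "q \<in> hom ?Q P" using h.FactGroup_hom unfolding K q_def .
  have qinj: "inj_on q (carrier ?Q)" using h.FactGroup_inj_on unfolding K q_def .
  have Q: "carrier ?Q = (\<lambda>g. K #>\<^bsub>G\<^esub> g) ` carrier G" by (rule carrier_FactGroup)
  have qc: "q (K #>\<^bsub>G\<^esub> g) = h g" if g: "g \<in> carrier G" for g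
  proof -
    have "h x = h g" if x: "x \<in> K #>\<^bsub>G\<^esub> g" for x
    proof -
      obtain k where k: "k \<in> K" "x = k \<otimes>\<^bsub>G\<^esub> g" using x by (auto simp: r_coset_def)
      then have "k \<in> carrier G" "h k = \<one>" using K by (auto simp: kernel_def)
      then show ?thesis using k g by simp
    qed
    moreover have "g \<in> K #>\<^bsub>G\<^esub> g"
      using g Kn normal_imp_subgroup h.G.rcos_self by metis
    ultimately have "h ` (K #>\<^bsub>G\<^esub> g) = {h g}" by blast
    then show ?thesis by (simp add: q_def)
  qed
  have qN: "q ` carrier ?Q = N"
  proof -
    have "q ` carrier ?Q = h ` carrier G" unfolding Q image_image using qc by (intro image_cong) simp_all
    then show ?thesis by (simp add: h(2))
  qed
  have dQ: "d ` X \<in> carrier ?Q \<and> q (d ` X) = e \<otimes> q X \<otimes> e" if X: "X \<in> carrier ?Q" for X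
  proof -
    obtain g where g: "g \<in> carrier G" "X = K #>\<^bsub>G\<^esub> g" using X unfolding Q by blast
    then show ?thesis using d[OF g(1)] by (simp add: Q qc)
  qed
  interpret Q: group ?Q using Kn by (rule normal.factorgroup_is_group)
  define E where "E k = (if k = 0 then \<one> else e)" for k :: int
  define \<Phi> where "\<Phi> = (\<lambda>(X, k). q X \<otimes> E k)"
  have C2: "carrier C2 = {0, 1}" by (auto simp: carrier_integer_mod_group)
  have S: "carrier ?S = carrier ?Q \<times> {0, 1}" by (simp add: semidirect_def C2)
  have qN': "q X \<in> N" if "X \<in> carrier ?Q" for X using qN that by blast
  have qP: "q X \<in> carrier P" if "X \<in> carrier ?Q" for X using qN'[OF that] N_carrier by blast
  have E: "E k \<in> carrier P" for k using e(1) by (simp add: E_def)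
  have th: "\<theta> k X \<in> carrier ?Q \<and> E k \<otimes> q X = q (\<theta> k X) \<otimes> E k"
    if "X \<in> carrier ?Q" "k \<in> {0, 1}" for X k
  proof (cases "k = 0")
    case True
    then show ?thesis using that qP act0 by (simp add: E_def)
  next
    case False
    then have "k = 1" using that(2) by simp
    then show ?thesis using act1[OF that(1)] dQ[OF that(1)] qP[OF that(1)] e
      by (simp add: E_def m_assoc)
  qed
  have hom: "\<Phi> (x \<otimes>\<^bsub>?S\<^esub> y) = \<Phi> x \<otimes> \<Phi> y" and closed: "x \<otimes>\<^bsub>?S\<^esub> y \<in> carrier ?S"
    if xy: "x \<in> carrier ?S" "y \<in> carrier ?S" for x y
  proof -
    obtain X k Y l where x: "x = (X, k)" "X \<in> carrier ?Q" "k \<in> {0, 1}"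
      and y: "y = (Y, l)" "Y \<in> carrier ?Q" "l \<in> {0, 1}" using xy unfolding S by blast
    note t = th[OF y(2) x(3)]
    have m: "x \<otimes>\<^bsub>?S\<^esub> y = (X \<otimes>\<^bsub>?Q\<^esub> \<theta> k Y, (k + l) mod 2)"
      by (simp add: semidirect_def x(1) y(1))
    have "(k + l) mod 2 \<in> {0, 1}" by auto
    then show "x \<otimes>\<^bsub>?S\<^esub> y \<in> carrier ?S" unfolding m S using Q.m_closed[OF x(2)] t by blast
    have EE: "E ((k + l) mod 2) = E k \<otimes> E l" using x(3) y(3) e by (auto simp: E_def)
    have "\<Phi> (x \<otimes>\<^bsub>?S\<^esub> y) = q X \<otimes> q (\<theta> k Y) \<otimes> (E k \<otimes> E l)"
      unfolding m using hom_mult[OF qhom x(2)] t by (simp add: \<Phi>_def EE)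
    also have "\<dots> = q X \<otimes> (q (\<theta> k Y) \<otimes> E k) \<otimes> E l"
      using t qP x(2) E by (simp add: m_assoc)
    also have "\<dots> = q X \<otimes> (E k \<otimes> q Y) \<otimes> E l" using t by simp
    also have "\<dots> = \<Phi> x \<otimes> \<Phi> y" using qP x(2) y(2) E by (simp add: \<Phi>_def x(1) y(1) m_assoc)
    finally show "\<Phi> (x \<otimes>\<^bsub>?S\<^esub> y) = \<Phi> x \<otimes> \<Phi> y" .
  qed
  have bij: "bij_betw \<Phi> (carrier ?S) (carrier P)"
  proof (rule bij_betw_imageI)
    show "inj_on \<Phi> (carrier ?S)"
    proof (rule inj_onI)
      fix x y assume xy: "x \<in> carrier ?S" "y \<in> carrier ?S" "\<Phi> x = \<Phi> y"
      obtain X k Y l where x: "x = (X, k)" "X \<in> carrier ?Q" "k \<in> {0, 1}"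
        and y: "y = (Y, l)" "Y \<in> carrier ?Q" "l \<in> {0, 1}" using xy(1,2) unfolding S by blast
      have eq: "q X \<otimes> E k = q Y \<otimes> E l" using xy(3) by (simp add: \<Phi>_def x(1) y(1))
      have mem: "q Z \<otimes> E j \<in> N \<longleftrightarrow> j = 0" if "Z \<in> carrier ?Q" for Z j
        using qN'[OF that] qP[OF that] coset_not_N by (simp add: E_def)
      have "k = l" using mem[OF x(2), of k] mem[OF y(2), of l] eq x(3) y(3) by auto
      then have "q X = q Y" using eq qP x(2) y(2) E by simp
      then show "x = y" using qinj x y \<open>k = l\<close> by (auto dest: inj_onD)
    qed
    show "\<Phi> ` carrier ?S = carrier P"
    proof (intro equalityI subsetI)
      fix z assume "z \<in> \<Phi> ` carrier ?S"
      then show "z \<in> carrier P" using qP E by (auto simp: S \<Phi>_def)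
    next
      fix z assume "z \<in> carrier P"
      from cover[OF this] obtain i k where i: "i \<in> N" "k \<in> {0, 1}" "z = i \<otimes> E k"
      proof
        assume "z \<in> N"
        then show ?thesis using that[of z 0] N_carrier by (simp add: E_def)
      next
        assume "\<exists>i \<in> N. z = i \<otimes> e"
        then obtain i where "i \<in> N" "z = i \<otimes> e" by blast
        then show ?thesis using that[of i 1] by (simp add: E_def)
      qed
      then obtain X where "X \<in> carrier ?Q" "i = q X" using qN by blast
      then have "z = \<Phi> (X, k)" "(X, k) \<in> carrier ?S" using i by (simp_all add: \<Phi>_def S)
      then show "z \<in> \<Phi> ` carrier ?S" by blast
    qed
  qed
  \<comment> \<open>The isomorphism has to start at \<open>P\<close>, so \<open>\<Phi>\<close> is
    inverted; closure of the multiplication on its domain is enough for the inverse to be a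
    homomorphism.\<close>
  define \<Psi> where "\<Psi> = inv_into (carrier ?S) \<Phi>"
  have bij': "bij_betw \<Psi> (carrier P) (carrier ?S)" unfolding \<Psi>_def using bij by (rule bij_betw_inv_into)
  have right: "\<Phi> (\<Psi> x) = x" if "x \<in> carrier P" for x
    unfolding \<Psi>_def using bij that by (rule bij_betw_inv_into_right)
  have left: "\<Psi> (\<Phi> y) = y" if "y \<in> carrier ?S" for y
    unfolding \<Psi>_def using bij that by (rule bij_betw_inv_into_left)
  have mem: "\<Psi> x \<in> carrier ?S" if "x \<in> carrier P" for x using bij' that by (rule bij_betwE[rule_format])
  have "\<Psi> \<in> hom P ?S"
  proof (rule homI)
    fix x y assume x: "x \<in> carrier P" and y: "y \<in> carrier P"
    have "\<Phi> (\<Psi> x \<otimes>\<^bsub>?S\<^esub> \<Psi> y) = x \<otimes> y" using hom[OF mem[OF x] mem[OF y]] right x y by simp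
    then show "\<Psi> (x \<otimes> y) = \<Psi> x \<otimes>\<^bsub>?S\<^esub> \<Psi> y" using left[OF closed[OF mem[OF x] mem[OF y]]] by simp
  qed (rule mem)
  then have "\<Psi> \<in> iso P ?S" using bij' by (simp add: iso_def)
  then show ?thesis unfolding is_iso_def by blast
qed

end


section \<open>Inner automorphisms\<close>

definition inner :: "('a, 'b) monoid_scheme \<Rightarrow> 'a \<Rightarrow> 'a \<Rightarrow> 'a" where
  "inner G g = (\<lambda>x \<in> carrier G. g \<otimes>\<^bsub>G\<^esub> x \<otimes>\<^bsub>G\<^esub> inv\<^bsub>G\<^esub> g)"

lemma Inn_inner: "Inn G = inner G ` carrier G"
  by (simp add: Inn_def inner_def)

lemma AutoGroup_mult:
  "f \<in> auto G \<Longrightarrow> g \<in> auto G \<Longrightarrow> f \<otimes>\<^bsub>AutoGroup G\<^esub> g = compose (carrier G) f g"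
  by (simp add: AutoGroup_def BijGroup_def auto_def)

lemma AutoGroup_carrier: "carrier (AutoGroup G) = auto G"
  by (simp add: AutoGroup_def)

lemma AutoGroup_one: "\<one>\<^bsub>AutoGroup G\<^esub> = (\<lambda>x \<in> carrier G. x)"
  by (simp add: AutoGroup_def BijGroup_def)

lemma auto_eqI:
  assumes "f \<in> auto G" "g \<in> auto G" "\<And>x. x \<in> carrier G \<Longrightarrow> f x = g x"
  shows "f = g"
  using assms by (intro extensionalityI[of f "carrier G"]) (auto simp: auto_def Bij_def)

context group
begin

lemma inner_auto:
  assumes g: "g \<in> carrier G"
  shows "inner G g \<in> auto G"
proof -
  have canc: "inv g \<otimes> (g \<otimes> x) = x" "g \<otimes> (inv g \<otimes> x) = x" if "x \<in> carrier G" for x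
    using g that by (simp_all add: m_assoc[symmetric])
  have "inner G g \<in> hom G G"
    using g by (intro homI) (simp_all add: inner_def m_assoc canc)
  moreover have "bij_betw (inner G g) (carrier G) (carrier G)"
    by (rule bij_betwI[where g = "\<lambda>x. inv g \<otimes> x \<otimes> g"]) (use g in \<open>simp_all add: inner_def m_assoc canc\<close>)
  ultimately show ?thesis by (simp add: auto_def Bij_def inner_def)
qed

lemma inner_mult:
  assumes "g \<in> carrier G" "h \<in> carrier G"
  shows "inner G (g \<otimes> h) = inner G g \<otimes>\<^bsub>AutoGroup G\<^esub> inner G h"
proof -
  interpret Aut: group "AutoGroup G" by (rule AutoGroup)
  have m: "inner G g \<otimes>\<^bsub>AutoGroup G\<^esub> inner G h = compose (carrier G) (inner G g) (inner G h)"
    using assms by (intro AutoGroup_mult inner_auto)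
  show ?thesis unfolding m
    by (rule ext) (use assms in \<open>simp add: inner_def compose_def inv_mult_group m_assoc\<close>)
qed

lemma inner_hom: "inner G \<in> hom G (AutoGroup G)"
  by (rule homI) (simp_all add: AutoGroup_carrier inner_auto inner_mult)

lemma conj_inner:
  assumes f: "f \<in> auto G" and g: "g \<in> carrier G"
  shows "f \<otimes>\<^bsub>AutoGroup G\<^esub> inner G g = inner G (f g) \<otimes>\<^bsub>AutoGroup G\<^esub> f"
proof -
  interpret f: group_hom G G f using f by unfold_locales (simp add: auto_def)
  have c: "f g \<in> carrier G" using g by simp
  show ?thesis unfolding AutoGroup_mult[OF f inner_auto[OF g]] AutoGroup_mult[OF inner_auto[OF c] f]
    by (rule ext) (use g in \<open>simp add: inner_def compose_def\<close>)
qed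

lemma inner_kernel: "kernel G (AutoGroup G) (inner G) = center G"
proof (intro equalityI subsetI)
  fix z assume z: "z \<in> kernel G (AutoGroup G) (inner G)"
  then have c: "z \<in> carrier G" and i: "inner G z = (\<lambda>x \<in> carrier G. x)"
    by (simp_all add: kernel_def AutoGroup_one)
  have "z \<otimes> x = x \<otimes> z" if x: "x \<in> carrier G" for x
  proof -
    have "z \<otimes> x \<otimes> inv z = x" using fun_cong[OF i, of x] x by (simp add: inner_def)
    then have "z \<otimes> x \<otimes> inv z \<otimes> z = x \<otimes> z" by simp
    then show ?thesis using c x by (simp add: m_assoc)
  qed
  then show "z \<in> center G" using c by (simp add: center_def)
next
  fix z assume z: "z \<in> center G"
  then have c: "z \<in> carrier G" and com: "\<And>x. x \<in> carrier G \<Longrightarrow> z \<otimes> x = x \<otimes> z"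
    by (simp_all add: center_def)
  have "inner G z = (\<lambda>x \<in> carrier G. x)"
    by (rule ext) (simp add: inner_def com c m_assoc)
  then show "z \<in> kernel G (AutoGroup G) (inner G)" using c by (simp add: kernel_def AutoGroup_one)
qed

lemma auto_center:
  assumes f: "f \<in> auto G"
  shows "f ` center G = center G"
proof -
  interpret f: group_hom G G f using f by unfold_locales (simp add: auto_def)
  have bij: "bij_betw f (carrier G) (carrier G)" using f by (simp add: auto_def Bij_def)
  then have surj: "f ` carrier G = carrier G" and inj: "inj_on f (carrier G)" by (auto simp: bij_betw_def)
  show ?thesis
  proof (intro equalityI subsetI)
    fix y assume "y \<in> f ` center G"
    then obtain z where z: "z \<in> carrier G" "\<And>x. x \<in> carrier G \<Longrightarrow> z \<otimes> x = x \<otimes> z" "y = f z"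
      by (auto simp: center_def)
    have "y \<otimes> x = x \<otimes> y" if "x \<in> carrier G" for x
    proof -
      have "x \<in> f ` carrier G" using surj that by simp
      then obtain w where "w \<in> carrier G" "x = f w" by blast
      then show ?thesis using z f.hom_mult[of z w] f.hom_mult[of w z] by simp
    qed
    then show "y \<in> center G" using z by (simp add: center_def)
  next
    fix y assume y: "y \<in> center G"
    then have "y \<in> f ` carrier G" using surj by (simp add: center_def)
    then obtain z where z: "z \<in> carrier G" "y = f z" by blast
    have "z \<otimes> x = x \<otimes> z" if x: "x \<in> carrier G" for x
    proof (rule inj_onD[OF inj])
      show "f (z \<otimes> x) = f (x \<otimes> z)" using y z x by (simp add: center_def)
    qed (use x z in simp_all)
    then show "y \<in> f ` center G" using z by (auto simp: center_def)
  qed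
qed

end

theorem theorem4p2:
  fixes n :: nat
  assumes "n \<ge> 3"
  shows "carrier (Aut_pair (artin_B n) (F_B n)) =
           generate (AutoGroup (artin_B n)) (Inn (artin_B n) \<union> {epsilon n})
       \<and> internal_semidirect (Aut_pair (artin_B n) (F_B n))
           (Inn (artin_B n)) (generate (AutoGroup (artin_B n)) {epsilon n})
       \<and> Aut_pair (artin_B n) (F_B n) \<cong>
           semidirect (artin_B n Mod center (artin_B n)) C2 (epsilon_action n)
       \<and> Out_pair (artin_B n) (F_B n) \<cong> C2"
proof -
  interpret artin_group n using assms by unfold_locales simp
  let ?Aut = "AutoGroup A" and ?P = "Aut_pair A (F_B n)" and ?e = "epsilon n"
  interpret Aut: group ?Aut by (rule A.AutoGroup)
  interpret e: group_hom A A ?e using epsilon_hom[OF n2] by unfold_locales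
  have e_auto: "?e \<in> auto A" by (rule epsilon_auto[OF n2])
  have ee: "?e \<otimes>\<^bsub>?Aut\<^esub> ?e = \<one>\<^bsub>?Aut\<^esub>"
    unfolding AutoGroup_mult[OF e_auto e_auto] AutoGroup_one
    by (rule ext) (simp add: compose_def epsilon_epsilon[OF n2])
  have e_Aut: "?e \<in> carrier ?Aut" using e_auto by (simp add: AutoGroup_carrier)
  have inv_e: "inv\<^bsub>?Aut\<^esub> ?e = ?e" using ee e_Aut by (intro Aut.inv_equality)
  define H where "H = {\<phi> \<in> auto A. \<phi> ` F_B n = F_B n}"
  have P: "?P = ?Aut\<lparr>carrier := H\<rparr>" by (simp add: Aut_pair_def H_def)
  have inner_H: "inner A g \<in> H" if g: "g \<in> carrier A" for g
  proof -
    have "inner A g ` F_B n = (\<lambda>x. g \<cdot> x \<cdot> inv\<^sub>A g) ` F_B n"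
      by (intro image_cong) (simp_all add: inner_def F_B_iff)
    also have "\<dots> = F_B n"
    proof (intro equalityI subsetI)
      fix y assume "y \<in> (\<lambda>x. g \<cdot> x \<cdot> inv\<^sub>A g) ` F_B n"
      then obtain x where "x \<in> F_B n" "y = g \<cdot> x \<cdot> inv\<^sub>A g" by blast
      then show "y \<in> F_B n" using g by (simp add: F_B_iff)
    next
      fix y assume y: "y \<in> F_B n"
      then have c: "y \<in> carrier A" by (simp add: F_B_iff)
      have canc: "g \<cdot> (inv\<^sub>A g \<cdot> x) = x" if "x \<in> carrier A" for x
        using g that by (simp add: A.m_assoc[symmetric])
      have "y = g \<cdot> (inv\<^sub>A g \<cdot> y \<cdot> g) \<cdot> inv\<^sub>A g"
        using g c by (simp add: A.m_assoc canc)
      moreover have "inv\<^sub>A g \<cdot> y \<cdot> g \<in> F_B n" using g y by (simp add: F_B_iff)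
      ultimately show "y \<in> (\<lambda>x. g \<cdot> x \<cdot> inv\<^sub>A g) ` F_B n" by (rule image_eqI)
    qed
    finally show ?thesis using A.inner_auto[OF g] by (simp add: H_def)
  qed
  have e_H: "?e \<in> H" using e_auto epsilon_F_B by (simp add: H_def)
  have inner_ee: "inner A c \<otimes>\<^bsub>?Aut\<^esub> ?e \<in> H" if c: "c \<in> carrier A" for c
  proof -
    have m: "inner A c \<otimes>\<^bsub>?Aut\<^esub> ?e = compose (carrier A) (inner A c) ?e"
      using c by (intro AutoGroup_mult A.inner_auto e_auto)
    have "inner A c \<otimes>\<^bsub>?Aut\<^esub> ?e \<in> auto A"
      using Aut.m_closed[of "inner A c" ?e] A.inner_auto[OF c] e_auto by (simp only: AutoGroup_carrier)
    moreover have "compose (carrier A) (inner A c) ?e ` F_B n = inner A c ` (?e ` F_B n)"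
      unfolding image_image by (intro image_cong) (simp_all add: compose_def F_B_iff)
    then have "(inner A c \<otimes>\<^bsub>?Aut\<^esub> ?e) ` F_B n = F_B n"
      unfolding m epsilon_F_B using inner_H[OF c] by (simp add: H_def)
    ultimately show ?thesis by (simp add: H_def)
  qed
  have H_cases: "\<phi> \<in> Inn A \<or> (\<exists>i \<in> Inn A. \<phi> = i \<otimes>\<^bsub>?Aut\<^esub> ?e)" if phi: "\<phi> \<in> H" for \<phi>
  proof -
    have pa: "\<phi> \<in> auto A" "\<phi> ` F_B n = F_B n" using phi by (simp_all add: H_def)
    from F_automorphism_cases[OF assms pa] show ?thesis
    proof
      assume "\<exists>c \<in> carrier A. \<forall>a \<in> carrier A. \<phi> a = c \<cdot> a \<cdot> inv\<^sub>A c"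
      then obtain c where c: "c \<in> carrier A" "\<And>a. a \<in> carrier A \<Longrightarrow> \<phi> a = c \<cdot> a \<cdot> inv\<^sub>A c" by blast
      have "\<phi> = inner A c" by (rule auto_eqI[OF pa(1) A.inner_auto[OF c(1)]]) (simp add: inner_def c(2))
      then show ?thesis using c(1) by (simp add: Inn_inner)
    next
      assume "\<exists>c \<in> carrier A. \<forall>a \<in> carrier A. \<phi> (?e a) = c \<cdot> a \<cdot> inv\<^sub>A c"
      then obtain c where c: "c \<in> carrier A" "\<And>a. a \<in> carrier A \<Longrightarrow> \<phi> (?e a) = c \<cdot> a \<cdot> inv\<^sub>A c" by blast
      have m: "inner A c \<otimes>\<^bsub>?Aut\<^esub> ?e = compose (carrier A) (inner A c) ?e"
        using c(1) by (intro AutoGroup_mult A.inner_auto e_auto)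
      have "inner A c \<otimes>\<^bsub>?Aut\<^esub> ?e \<in> auto A" using inner_ee[OF c(1)] by (simp add: H_def)
      moreover have "\<phi> a = (inner A c \<otimes>\<^bsub>?Aut\<^esub> ?e) a" if a: "a \<in> carrier A" for a
      proof -
        have "\<phi> a = \<phi> (?e (?e a))" using epsilon_epsilon[OF n2 a] by simp
        also have "\<dots> = c \<cdot> ?e a \<cdot> inv\<^sub>A c" using a by (intro c(2)) simp
        also have "\<dots> = (inner A c \<otimes>\<^bsub>?Aut\<^esub> ?e) a" unfolding m using a by (simp add: compose_def inner_def)
        finally show ?thesis .
      qed
      ultimately have "\<phi> = inner A c \<otimes>\<^bsub>?Aut\<^esub> ?e" by (rule auto_eqI[OF pa(1)])
      then show ?thesis using c(1) by (auto simp: Inn_inner)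
    qed
  qed
  have Inn_auto: "Inn A \<subseteq> carrier ?Aut" using A.inner_auto by (auto simp: Inn_inner AutoGroup_carrier)
  interpret inn: group_hom A ?Aut "inner A" using A.inner_hom by unfold_locales
  have Inn_sub: "subgroup (Inn A) ?Aut" unfolding Inn_inner by (rule inn.img_is_subgroup)
  have Inn_H: "Inn A \<subseteq> H" using inner_H by (auto simp: Inn_inner)
  have H_eq: "H = generate ?Aut (Inn A \<union> {?e})"
  proof (intro equalityI subsetI)
    fix \<phi> assume "\<phi> \<in> H"
    from H_cases[OF this] show "\<phi> \<in> generate ?Aut (Inn A \<union> {?e})"
      by (auto intro: generate.incl generate.eng)
  next
    have grp: "subgroup (generate ?Aut (Inn A \<union> {?e})) ?Aut"
      using Inn_auto e_auto by (intro Aut.generate_is_subgroup) (simp add: AutoGroup_carrier)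
    have step: "s \<otimes>\<^bsub>?Aut\<^esub> \<psi> \<in> H" if s: "s \<in> H" and p: "\<psi> \<in> H" for s \<psi>
    proof -
      have sa: "s \<in> auto A" "\<psi> \<in> auto A" using s p by (simp_all add: H_def)
      have "compose (carrier A) s \<psi> ` F_B n = s ` (\<psi> ` F_B n)"
        unfolding image_image by (intro image_cong) (simp_all add: compose_def F_B_iff)
      moreover have "s \<otimes>\<^bsub>?Aut\<^esub> \<psi> \<in> auto A" using Aut.m_closed[of s \<psi>] sa by (simp only: AutoGroup_carrier)
      ultimately show ?thesis using s p AutoGroup_mult[OF sa] by (simp add: H_def)
    qed
    fix \<phi> assume "\<phi> \<in> generate ?Aut (Inn A \<union> {?e})"
    then show "\<phi> \<in> H"
    proof induction
      case one
      show ?case using Inn_H subgroup.one_closed[OF Inn_sub] by blast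
    next
      case (incl h)
      then show ?case using Inn_H e_H by blast
    next
      case (inv h)
      then show ?case using Inn_H e_H inv_e subgroup.m_inv_closed[OF Inn_sub] by auto
    next
      case (eng g h)
      then show ?case by (intro step)
    qed
  qed
  \<comment> \<open>Through the description by generators, closure under inverses comes for
    free.\<close>
  have H_sub: "subgroup H ?Aut" unfolding H_eq
    using Inn_auto e_auto by (intro Aut.generate_is_subgroup) (simp add: AutoGroup_carrier)
  interpret P: group ?P unfolding P by (rule Aut.subgroup_imp_group[OF H_sub])
  have P_simps: "carrier ?P = H" "monoid.mult ?P = monoid.mult ?Aut" "\<one>\<^bsub>?P\<^esub> = \<one>\<^bsub>?Aut\<^esub>"
    by (simp_all add: P)
  \<comment> \<open>Inner automorphisms preserve the degree of \<open>beta n 1\<close>, whereas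
    \<open>epsilon n\<close> changes its sign.\<close>
  have not_inner: "?e \<notin> Inn A"
  proof
    assume "?e \<in> Inn A"
    then obtain g where g: "g \<in> carrier A" "?e = inner A g" by (auto simp: Inn_inner)
    have b: "beta n 1 \<in> carrier A" using n2 by simp
    have "deg n 1 (?e (beta n 1)) = deg n 1 (beta n 1)"
      unfolding g(2) using b g(1) by (simp add: inner_def deg_mult deg_inv)
    moreover have "deg n 1 (?e (beta n 1)) = - deg n 1 (beta n 1)"
      using epsilon_beta[OF n2, of 1] n2 deg_inv[OF b] by simp
    moreover have "deg n 1 (beta n 1) = 1" using deg_beta[of 1 1] n2 by simp
    ultimately show False by simp
  qed
  have Inn_normal: "Inn A \<lhd> ?P"
    unfolding P.normal_inv_iff
  proof (intro conjI ballI)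
    show "subgroup (Inn A) ?P" unfolding P
      using Aut.subgroup_incl[OF Inn_sub H_sub Inn_H] .
    fix x i assume x: "x \<in> carrier ?P" and i: "i \<in> Inn A"
    obtain g where g: "g \<in> carrier A" "i = inner A g" using i by (auto simp: Inn_inner)
    have xa: "x \<in> auto A" using x by (simp add: P_simps H_def)
    interpret x: group_hom A A x using xa by unfold_locales (simp add: auto_def)
    have c: "inner A (x g) \<in> carrier ?P" using inner_H g(1) by (simp add: P_simps)
    have "x \<otimes>\<^bsub>?P\<^esub> i = inner A (x g) \<otimes>\<^bsub>?P\<^esub> x"
      unfolding P_simps g(2) using A.conj_inner[OF xa g(1)] .
    then have "x \<otimes>\<^bsub>?P\<^esub> i \<otimes>\<^bsub>?P\<^esub> inv\<^bsub>?P\<^esub> x = inner A (x g)"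
      using x c by (simp add: P.m_assoc)
    then show "x \<otimes>\<^bsub>?P\<^esub> i \<otimes>\<^bsub>?P\<^esub> inv\<^bsub>?P\<^esub> x \<in> Inn A" using g(1) by (simp add: Inn_inner)
  qed
  interpret split: split_index_two ?P "Inn A" ?e
    by (rule split_index_two.intro[OF P.is_group], rule split_index_two_axioms.intro)
      (use Inn_normal e_H ee not_inner H_cases in \<open>simp_all add: P_simps\<close>)
  have gen_e: "generate ?Aut {?e} = {\<one>\<^bsub>?P\<^esub>, ?e}"
  proof (intro equalityI)
    have "subgroup {\<one>\<^bsub>?Aut\<^esub>, ?e} ?Aut"
      by (rule Aut.subgroupI) (use ee inv_e e_Aut in auto)
    then show "generate ?Aut {?e} \<subseteq> {\<one>\<^bsub>?P\<^esub>, ?e}"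
      unfolding P_simps by (intro Aut.generate_subgroup_incl) auto
    show "{\<one>\<^bsub>?P\<^esub>, ?e} \<subseteq> generate ?Aut {?e}"
      unfolding P_simps by (auto intro: generate.one generate.incl)
  qed
  have inn_P: "inner A \<in> hom A ?P"
    using inner_H by (intro homI) (simp_all add: P_simps A.inner_mult)
  have "?P \<cong> semidirect (A Mod center A) C2 (epsilon_action n)"
  proof (rule split.semidirect_iso[OF group_artin_B inn_P])
    show "inner A ` carrier A = Inn A" by (simp add: Inn_inner)
    show "kernel A ?P (inner A) = center A"
      using A.inner_kernel by (simp add: kernel_def P_simps)
    show "epsilon_action n 0 X = X" for X by (simp add: epsilon_action_def)
    show "epsilon_action n 1 X = ?e ` X" for X by (simp add: epsilon_action_def)
    fix g assume g: "g \<in> carrier A"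
    then show eg: "?e g \<in> carrier A" by simp
    show "?e ` (center A #>\<^bsub>A\<^esub> g) = center A #>\<^bsub>A\<^esub> ?e g"
    proof -
      have rc: "center A #>\<^bsub>A\<^esub> h = (\<lambda>z. z \<cdot> h) ` center A" for h
        unfolding r_coset_def by blast
      have "?e ` (center A #>\<^bsub>A\<^esub> g) = (\<lambda>z. ?e z \<cdot> ?e g) ` center A"
        unfolding rc image_image by (intro image_cong refl e.hom_mult g) (simp_all add: center_def)
      also have "\<dots> = (\<lambda>z. z \<cdot> ?e g) ` (?e ` center A)" by (simp only: image_image)
      also have "\<dots> = center A #>\<^bsub>A\<^esub> ?e g" unfolding A.auto_center[OF e_auto] rc ..
      finally show ?thesis .
    qed
    have c: "inner A (?e g) \<in> carrier ?P" "?e \<in> carrier ?P" using inner_H[OF eg] e_H by (simp_all add: P_simps)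
    have "?e \<otimes>\<^bsub>?P\<^esub> inner A g = inner A (?e g) \<otimes>\<^bsub>?P\<^esub> ?e"
      unfolding P_simps using A.conj_inner[OF e_auto g] .
    then have "?e \<otimes>\<^bsub>?P\<^esub> inner A g \<otimes>\<^bsub>?P\<^esub> ?e = inner A (?e g)"
      using c split.e(2) by (simp add: P.m_assoc)
    then show "inner A (?e g) = ?e \<otimes>\<^bsub>?P\<^esub> inner A g \<otimes>\<^bsub>?P\<^esub> ?e" by simp
  qed
  then show ?thesis
    using H_eq split.internal_semidirect split.Mod_iso_C2
    by (simp only: P_simps(1) gen_e Out_pair_def)
qed

end
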